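(* Let $\rho>0$ and $n\in\mathbb{N}$, and let $f_1,\dots,f_n$ be holomorphic functions on $\overline{\rho\mathbb{D}}$ such that there exists some $\tilde z\in\rho\mathbb{D}$ with $\mathrm{res}_\lambda\left(G_d,\frac{\partial G_d}{\partial z}\right)(\tilde z)\neq0$, where $G_d(\lambda,z):=f_1(z)+\lambda f_2(z)+\dots+\lambda^{n-1}f_n(z)-\lambda^n$ for $(\lambda,z)\in\mathbb{C}\times\rho\overline{\mathbb{D}}$. Let $$A_d=\begin{pmatrix}0&I&0&\dots\\0&0&I&\dots\\ \vdots&\vdots&\vdots&\ddots\\ f_1(\partial_x)&f_2(\partial_x)&\dots&f_n(\partial_x)\end{pmatrix}:X_\rho^n\to X_\rho^n.$$ Then the following assertions are equivalent: (i) $A_d$ generates a sub-chaotic semigroup $(e^{tA_d})_{t\ge0}$ on $X_\rho^n$ such that the projection family $(\pi(e^{tA_d}):X_\rho^n\to X_\rho)_{t\ge0}$ is Devaney chaotic. (ii) There are some $\lambda_0\in i\mathbb{R}$, $z_0\in\rho\mathbb{D}$ such that $G_d(\lambda_0,z_0)=0$ and $\mathrm{res}_\lambda\left(G_d,\frac{\partial G_d}{\partial z}\right)(z_0)\neq0$. (iii) Every autonomous discretization of $(e^{tA_d})_{t\ge0}$ is Devaney sub-chaotic on $X_\rho^n$. (iv) Some autonomous discretization of $(e^{tA_d})_{t\ge0}$ is Devaney sub-chaotic on $X_\rho^n$.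
   Context: $\mathbb{D}=\{z\in\mathbb{C}:|z|<1\}$. For $\rho>0$ the Herzog space is $X_\rho=\{f:\mathbb{R}\to\mathbb{C}: f(x)=\sum_{k\ge0}\frac{a_k\rho^k}{k!}x^k,\ (a_k)_{k\ge0}\in c_0(\mathbb{N}_0)\}$ with norm $\|f\|=\sup_k|a_k|$. The derivative $\partial_x$ is bounded on $X_\rho$ with $\sigma(\partial_x)=\rho\overline{\mathbb{D}}$. "Holomorphic on $\overline{\rho\mathbb{D}}$" means holomorphic on a neighborhood of it; $f_i(\partial_x)$ is defined by the Riesz–Dunford functional calculus. Resultant: for fixed $z$, $G_d(\cdot,z)$ and $\frac{\partial G_d}{\partial z}(\cdot,z)$ are polynomials in $\lambda$ (of degree $n$ and of formal degree $n-1$); $\mathrm{res}_\lambda(G_d,\frac{\partial G_d}{\partial z})(z)$ is their resultant (determinant of the Sylvester matrix), which vanishes iff they have a common root (in particular it is $0$ if $\frac{\partial G_d}{\partial z}(\cdot,z)\equiv0$). An operator $T$ is Devaney chaotic if some orbit $\{T^kx:k\ge0\}$ is dense and its periodic points are dense. A $C_0$-semigroup $(T_t)$ is Devaney chaotic if $\{T_tx:t\ge0\}$ is dense for some $x$ and the set of $x$ with $T_tx=x$ for some $t>0$ is dense. An operator or semigroup is (Devaney) sub-chaotic, with respect to $Y$, if $Y\ne\{0\}$ is a closed invariant subspace on which its restriction is Devaney chaotic; sub-chaotic means for some such $Y$. With $\pi:X^n\to X$ the first coordinate projection, the projection family $(\pi\circ\mathcal{T}_t)_{t\ge0}$ of a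 $C_0$-semigroup $(\mathcal{T}_t)$ on $X^n$ is Devaney chaotic if $(\mathcal{T}_t)$ is sub-chaotic with respect to some closed invariant subspace $Y\neq\{0\}$ with $\overline{\pi(Y)}=X$. An autonomous discretization of $(\mathcal{T}_t)$ is the sequence of iterates of the operator $\mathcal{T}_{t_0}$ for a fixed $t_0>0$; it is sub-chaotic if the operator $\mathcal{T}_{t_0}$ is. *)

theory Defs
  imports
    "HOL-Complex_Analysis.Complex_Analysis"
    "HOL-Library.Function_Algebras"
    "Subresultants.Resultant_Prelim"
begin

section \<open>Complex vector spaces and normed subspaces\<close>

text \<open>
  The Herzog space depends on the real parameter \<open>\<rho>\<close>, so it cannot be a type. A normed space is
  given here by a carrier \<open>V\<close> inside a type of class \<open>complex_vector\<close> and a norm \<open>N\<close>; the values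
  of \<open>N\<close>, and of operators on the space, outside \<open>V\<close> are irrelevant.
\<close>

class complex_vector = ab_group_add +
  fixes scaleC :: "complex \<Rightarrow> 'a \<Rightarrow> 'a"  (infixr \<open>*\<^sub>C\<close> 75)
  assumes scaleC_add_right: "c *\<^sub>C (x + y) = c *\<^sub>C x + c *\<^sub>C y"
    and scaleC_add_left: "(b + c) *\<^sub>C x = b *\<^sub>C x + c *\<^sub>C x"
    and scaleC_scaleC: "b *\<^sub>C c *\<^sub>C x = (b * c) *\<^sub>C x"
    and scaleC_one: "1 *\<^sub>C x = x"

instantiation complex :: complex_vector
begin
definition scaleC_complex :: "complex \<Rightarrow> complex \<Rightarrow> complex"
  where "scaleC_complex c x = c * x"
instance by standard (auto simp: scaleC_complex_def algebra_simps)
end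

instantiation "fun" :: (type, complex_vector) complex_vector
begin
definition scaleC_fun :: "complex \<Rightarrow> ('a \<Rightarrow> 'b) \<Rightarrow> 'a \<Rightarrow> 'b"
  where "scaleC_fun c f = (\<lambda>x. c *\<^sub>C f x)"
instance
  by standard
    (auto simp: scaleC_fun_def fun_eq_iff scaleC_add_right scaleC_add_left scaleC_scaleC scaleC_one)
end

interpretation cvec: vector_space "scaleC :: complex \<Rightarrow> 'a \<Rightarrow> 'a::complex_vector"
  by standard (auto simp: scaleC_add_right scaleC_add_left scaleC_scaleC scaleC_one)

definition ntop :: "'v::complex_vector set \<Rightarrow> ('v \<Rightarrow> real) \<Rightarrow> 'v topology"
  where "ntop V N = Metric_space.mtopology V (\<lambda>x y. if x \<in> V \<and> y \<in> V then N (x - y) else 0)"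

definition bounded_op :: "'v::complex_vector set \<Rightarrow> ('v \<Rightarrow> real) \<Rightarrow> ('v \<Rightarrow> 'v) \<Rightarrow> bool"
  where "bounded_op V N T \<longleftrightarrow>
    (\<forall>x\<in>V. T x \<in> V) \<and>
    (\<forall>x\<in>V. \<forall>y\<in>V. T (x + y) = T x + T y) \<and>
    (\<forall>c. \<forall>x\<in>V. T (c *\<^sub>C x) = c *\<^sub>C T x) \<and>
    (\<exists>K. \<forall>x\<in>V. N (T x) \<le> K * N x)"

section \<open>Riesz--Dunford functional calculus\<close>

definition resolvent :: "'v::complex_vector set \<Rightarrow> ('v \<Rightarrow> 'v) \<Rightarrow> complex \<Rightarrow> 'v \<Rightarrow> 'v"
  where "resolvent V T \<zeta> = inv_into V (\<lambda>x. \<zeta> *\<^sub>C x - T x)"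

definition op_spectrum :: "'v::complex_vector set \<Rightarrow> ('v \<Rightarrow> real) \<Rightarrow> ('v \<Rightarrow> 'v) \<Rightarrow> complex set"
  where "op_spectrum V N T =
    {\<zeta>. \<not> (bij_betw (\<lambda>x. \<zeta> *\<^sub>C x - T x) V V \<and> bounded_op V N (resolvent V T \<zeta>))}"

text \<open>Henstock--Kurzweil integral over \<open>[0, 1]\<close>, with values in \<open>V\<close> and convergence in the norm
  \<open>N\<close>; same shape as the definition of \<^const>\<open>has_integral\<close>.\<close>

definition has_nintegral ::
    "'v::complex_vector set \<Rightarrow> ('v \<Rightarrow> real) \<Rightarrow> (real \<Rightarrow> 'v) \<Rightarrow> 'v \<Rightarrow> bool"
  where "has_nintegral V N F I \<longleftrightarrow>
    limitin (ntop V N) (\<lambda>p. \<Sum>(t, k)\<in>p. complex_of_real (measure lborel k) *\<^sub>C F t) I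
      (division_filter {0..1})"

text \<open>Counterpart of \<^const>\<open>contour_integral\<close>.\<close>

definition contour_nintegral ::
    "'v::complex_vector set \<Rightarrow> ('v \<Rightarrow> real) \<Rightarrow> (real \<Rightarrow> complex) \<Rightarrow> (complex \<Rightarrow> 'v) \<Rightarrow> 'v"
  where "contour_nintegral V N \<gamma> F =
    (THE I. has_nintegral V N (\<lambda>t. vector_derivative \<gamma> (at t within {0..1}) *\<^sub>C F (\<gamma> t)) I)"

text \<open>
  The operator \<open>f(T)\<close>, namely
  \<open>f(T) x = 1 / (2 \<pi> i) * \<ointegral> f(\<zeta>) (\<zeta> - T)\<^sup>-\<^sup>1 x d\<zeta>\<close>, for \<open>f\<close> holomorphic on a neighbourhood of a
  closed disc around \<open>0\<close> whose interior contains the spectrum of \<open>T\<close>. The contour is the positively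
  oriented boundary of such a disc; the value does not depend on the radius chosen.
\<close>

definition riesz_dunford_radius ::
    "'v::complex_vector set \<Rightarrow> ('v \<Rightarrow> real) \<Rightarrow> (complex \<Rightarrow> complex) \<Rightarrow> ('v \<Rightarrow> 'v) \<Rightarrow> real"
  where "riesz_dunford_radius V N f T =
    (SOME r. 0 < r \<and> op_spectrum V N T \<subseteq> ball 0 r \<and>
      (\<exists>U. open U \<and> cball 0 r \<subseteq> U \<and> f holomorphic_on U))"

definition riesz_dunford ::
    "'v::complex_vector set \<Rightarrow> ('v \<Rightarrow> real) \<Rightarrow> (complex \<Rightarrow> complex) \<Rightarrow> ('v \<Rightarrow> 'v) \<Rightarrow> 'v \<Rightarrow> 'v"
  where "riesz_dunford V N f T x =
    (1 / (2 * of_real pi * \<i>)) *\<^sub>C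
      contour_nintegral V N (circlepath 0 (riesz_dunford_radius V N f T))
        (\<lambda>\<zeta>. f \<zeta> *\<^sub>C resolvent V T \<zeta> x)"

section \<open>Semigroups\<close>

definition C0_semigroup ::
    "'v::complex_vector set \<Rightarrow> ('v \<Rightarrow> real) \<Rightarrow> (real \<Rightarrow> 'v \<Rightarrow> 'v) \<Rightarrow> bool"
  where "C0_semigroup V N S \<longleftrightarrow>
    (\<forall>t\<ge>0. bounded_op V N (S t)) \<and>
    (\<forall>x\<in>V. S 0 x = x) \<and>
    (\<forall>s\<ge>0. \<forall>t\<ge>0. \<forall>x\<in>V. S (s + t) x = S s (S t x)) \<and>
    (\<forall>x\<in>V. limitin (ntop V N) (\<lambda>t. S t x) x (at_right 0))"

text \<open>\<open>A\<close> is the generator of \<open>S\<close>, for an operator \<open>A\<close> with domain all of \<open>V\<close>.\<close>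

definition generates ::
    "'v::complex_vector set \<Rightarrow> ('v \<Rightarrow> real) \<Rightarrow> ('v \<Rightarrow> 'v) \<Rightarrow> (real \<Rightarrow> 'v \<Rightarrow> 'v) \<Rightarrow> bool"
  where "generates V N A S \<longleftrightarrow>
    C0_semigroup V N S \<and>
    (\<forall>x\<in>V. limitin (ntop V N) (\<lambda>h. complex_of_real (1 / h) *\<^sub>C (S h x - x)) (A x) (at_right 0))"

definition exp_semigroup ::
    "'v::complex_vector set \<Rightarrow> ('v \<Rightarrow> real) \<Rightarrow> ('v \<Rightarrow> 'v) \<Rightarrow> real \<Rightarrow> 'v \<Rightarrow> 'v"
  where "exp_semigroup V N A t x =
    (THE y. limitin (ntop V N) (\<lambda>m. \<Sum>k<m. complex_of_real (t ^ k / fact k) *\<^sub>C (A ^^ k) x) y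
       sequentially)"

section \<open>Chaos\<close>

definition closed_subspace :: "'v::complex_vector set \<Rightarrow> ('v \<Rightarrow> real) \<Rightarrow> 'v set \<Rightarrow> bool"
  where "closed_subspace V N Y \<longleftrightarrow> cvec.subspace Y \<and> closedin (ntop V N) Y"

definition chaotic_op :: "'v::complex_vector set \<Rightarrow> ('v \<Rightarrow> real) \<Rightarrow> ('v \<Rightarrow> 'v) \<Rightarrow> bool"
  where "chaotic_op V N T \<longleftrightarrow>
    (\<exists>x\<in>V. ntop V N closure_of {(T ^^ k) x | k. True} = V) \<and>
    ntop V N closure_of {x \<in> V. \<exists>k>0. (T ^^ k) x = x} = V"

definition subchaotic_op :: "'v::complex_vector set \<Rightarrow> ('v \<Rightarrow> real) \<Rightarrow> ('v \<Rightarrow> 'v) \<Rightarrow> bool"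
  where "subchaotic_op V N T \<longleftrightarrow>
    (\<exists>Y. closed_subspace V N Y \<and> Y \<noteq> {0} \<and> T ` Y \<subseteq> Y \<and> chaotic_op Y N T)"

definition chaotic_sg :: "'v::complex_vector set \<Rightarrow> ('v \<Rightarrow> real) \<Rightarrow> (real \<Rightarrow> 'v \<Rightarrow> 'v) \<Rightarrow> bool"
  where "chaotic_sg V N S \<longleftrightarrow>
    (\<exists>x\<in>V. ntop V N closure_of {S t x | t. t \<ge> 0} = V) \<and>
    ntop V N closure_of {x \<in> V. \<exists>t>0. S t x = x} = V"

definition subchaotic_sg_wrt ::
    "'v::complex_vector set \<Rightarrow> ('v \<Rightarrow> real) \<Rightarrow> (real \<Rightarrow> 'v \<Rightarrow> 'v) \<Rightarrow> 'v set \<Rightarrow> bool"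
  where "subchaotic_sg_wrt V N S Y \<longleftrightarrow>
    closed_subspace V N Y \<and> Y \<noteq> {0} \<and> (\<forall>t\<ge>0. S t ` Y \<subseteq> Y) \<and> chaotic_sg Y N S"

definition subchaotic_sg :: "'v::complex_vector set \<Rightarrow> ('v \<Rightarrow> real) \<Rightarrow> (real \<Rightarrow> 'v \<Rightarrow> 'v) \<Rightarrow> bool"
  where "subchaotic_sg V N S \<longleftrightarrow> (\<exists>Y. subchaotic_sg_wrt V N S Y)"

text \<open>
  An element of \<open>V\<^sup>n\<close> is a sequence supported on the index set \<open>{1..n}\<close>, and its norm is the maximum
  of the norms of the coordinates (any other product norm is equivalent).
\<close>

definition prod_space :: "nat \<Rightarrow> 'v::complex_vector set \<Rightarrow> (nat \<Rightarrow> 'v) set"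
  where "prod_space n V = {F. (\<forall>i\<in>{1..n}. F i \<in> V) \<and> (\<forall>i. i \<notin> {1..n} \<longrightarrow> F i = 0)}"

definition prod_norm :: "nat \<Rightarrow> ('v \<Rightarrow> real) \<Rightarrow> (nat \<Rightarrow> 'v) \<Rightarrow> real"
  where "prod_norm n N F = (MAX i\<in>{1..n}. N (F i))"

text \<open>Devaney chaos of the projection family \<open>(\<pi> \<circ> S\<^sub>t)\<close> of a semigroup \<open>S\<close> on \<open>V\<^sup>n\<close>, where
  \<open>\<pi> F = F 1\<close>.\<close>

definition chaotic_projection_family ::
    "nat \<Rightarrow> 'v::complex_vector set \<Rightarrow> ('v \<Rightarrow> real) \<Rightarrow> (real \<Rightarrow> (nat \<Rightarrow> 'v) \<Rightarrow> nat \<Rightarrow> 'v) \<Rightarrow> bool"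
  where "chaotic_projection_family n V N S \<longleftrightarrow>
    (\<exists>Y. subchaotic_sg_wrt (prod_space n V) (prod_norm n N) S Y \<and>
      ntop V N closure_of ((\<lambda>F. F 1) ` Y) = V)"

section \<open>The Herzog space\<close>

definition herzog_expansion :: "real \<Rightarrow> (real \<Rightarrow> complex) \<Rightarrow> (nat \<Rightarrow> complex) \<Rightarrow> bool"
  where "herzog_expansion \<rho> f a \<longleftrightarrow>
    a \<longlonglongrightarrow> 0 \<and> (\<forall>x. (\<lambda>k. a k * of_real (\<rho> ^ k / fact k) * of_real (x ^ k)) sums f x)"

definition herzog_space :: "real \<Rightarrow> (real \<Rightarrow> complex) set"
  where "herzog_space \<rho> = {f. \<exists>a. herzog_expansion \<rho> f a}"

definition herzog_coeff :: "real \<Rightarrow> (real \<Rightarrow> complex) \<Rightarrow> nat \<Rightarrow> complex"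
  where "herzog_coeff \<rho> f = (THE a. herzog_expansion \<rho> f a)"

definition herzog_norm :: "real \<Rightarrow> (real \<Rightarrow> complex) \<Rightarrow> real"
  where "herzog_norm \<rho> f = (SUP k. norm (herzog_coeff \<rho> f k))"

lemma herzog_expansion_diff:
  "herzog_expansion \<rho> f a \<Longrightarrow> herzog_expansion \<rho> g b \<Longrightarrow>
    herzog_expansion \<rho> (f - g) (\<lambda>k. a k - b k)"
  unfolding herzog_expansion_def left_diff_distrib minus_apply
  using tendsto_diff[of a 0 sequentially b 0] by (auto intro!: sums_diff)

lemma herzog_expansion_zero:
  assumes "\<rho> > 0" and "herzog_expansion \<rho> 0 a"
  shows "a k = 0"
proof -
  have real_case: "c k = 0"
    if c: "\<And>x. (\<lambda>k. c k * x ^ k) sums 0" for c :: "nat \<Rightarrow> real" and k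
  proof -
    have c0: "c 0 = 0"
      using c[of 0] powser_sums_zero_iff[of c 0] by simp
    show ?thesis
    proof (cases "k = 0")
      case False
      show ?thesis
      proof (rule ccontr)
        assume "c k \<noteq> 0"
        show False
        proof (rule powser_0_nonzero[of 1 0 c "\<lambda>_. 0" k])
          show "(\<lambda>n. c n * (x - 0) ^ n) sums 0" for x
            using c by simp
        next
          fix s :: real
          assume "s > 0" and s: "\<And>z::real. z \<in> cball 0 s - {0} \<Longrightarrow> (0::real) \<noteq> 0"
          then show False
            using s[of s] by simp
        qed (use \<open>c k \<noteq> 0\<close> False in auto)
      qed
    qed (use c0 in simp)
  qed
  define b where "b = (\<lambda>k. a k * of_real (\<rho> ^ k / fact k))"
  have s: "(\<lambda>k. b k * of_real (x ^ k)) sums 0" for x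
    using assms(2) by (simp add: herzog_expansion_def b_def)
  have parts: "Re (w * of_real y) = Re w * y" "Im (w * of_real y) = Im w * y" for w :: complex and y
    by simp_all
  have "Re (b k) = 0"
    by (rule real_case) (use sums_Re[OF s, unfolded parts(1)] in simp)
  moreover have "Im (b k) = 0"
    by (rule real_case) (use sums_Im[OF s, unfolded parts(2)] in simp)
  ultimately have "b k = 0"
    by (simp add: complex_eq_iff)
  then show ?thesis
    using assms(1) by (simp add: b_def)
qed

lemma herzog_coeff_eq:
  assumes "\<rho> > 0" and "herzog_expansion \<rho> f a"
  shows "herzog_coeff \<rho> f = a"
  unfolding herzog_coeff_def
proof (rule the_equality)
  fix b assume "herzog_expansion \<rho> f b"
  from herzog_expansion_zero[OF assms(1) herzog_expansion_diff[OF this assms(2), simplified]]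
  show "b = a" by (auto simp: fun_eq_iff)
qed fact

lemma Metric_space_herzog:
  assumes "\<rho> > 0"
  shows "Metric_space (herzog_space \<rho>)
    (\<lambda>x y. if x \<in> herzog_space \<rho> \<and> y \<in> herzog_space \<rho> then herzog_norm \<rho> (x - y) else 0)"
proof -
  define C where "C = herzog_coeff \<rho>"
  have C: "herzog_expansion \<rho> f (C f)" if "f \<in> herzog_space \<rho>" for f
    using that herzog_coeff_eq[OF assms] by (auto simp: herzog_space_def C_def)
  have norm_eq: "herzog_norm \<rho> (f - g) = (SUP k. norm (C f k - C g k))"
    and bdd: "bdd_above (range (\<lambda>k. norm (C f k - C g k)))"
    if "f \<in> herzog_space \<rho>" "g \<in> herzog_space \<rho>" for f g
  proof -
    have E: "herzog_expansion \<rho> (f - g) (\<lambda>k. C f k - C g k)"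
      using C that by (intro herzog_expansion_diff)
    show "herzog_norm \<rho> (f - g) = (SUP k. norm (C f k - C g k))"
      by (simp add: herzog_norm_def herzog_coeff_eq[OF assms E])
    have "Bseq (\<lambda>k. C f k - C g k)"
      using E by (auto simp: herzog_expansion_def intro: convergent_imp_Bseq convergentI)
    then show "bdd_above (range (\<lambda>k. norm (C f k - C g k)))"
      by (auto simp: Bseq_def bdd_above_def)
  qed
  have upper: "norm (C f k - C g k) \<le> herzog_norm \<rho> (f - g)"
    if "f \<in> herzog_space \<rho>" "g \<in> herzog_space \<rho>" for f g k
    unfolding norm_eq[OF that] by (intro cSUP_upper bdd that) auto
  have eqI: "f = g" if "f \<in> herzog_space \<rho>" "g \<in> herzog_space \<rho>" "C f = C g" for f g
  proof
    fix x show "f x = g x"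
      using C[OF that(1)] C[OF that(2)] unfolding that(3) herzog_expansion_def
      by (blast intro: sums_unique2)
  qed
  show ?thesis
  proof
    fix f g
    show "0 \<le> (if f \<in> herzog_space \<rho> \<and> g \<in> herzog_space \<rho> then herzog_norm \<rho> (f - g) else 0)"
      using upper[of f g 0] by (auto intro: order_trans[OF norm_ge_zero])
    show "(if f \<in> herzog_space \<rho> \<and> g \<in> herzog_space \<rho> then herzog_norm \<rho> (f - g) else 0) =
        (if g \<in> herzog_space \<rho> \<and> f \<in> herzog_space \<rho> then herzog_norm \<rho> (g - f) else 0)"
      by (auto simp: norm_eq norm_minus_commute)
  next
    fix f g assume fg: "f \<in> herzog_space \<rho>" "g \<in> herzog_space \<rho>"
    have "C f = C g" if "herzog_norm \<rho> (f - g) = 0"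
      using upper[OF fg] that by (auto simp: fun_eq_iff)
    moreover have "herzog_norm \<rho> (f - f) = 0"
      using norm_eq[OF fg(1) fg(1)] by simp
    ultimately show "(if f \<in> herzog_space \<rho> \<and> g \<in> herzog_space \<rho> then herzog_norm \<rho> (f - g)
        else 0) = 0 \<longleftrightarrow> f = g"
      using fg eqI by auto
  next
    fix f g h
    assume fgh: "f \<in> herzog_space \<rho>" "g \<in> herzog_space \<rho>" "h \<in> herzog_space \<rho>"
    have "norm (C f k - C h k) \<le> herzog_norm \<rho> (f - g) + herzog_norm \<rho> (g - h)" for k
      using upper[OF fgh(1,2), of k] upper[OF fgh(2,3), of k]
        norm_triangle_ineq[of "C f k - C g k" "C g k - C h k"] by simp
    then have "herzog_norm \<rho> (f - h) \<le> herzog_norm \<rho> (f - g) + herzog_norm \<rho> (g - h)"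
      unfolding norm_eq[OF fgh(1,3)] by (intro cSUP_least) auto
    then show "(if f \<in> herzog_space \<rho> \<and> h \<in> herzog_space \<rho> then herzog_norm \<rho> (f - h) else 0) \<le>
        (if f \<in> herzog_space \<rho> \<and> g \<in> herzog_space \<rho> then herzog_norm \<rho> (f - g) else 0) +
        (if g \<in> herzog_space \<rho> \<and> h \<in> herzog_space \<rho> then herzog_norm \<rho> (g - h) else 0)"
      using fgh by simp
  qed
qed

definition diff_op :: "(real \<Rightarrow> complex) \<Rightarrow> real \<Rightarrow> complex"
  where "diff_op f = (\<lambda>x. vector_derivative f (at x))"

section \<open>The companion operator and its symbol\<close>

text \<open>The coefficient functions \<open>f 1, \<dots>, f n\<close> are indexed from \<open>1\<close>.\<close>

definition companion_op ::
    "real \<Rightarrow> nat \<Rightarrow> (nat \<Rightarrow> complex \<Rightarrow> complex) \<Rightarrow> (nat \<Rightarrow> real \<Rightarrow> complex) \<Rightarrow> nat \<Rightarrow> real \<Rightarrow> complex"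
  where "companion_op \<rho> n f F i =
    (if 1 \<le> i \<and> i < n then F (i + 1)
     else if i = n then
       (\<Sum>j=1..n. riesz_dunford (herzog_space \<rho>) (herzog_norm \<rho>) (f j) diff_op (F j))
     else 0)"

definition Gd :: "nat \<Rightarrow> (nat \<Rightarrow> complex \<Rightarrow> complex) \<Rightarrow> complex \<Rightarrow> complex \<Rightarrow> complex"
  where "Gd n f l z = (\<Sum>j=1..n. l ^ (j - 1) * f j z) - l ^ n"

text \<open>\<open>G\<^sub>d\<close> and its partial derivative in \<open>z\<close>, as polynomials in \<open>\<lambda>\<close> for fixed \<open>z\<close>.\<close>

definition Gd_poly :: "nat \<Rightarrow> (nat \<Rightarrow> complex \<Rightarrow> complex) \<Rightarrow> complex \<Rightarrow> complex poly"
  where "Gd_poly n f z = (\<Sum>j=1..n. monom (f j z) (j - 1)) - monom 1 n"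

definition dGd_poly :: "nat \<Rightarrow> (nat \<Rightarrow> complex \<Rightarrow> complex) \<Rightarrow> complex \<Rightarrow> complex poly"
  where "dGd_poly n f z = (\<Sum>j=1..n. monom (deriv (f j) z) (j - 1))"

lemma poly_Gd_poly: "poly (Gd_poly n f z) l = Gd n f l z"
  by (simp add: Gd_poly_def Gd_def poly_sum poly_monom mult.commute)

lemma deriv_Gd:
  assumes "\<And>j. j \<in> {1..n} \<Longrightarrow> f j field_differentiable at z"
  shows "deriv (Gd n f l) z = poly (dGd_poly n f z) l"
proof -
  have "((\<lambda>w. (\<Sum>j=1..n. l ^ (j - 1) * f j w) - l ^ n) has_field_derivative
      (\<Sum>j=1..n. l ^ (j - 1) * deriv (f j) z) - 0) (at z)"
    by (intro DERIV_diff DERIV_sum DERIV_cmult DERIV_const)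
      (use assms in \<open>auto simp: field_differentiable_derivI\<close>)
  moreover have "Gd n f l = (\<lambda>w. (\<Sum>j=1..n. l ^ (j - 1) * f j w) - l ^ n)"
    by (simp add: Gd_def fun_eq_iff)
  ultimately show ?thesis
    by (simp add: DERIV_imp_deriv dGd_poly_def poly_sum poly_monom mult.commute)
qed

text \<open>The Sylvester determinant for the formal degrees \<open>n\<close> and \<open>n - 1\<close>.\<close>

definition res_Gd :: "nat \<Rightarrow> (nat \<Rightarrow> complex \<Rightarrow> complex) \<Rightarrow> complex \<Rightarrow> complex"
  where "res_Gd n f z =
    Determinant.det (sylvester_mat_sub n (n - 1) (Gd_poly n f z) (dGd_poly n f z))"

end

theory Submission
  imports Defs
begin

text \<open>
  An element of \<open>X\<^sub>\<rho>\<^sup>n\<close> is a bounded double sequence \<open>w (i, k)\<close>: row \<open>i\<close> lists the coefficients of the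
  \<open>i\<close>-th coordinate, and the norms agree. On such arrays differentiation is the operator \<open>D\<close>,
  \<open>\<rho>\<close> times the backward shift of the rows, the operator \<open>f\<^sub>j(\<partial>\<^sub>x)\<close> of the Riesz--Dunford calculus is the power series of
  \<open>f\<^sub>j\<close> evaluated at \<open>D\<close> (\<open>riesz_dunford_diff_op\<close>), and \<open>A\<^sub>d\<close> becomes a bounded operator \<open>A\<close> on a
  Banach space of arrays whose exponential is again a power series. All analysis takes place there;
  the locale \<open>isometric_model\<close> carries the topological notions back to \<open>X\<^sub>\<rho>\<^sup>n\<close>.

  The link with \<open>G\<^sub>d\<close> is that an eigenvector of \<open>A\<close> for \<open>\<lambda>\<close> has rows \<open>u, \<lambda>u, \<dots>, \<lambda>\<^bsup>n-1\<^esup>u\<close>, where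
  \<open>u\<close> is annihilated by the power series \<open>G\<^sub>d(\<lambda>, D)\<close>. The eigenvectors of \<open>D\<close> are the coefficient
  sequences \<open>((z/\<rho>)\<^sup>k)\<^sub>k\<close> of \<open>exp(z x)\<close>, which tend to zero exactly for \<open>|z| < \<rho>\<close>; so every root
  \<open>G\<^sub>d(\<lambda>, z) = 0\<close> with \<open>|z| < \<rho>\<close> gives an eigenvector.

  Chaos implies a root on the imaginary axis. Density of the periodic points produces a vector
  \<open>x \<noteq> 0\<close> with \<open>exp(s A) x = x\<close> for some \<open>s > 0\<close>, that is, in the kernel of the power series
  \<open>exp(s z) - 1\<close> of \<open>A\<close>. Such a series has finitely many zeros in a disc around the spectrum;
  dividing them out one at a time ends at an eigenvector whose eigenvalue is a zero of the series
  (\<open>opcalc_kernel_imp_eigenvector\<close>). So \<open>A\<close> has an eigenvalue \<open>\<lambda>\<close> in \<open>i\<real>\<close>, and the same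
  lemma for \<open>D\<close> and \<open>G\<^sub>d(\<lambda>, \<cdot>)\<close> yields \<open>z\<close> with \<open>|z| < \<rho>\<close> and \<open>G\<^sub>d(\<lambda>, z) = 0\<close>. If the resultant
  vanishes at \<open>z\<close>, then, its zeros being isolated by hypothesis, Hurwitz' theorem moves the root off them while
  \<open>\<lambda>\<close> moves along \<open>i\<real>\<close> (\<open>Gd_root_perturbation\<close>).

  Conversely let \<open>G\<^sub>d(\<lambda>\<^sub>0, z\<^sub>0) = 0\<close> with \<open>\<lambda>\<^sub>0\<close> in \<open>i\<real>\<close> and nonzero resultant at \<open>z\<^sub>0\<close>. Then the
  derivative of \<open>G\<^sub>d\<close> in \<open>z\<close> does not vanish, and the implicit function theorem gives a holomorphic curve
  of roots \<open>z(\<lambda>)\<close> and with it a holomorphic family \<open>F(\<lambda>)\<close> of eigenvectors. Let \<open>Y\<close> be the closed span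
  of the Taylor coefficients of \<open>F\<close> at \<open>\<lambda>\<^sub>0\<close>. By the identity theorem \<open>Y\<close> is also the closed span of
  \<open>F(\<lambda>)\<close> for \<open>\<lambda>\<close> in any set that accumulates at \<open>\<lambda>\<^sub>0\<close>. The sets \<open>Re \<lambda> < 0\<close> and \<open>Re \<lambda> > 0\<close> give
  a dense orbit of \<open>exp(t A)\<close> on \<open>Y\<close> by the Godefroy--Shapiro argument, and the \<open>\<lambda>\<close> for which
  \<open>exp(t \<lambda>)\<close> is a root of unity give dense periodic points, for each \<open>t > 0\<close>. The first rows of
  the vectors \<open>F(\<lambda>)\<close> are the exponentials for the points \<open>z(\<lambda>)\<close>, which accumulate at
  \<open>z\<^sub>0\<close>; so the closure of the first projection of \<open>Y\<close> contains all exponentials and all of \<open>X\<^sub>\<rho>\<close>.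
\<close>

section \<open>Complex Banach spaces of bounded functions\<close>

text \<open>Complex multiplication comes from a class without a norm; this class ties the two together.\<close>

class complex_normed = real_normed_vector + complex_vector +
  assumes scaleR_scaleC: "r *\<^sub>R x = complex_of_real r *\<^sub>C x"
    and norm_scaleC: "norm (c *\<^sub>C x) = cmod c * norm x"

instance complex :: complex_normed
  by standard (auto simp: scaleC_complex_def scaleR_conv_of_real norm_mult)

lemma bounded_bilinear_scaleC:
  "bounded_bilinear (scaleC :: complex \<Rightarrow> 'a \<Rightarrow> 'a::complex_normed)"
proof
  show "\<exists>K. \<forall>a (b::'a). norm (a *\<^sub>C b) \<le> norm a * norm b * K"
    by (rule exI[of _ 1]) (simp add: norm_scaleC)
qed (simp_all add: scaleC_add_left scaleC_add_right scaleR_scaleC scaleC_scaleC mult.commute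
      scaleC_complex_def)

lemmas tendsto_scaleC [tendsto_intros] = bounded_bilinear.tendsto[OF bounded_bilinear_scaleC]
lemmas continuous_on_scaleC [continuous_intros] =
  bounded_bilinear.continuous_on[OF bounded_bilinear_scaleC]
lemmas bounded_linear_scaleC_right = bounded_bilinear.bounded_linear_right[OF bounded_bilinear_scaleC]
lemmas bounded_linear_scaleC_left = bounded_bilinear.bounded_linear_left[OF bounded_bilinear_scaleC]

instantiation bcontfun :: (topological_space, complex_normed) complex_normed
begin

definition scaleC_bcontfun :: "complex \<Rightarrow> 'a \<Rightarrow>\<^sub>C 'b \<Rightarrow> 'a \<Rightarrow>\<^sub>C 'b"
  where "scaleC_bcontfun c f = Bcontfun (\<lambda>x. c *\<^sub>C f x)"

lemma apply_scaleC_bcontfun [simp]: "apply_bcontfun (c *\<^sub>C f) x = c *\<^sub>C apply_bcontfun f x"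
proof -
  have "(\<lambda>x. c *\<^sub>C f x) \<in> bcontfun"
    by (rule bcontfun_normI[where b = "cmod c * norm f"])
       (auto intro!: continuous_intros mult_left_mono norm_bounded simp: norm_scaleC)
  then show ?thesis by (simp add: scaleC_bcontfun_def Bcontfun_inverse)
qed

instance
proof
  fix c :: complex and f :: "'a \<Rightarrow>\<^sub>C 'b"
  have le: "norm (a *\<^sub>C g) \<le> cmod a * norm g" for a :: complex and g :: "'a \<Rightarrow>\<^sub>C 'b"
    by (rule norm_bound) (auto simp: norm_scaleC intro!: mult_left_mono norm_bounded)
  show "norm (c *\<^sub>C f) = cmod c * norm f"
  proof (cases "c = 0")
    case True
    then show ?thesis using le[of c f] by simp
  next
    case False
    have "norm f = norm (inverse c *\<^sub>C c *\<^sub>C f)"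
      using False by (intro arg_cong[of _ _ norm] bcontfun_eqI) (simp add: scaleC_scaleC scaleC_one)
    also have "\<dots> \<le> norm (c *\<^sub>C f) / cmod c"
      using le[of "inverse c" "c *\<^sub>C f"] by (simp add: norm_inverse inverse_eq_divide norm_divide)
    finally have "cmod c * norm f \<le> norm (c *\<^sub>C f)"
      using False by (simp add: pos_le_divide_eq mult.commute)
    then show ?thesis using le[of c f] by simp
  qed
qed (auto intro!: bcontfun_eqI
      simp: scaleC_add_right scaleC_add_left scaleC_scaleC scaleC_one scaleR_scaleC)

end

section \<open>Power series of a bounded operator\<close>

lemma eval_fps_eq_imp_eq:
  fixes F G :: "complex fps"
  assumes "r > 0" "fps_conv_radius F > 0" "fps_conv_radius G > 0"
    and eq: "\<And>z. norm z < r \<Longrightarrow> eval_fps F z = eval_fps G z"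
  shows "F = G"
proof -
  have "eventually (\<lambda>z. eval_fps F z = eval_fps G z) (nhds 0)"
    using eventually_nhds_in_open[of "ball 0 r" 0] \<open>r > 0\<close>
    by (auto elim!: eventually_mono simp: eq[symmetric])
  then have "eval_fps F has_fps_expansion G"
    using assms by (auto simp: has_fps_expansion_def elim: eventually_mono)
  then show ?thesis
    using fps_expansion_unique_complex[of "eval_fps F" F G] assms eval_fps_has_fps_expansion[of F]
    by blast
qed

text \<open>
  \<open>F(T) x\<close>. If the radius of convergence exceeds a bound of the norm of \<open>T\<close>, the series converges
  absolutely for every \<open>x\<close>.
\<close>

definition opcalc :: "complex fps \<Rightarrow> ('w \<Rightarrow> 'w) \<Rightarrow> 'w \<Rightarrow> 'w::complex_normed"
  where "opcalc F T x = (\<Sum>m. fps_nth F m *\<^sub>C (T ^^ m) x)"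

locale bounded_operator =
  fixes T :: "'w::{complex_normed,banach} \<Rightarrow> 'w" and R :: real
  assumes op_add: "T (x + y) = T x + T y"
    and op_scaleC: "T (c *\<^sub>C x) = c *\<^sub>C T x"
    and op_bound: "norm (T x) \<le> R * norm x"
    and op_bound_nonneg: "0 \<le> R"
begin

lemma op_zero [simp]: "T 0 = 0"
  using op_scaleC[of 0 0] by simp

lemma pow_add: "(T ^^ m) (x + y) = (T ^^ m) x + (T ^^ m) y"
  by (induction m) (simp_all add: op_add)

lemma pow_scaleC: "(T ^^ m) (c *\<^sub>C x) = c *\<^sub>C (T ^^ m) x"
  by (induction m) (simp_all add: op_scaleC)

lemma pow_bound: "norm ((T ^^ m) x) \<le> R ^ m * norm x"
proof (induction m)
  case (Suc m)
  have "norm (T ((T ^^ m) x)) \<le> R * norm ((T ^^ m) x)" by (rule op_bound)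
  also have "\<dots> \<le> R * (R ^ m * norm x)"
    using Suc by (intro mult_left_mono op_bound_nonneg)
  finally show ?case by (simp add: mult.assoc)
qed simp

lemma pow_bounded_linear: "bounded_linear (T ^^ m)"
  by (rule bounded_linear_intro[where K = "R ^ m"])
     (use pow_bound in \<open>simp_all add: pow_add pow_scaleC scaleR_scaleC mult.commute\<close>)

lemma op_bounded_linear: "bounded_linear T"
  using pow_bounded_linear[of 1] by simp

context
  fixes F :: "complex fps"
  assumes F: "fps_conv_radius F > R"
begin

lemma summable_coeffs: "summable (\<lambda>m. cmod (fps_nth F m) * R ^ m)"
  using norm_summable_fps[of "of_real R" F] F op_bound_nonneg
  by (simp add: norm_mult norm_power)

lemma opcalc_term_bound: "norm (fps_nth F m *\<^sub>C (T ^^ m) x) \<le> cmod (fps_nth F m) * R ^ m * norm x"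
  using mult_left_mono[OF pow_bound[of m x], of "cmod (fps_nth F m)"]
  by (simp add: norm_scaleC mult.assoc)

lemma summable_opcalc_norm: "summable (\<lambda>m. norm (fps_nth F m *\<^sub>C (T ^^ m) x))"
  by (rule summable_comparison_test'[OF summable_mult2[OF summable_coeffs, of "norm x"]])
     (use opcalc_term_bound in simp)

lemma opcalc_sums: "(\<lambda>m. fps_nth F m *\<^sub>C (T ^^ m) x) sums opcalc F T x"
  unfolding opcalc_def by (rule summable_sums[OF summable_norm_cancel[OF summable_opcalc_norm]])

lemma opcalc_bound: "norm (opcalc F T x) \<le> (\<Sum>m. cmod (fps_nth F m) * R ^ m) * norm x"
proof -
  have "norm (opcalc F T x) \<le> (\<Sum>m. norm (fps_nth F m *\<^sub>C (T ^^ m) x))"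
    unfolding opcalc_def by (intro summable_norm summable_opcalc_norm)
  also have "\<dots> \<le> (\<Sum>m. cmod (fps_nth F m) * R ^ m * norm x)"
    by (intro suminf_le summable_opcalc_norm summable_mult2 summable_coeffs opcalc_term_bound)
  also have "\<dots> = (\<Sum>m. cmod (fps_nth F m) * R ^ m) * norm x"
    by (simp add: suminf_mult2[OF summable_coeffs])
  finally show ?thesis .
qed

lemma opcalc_add: "opcalc F T (x + y) = opcalc F T x + opcalc F T y"
  by (rule sums_unique2[OF opcalc_sums])
     (use sums_add[OF opcalc_sums opcalc_sums, of x y] in \<open>simp add: pow_add scaleC_add_right\<close>)

lemma opcalc_scaleC: "opcalc F T (c *\<^sub>C x) = c *\<^sub>C opcalc F T x"
  by (rule sums_unique2[OF opcalc_sums])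
     (use bounded_linear.sums[OF bounded_linear_scaleC_right opcalc_sums, of c x]
       in \<open>simp add: pow_scaleC scaleC_scaleC mult.commute\<close>)

lemma opcalc_operator: "bounded_operator (opcalc F T) (\<Sum>m. cmod (fps_nth F m) * R ^ m)"
  by standard
     (auto simp: opcalc_add opcalc_scaleC opcalc_bound op_bound_nonneg intro!: suminf_nonneg summable_coeffs)

lemma opcalc_eigenvector:
  assumes "T v = \<mu> *\<^sub>C v" "cmod \<mu> < fps_conv_radius F"
  shows "opcalc F T v = eval_fps F \<mu> *\<^sub>C v"
proof -
  have pow: "(T ^^ m) v = \<mu> ^ m *\<^sub>C v" for m
    by (induction m) (simp_all add: scaleC_one op_scaleC assms scaleC_scaleC mult.commute)
  have "(\<lambda>m. (fps_nth F m * \<mu> ^ m) *\<^sub>C v) sums (eval_fps F \<mu> *\<^sub>C v)"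
    unfolding eval_fps_def
    by (intro bounded_linear.sums[OF bounded_linear_scaleC_left] summable_sums summable_fps assms)
  then show ?thesis
    by (intro sums_unique2[OF opcalc_sums]) (simp add: pow scaleC_scaleC)
qed

lemma opcalc_closed_invariant:
  assumes E: "cvec.subspace E" "closed E" and inv: "\<And>x. x \<in> E \<Longrightarrow> T x \<in> E" and "x \<in> E"
  shows "opcalc F T x \<in> E"
proof -
  have pow: "(T ^^ m) x \<in> E" for m
    by (induction m) (auto simp: inv \<open>x \<in> E\<close>)
  have "(\<lambda>k. \<Sum>m<k. fps_nth F m *\<^sub>C (T ^^ m) x) \<longlonglongrightarrow> opcalc F T x"
    using opcalc_sums by (simp add: sums_def)
  then show ?thesis
    by (rule closed_sequentially[OF E(2), rotated])
       (intro cvec.subspace_sum cvec.subspace_scale E pow)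
qed

end

text \<open>
  Both sides sum the absolutely summable family \<open>F\<^sub>i G\<^sub>j T\<^bsup>i+j\<^esup> x\<close>, one by antidiagonals and one by
  rows.
\<close>

lemma opcalc_mult:
  assumes F: "fps_conv_radius F > R" and G: "fps_conv_radius G > R"
  shows "opcalc (F * G) T x = opcalc F T (opcalc G T x)"
proof -
  have FG: "fps_conv_radius (F * G) > R"
    using assms fps_conv_radius_mult[of F G] by (auto simp: min_def intro: less_le_trans split: if_splits)
  define t where "t = (\<lambda>i j. (fps_nth F i * fps_nth G j) *\<^sub>C (T ^^ (i + j)) x)"
  have t_sums: "(\<lambda>j. t i j) sums (fps_nth F i *\<^sub>C (T ^^ i) (opcalc G T x))" for i
    using bounded_linear.sums[OF bounded_linear_scaleC_right
        bounded_linear.sums[OF pow_bounded_linear opcalc_sums[OF G]], of "fps_nth F i" i x]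
    by (simp add: t_def pow_scaleC scaleC_scaleC funpow_add)
  have t_norm: "norm (t i j) \<le> (cmod (fps_nth F i) * R ^ i) * (cmod (fps_nth G j) * R ^ j * norm x)" for i j
    using mult_left_mono[OF pow_bound[of "i + j" x], of "cmod (fps_nth F i) * cmod (fps_nth G j)"]
    by (simp add: t_def norm_scaleC norm_mult power_add mult_ac)
  define u where "u = (\<lambda>i. cmod (fps_nth F i) * R ^ i)"
  define v where "v = (\<lambda>j. cmod (fps_nth G j) * R ^ j * norm x)"
  have nonneg: "u i \<ge> 0" "v i \<ge> 0" for i
    using op_bound_nonneg by (auto simp: u_def v_def)
  have su: "u summable_on UNIV" and sv: "v summable_on UNIV"
    using nonneg summable_coeffs[OF F] summable_mult2[OF summable_coeffs[OF G], of "norm x"]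
    by (auto simp: u_def v_def summable_on_UNIV_nonneg_real_iff)
  have "(\<lambda>(i, j). u i * v j) summable_on UNIV \<times> UNIV"
    by (rule summable_on_SigmaI[where g = "\<lambda>i. u i * infsum v UNIV"])
       (use su sv nonneg in \<open>auto intro!: has_sum_cmult_right summable_on_cmult_left has_sum_infsum\<close>)
  then have "(\<lambda>p. norm (case p of (i, j) \<Rightarrow> t i j)) summable_on UNIV \<times> UNIV"
    by (rule Infinite_Sum.abs_summable_on_comparison_test') (use t_norm in \<open>auto simp: u_def v_def\<close>)
  then have t_on: "(\<lambda>(i, j). t i j) summable_on UNIV \<times> UNIV"
    by (rule abs_summable_summable)
  have "(\<lambda>j. t i j) summable_on UNIV" for i
    by (rule norm_summable_imp_summable_on, rule summable_comparison_test'[where g = "\<lambda>j. u i * v j"])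
       (use sv nonneg t_norm in \<open>auto simp: u_def v_def summable_on_UNIV_nonneg_real_iff
         intro!: summable_mult\<close>)
  then have row: "infsum (t i) UNIV = fps_nth F i *\<^sub>C (T ^^ i) (opcalc G T x)" for i
    using t_sums by (meson has_sum_imp_sums has_sum_infsum sums_unique2)
  let ?D = "SIGMA k:(UNIV::nat set). {..k}"
  \<comment> \<open>The antidiagonal of index k is the set of pairs (i, k - i) with i at most k.\<close>
  have bij: "bij_betw (\<lambda>(k, i). (i, k - i)) ?D (UNIV \<times> UNIV)"
    by (rule bij_betw_byWitness[where f' = "\<lambda>(i, j). (i + j, i)"]) auto
  have d_on: "(\<lambda>(k, i). t i (k - i)) summable_on ?D"
    using summable_on_reindex_bij_betw[OF bij, of "\<lambda>(i, j). t i j"] t_on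
    by (simp add: case_prod_unfold)
  have diag: "infsum (\<lambda>i. t i (k - i)) {..k} = fps_nth (F * G) k *\<^sub>C (T ^^ k) x" for k
    by (simp add: fps_mult_nth t_def atMost_atLeast0 cvec.scale_sum_left)
  have "infsum (\<lambda>k. fps_nth (F * G) k *\<^sub>C (T ^^ k) x) UNIV = infsum (\<lambda>(k, i). t i (k - i)) ?D"
    using infsum_Sigma'_banach[OF d_on] by (simp add: diag)
  also have "\<dots> = infsum (\<lambda>(i, j). t i j) (UNIV \<times> UNIV)"
    using infsum_reindex_bij_betw[OF bij, of "\<lambda>(i, j). t i j"] by (simp add: case_prod_unfold)
  also have "\<dots> = infsum (\<lambda>i. fps_nth F i *\<^sub>C (T ^^ i) (opcalc G T x)) UNIV"
    using infsum_Sigma'_banach[OF t_on] by (simp add: row)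
  finally have *: "infsum (\<lambda>k. fps_nth (F * G) k *\<^sub>C (T ^^ k) x) UNIV =
      infsum (\<lambda>i. fps_nth F i *\<^sub>C (T ^^ i) (opcalc G T x)) UNIV" .
  have "infsum (\<lambda>k. fps_nth H k *\<^sub>C (T ^^ k) y) UNIV = opcalc H T y"
    if "fps_conv_radius H > R" for H y
    using norm_summable_imp_has_sum[OF summable_opcalc_norm opcalc_sums] that
    by (meson infsumI)
  then show ?thesis using * F FG by simp
qed

lemma opcalc_finite:
  assumes "\<And>m. m \<ge> k \<Longrightarrow> fps_nth F m = 0"
  shows "opcalc F T x = (\<Sum>m<k. fps_nth F m *\<^sub>C (T ^^ m) x)"
  unfolding opcalc_def by (rule suminf_finite) (use assms in auto)

lemma opcalc_one [simp]: "opcalc 1 T x = x"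
  by (subst opcalc_finite[of 1]) (auto simp: scaleC_one)

lemma opcalc_X_diff_const: "opcalc (fps_X - fps_const c) T x = T x - c *\<^sub>C x"
  by (subst opcalc_finite[of 2]) (auto simp: numeral_2_eq_2 scaleC_one)

lemma opcalc_X_power_mult:
  assumes G: "fps_conv_radius G > R"
  shows "opcalc ((fps_X - fps_const c) ^ k * G) T x = opcalc G T (((\<lambda>y. T y - c *\<^sub>C y) ^^ k) x)"
proof (induction k arbitrary: x)
  case (Suc k)
  have inf: "fps_conv_radius (fps_X - fps_const c) = \<infinity>"
    using fps_conv_radius_diff[of fps_X "fps_const c"] by (simp add: min_def)
  have H: "fps_conv_radius ((fps_X - fps_const c) ^ k * G) > R"
  proof -
    have "fps_conv_radius ((fps_X - fps_const c) ^ k) = \<infinity>"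
      using fps_conv_radius_power[of "fps_X - fps_const c" k] inf by simp
    then show ?thesis
      using G fps_conv_radius_mult[of "(fps_X - fps_const c) ^ k" G]
      by (auto simp: min_def intro: less_le_trans split: if_splits)
  qed
  have "opcalc ((fps_X - fps_const c) ^ Suc k * G) T x =
      opcalc (((fps_X - fps_const c) ^ k * G) * (fps_X - fps_const c)) T x"
    by (simp add: mult_ac)
  also have "\<dots> = opcalc ((fps_X - fps_const c) ^ k * G) T (T x - c *\<^sub>C x)"
    by (subst opcalc_mult) (use H inf in \<open>auto simp: opcalc_X_diff_const\<close>)
  also have "\<dots> = opcalc G T (((\<lambda>y. T y - c *\<^sub>C y) ^^ Suc k) x)"
    by (subst Suc) (simp add: funpow_Suc_right del: funpow.simps)
  finally show ?case .
qed simp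

end

section \<open>Eigenvectors from the kernel of a power series\<close>

lemma cball_subset_open_imp_larger_ball:
  fixes U :: "'a::euclidean_space set"
  assumes "open U" "cball 0 R \<subseteq> U" "R \<ge> 0"
  obtains r where "r > R" "ball 0 r \<subseteq> U"
proof -
  obtain \<epsilon> where \<epsilon>: "\<epsilon> > 0" "(\<Union>x\<in>cball 0 R. ball x \<epsilon>) \<subseteq> U"
    using compact_subset_open_imp_ball_epsilon_subset[OF compact_cball assms(1,2)] by blast
  have "z \<in> U" if z: "norm z < R + \<epsilon>" for z
  proof (cases "norm z \<le> R")
    case False
    define x where "x = (R / norm z) *\<^sub>R z"
    have "z \<noteq> 0" using False \<open>R \<ge> 0\<close> by auto
    have "x - z = (R / norm z - 1) *\<^sub>R z"
      by (simp add: x_def algebra_simps)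
    then have "norm (x - z) = \<bar>R / norm z - 1\<bar> * norm z"
      by simp
    also have "\<dots> = norm z - R"
      using False \<open>z \<noteq> 0\<close> by (simp add: abs_if field_simps)
    finally have "z \<in> ball x \<epsilon>" using z by (simp add: dist_norm)
    moreover have "x \<in> cball 0 R"
      using \<open>R \<ge> 0\<close> \<open>z \<noteq> 0\<close> by (simp add: x_def)
    ultimately show ?thesis using \<epsilon> by blast
  qed (use assms in auto)
  then show ?thesis using \<open>\<epsilon> > 0\<close> by (intro that[of "R + \<epsilon>"]) auto
qed

text \<open>
  The quotient by the full power of \<open>z - w\<close> is holomorphic on the same disc, so its expansion at the
  origin converges there.
\<close>

lemma fps_divide_out_zero:
  fixes F :: "complex fps"
  assumes "F \<noteq> 0" and r: "cmod w < r" "ereal r \<le> fps_conv_radius F" and "eval_fps F w = 0"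
  obtains n G where "fps_conv_radius G \<ge> ereal r" "F = (fps_X - fps_const w) ^ n * G"
    "eval_fps G w \<noteq> 0"
proof -
  have r0: "r > 0" using r(1) norm_ge_zero[of w] by linarith
  have conv: "ereal (cmod z) < fps_conv_radius F" if "cmod z < r" for z
    using that r(2) by (meson ereal_less(3) less_ereal.simps(1) less_le_trans)
  have conv0: "fps_conv_radius F > 0"
    using conv[of 0] r0 by (simp add: zero_ereal_def)
  have hol: "eval_fps F holomorphic_on ball 0 r"
    by (rule holomorphic_on_eval_fps) (use conv in \<open>auto simp: in_eball_iff\<close>)
  have nonconst: "\<not> eval_fps F constant_on ball 0 r"
  proof
    assume "eval_fps F constant_on ball 0 r"
    then have "eval_fps F z = eval_fps 0 z" if "norm z < r" for z
      using that \<open>eval_fps F w = 0\<close> r(1) unfolding constant_on_def by (auto simp: eval_fps_0)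
    then have "F = 0"
      by (intro eval_fps_eq_imp_eq[OF r0 conv0]) auto
    then show False using \<open>F \<noteq> 0\<close> by simp
  qed
  have wr: "w \<in> ball 0 r" using r(1) by simp
  obtain g \<delta> n where g: "0 < (n::nat)" "0 < \<delta>" "ball w \<delta> \<subseteq> ball 0 r" "g holomorphic_on ball w \<delta>"
      "\<And>z. z \<in> ball w \<delta> \<Longrightarrow> eval_fps F z = (z - w) ^ n * g z" "\<And>z. z \<in> ball w \<delta> \<Longrightarrow> g z \<noteq> 0"
    by (rule holomorphic_factor_zero_nonconstant[OF hol open_ball connected_ball wr assms(4) nonconst]) blast
  \<comment> \<open>The quotient, continued to w by the local factor g.\<close>
  define k where "k = (\<lambda>z. if z \<in> ball w \<delta> then g z else eval_fps F z / (z - w) ^ n)"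
  have k: "eval_fps F z = (z - w) ^ n * k z" if "z \<in> ball 0 r" for z
    using g(5)[of z] g(2) by (auto simp: k_def)
  have "k holomorphic_on ball w \<delta> \<union> (ball 0 r - {w})"
  proof (rule holomorphic_on_Un)
    show "k holomorphic_on ball w \<delta>"
      using g(4) by (rule holomorphic_transform) (simp add: k_def)
    have "(\<lambda>z. eval_fps F z / (z - w) ^ n) holomorphic_on ball 0 r - {w}"
      by (intro holomorphic_intros holomorphic_on_subset[OF hol]) auto
    then show "k holomorphic_on ball 0 r - {w}"
      by (rule holomorphic_transform) (use g(5) in \<open>auto simp: k_def\<close>)
  qed (auto intro: open_delete)
  also have "ball w \<delta> \<union> (ball 0 r - {w}) = eball 0 (ereal r)"
    using g(2,3) by auto
  finally have hk: "k holomorphic_on eball 0 (ereal r)" .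
  define G where "G = fps_expansion k 0"
  have Gr: "fps_conv_radius G \<ge> ereal r"
    unfolding G_def by (rule conv_radius_fps_expansion[OF hk])
  have Gk: "eval_fps G z = k z" if "cmod z < r" for z
    using eval_fps_expansion'[OF hk, of z] that by (simp add: G_def)
  have G0: "fps_conv_radius G > 0"
    using Gr r0 by (metis ereal_less(2) less_le_trans)
  have inf: "fps_conv_radius ((fps_X - fps_const w) ^ n) = \<infinity>"
    using fps_conv_radius_power[of "fps_X - fps_const w" n] fps_conv_radius_diff[of fps_X "fps_const w"]
    by (simp add: min_def)
  have "F = (fps_X - fps_const w) ^ n * G"
  proof (rule eval_fps_eq_imp_eq[OF r0 conv0])
    show "fps_conv_radius ((fps_X - fps_const w) ^ n * G) > 0"
      using fps_conv_radius_mult[of "(fps_X - fps_const w) ^ n" G] inf G0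
      by (auto simp: min_def split: if_splits)
    fix z :: complex assume z: "norm z < r"
    have "ereal (cmod z) < fps_conv_radius G"
      using z Gr by (meson less_ereal.simps(1) less_le_trans)
    then have "eval_fps ((fps_X - fps_const w) ^ n * G) z = (z - w) ^ n * k z"
      using inf z fps_conv_radius_diff[of fps_X "fps_const w"]
      by (simp add: eval_fps_mult eval_fps_power eval_fps_diff Gk min_def)
    then show "eval_fps F z = eval_fps ((fps_X - fps_const w) ^ n * G) z"
      using k[of z] z by simp
  qed
  moreover have "eval_fps G w \<noteq> 0"
    using Gk[OF r(1)] g by (simp add: k_def)
  ultimately show ?thesis using that Gr by blast
qed

text \<open>
  Zeros of \<open>F\<close> in the closed disc of radius \<open>R\<close> are divided out, by induction on their number. If
  there is none, then \<open>1/F\<close> has a power series that converges beyond \<open>R\<close>, so \<open>F(T)\<close> is invertible and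
  the kernel is trivial. If \<open>w\<close> is a zero of order \<open>n\<close> and \<open>F = (z - w)\<^sup>n G\<close>, then either
  \<open>T - w\<close> has a kernel in \<open>E\<close>, or \<open>(T - w)\<^sup>n x\<close> is a nonzero vector in the kernel of \<open>G(T)\<close>.
\<close>

lemma (in bounded_operator) opcalc_kernel_imp_eigenvector:
  fixes F :: "complex fps"
  assumes conv: "fps_conv_radius F > R" and "F \<noteq> 0"
    and E: "cvec.subspace E" "\<And>x. x \<in> E \<Longrightarrow> T x \<in> E"
    and x: "x \<in> E" "x \<noteq> 0" "opcalc F T x = 0"
  obtains \<mu> y where "cmod \<mu> \<le> R" "eval_fps F \<mu> = 0" "y \<in> E" "y \<noteq> 0" "T y = \<mu> *\<^sub>C y"
proof -
  obtain r where r: "R < r" "ereal r < fps_conv_radius F"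
    using conv ereal_dense2 less_ereal.simps(1) by blast
  have r0: "r > 0" using r op_bound_nonneg by simp
  define Z where "Z = (\<lambda>H::complex fps. {z \<in> cball 0 R. eval_fps H z = 0})"
  have "finite (Z F) \<and> (\<exists>\<mu> y. cmod \<mu> \<le> R \<and> eval_fps F \<mu> = 0 \<and> y \<in> E \<and> y \<noteq> 0 \<and> T y = \<mu> *\<^sub>C y)"
    if "F \<noteq> 0" "ereal r \<le> fps_conv_radius F" "opcalc F T x = 0" "x \<in> E" "x \<noteq> 0" for F x
    using that
  proof (induction "card (Z F)" arbitrary: F x rule: less_induct)
    case less
    have conv: "ereal (cmod z) < fps_conv_radius F" if "cmod z < r" for z
      using that less.prems(2) by (meson less_ereal.simps(1) less_le_trans)
    have convR: "fps_conv_radius F > R"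
      using r less.prems(2) by (meson less_ereal.simps(1) less_le_trans)
    have conv0: "fps_conv_radius F > 0"
      using conv[of 0] r0 by (simp add: zero_ereal_def)
    have hol: "eval_fps F holomorphic_on ball 0 r"
      by (rule holomorphic_on_eval_fps) (use conv in \<open>auto simp: in_eball_iff\<close>)
    have fin: "finite (Z F)"
    proof (cases "eval_fps F constant_on ball 0 r")
      case False
      then show ?thesis unfolding Z_def
        by (intro holomorphic_compact_finite_zeros[OF hol]) (use r in auto)
    next
      case True
      then obtain c where c: "\<And>z. cmod z < r \<Longrightarrow> eval_fps F z = c"
        unfolding constant_on_def by auto
      have "c \<noteq> 0"
      proof
        assume "c = 0"
        then have "F = 0"
          using c by (intro eval_fps_eq_imp_eq[OF r0 conv0]) (auto simp: eval_fps_0)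
        then show False using less.prems(1) by simp
      qed
      then have "Z F = {}" using c r by (force simp: Z_def)
      then show ?thesis by simp
    qed
    moreover have "\<exists>\<mu> y. cmod \<mu> \<le> R \<and> eval_fps F \<mu> = 0 \<and> y \<in> E \<and> y \<noteq> 0 \<and> T y = \<mu> *\<^sub>C y"
    proof (cases "Z F = {}")
      case True
      \<comment> \<open>No zeros in the closed disc of radius R: the expansion G of the reciprocal inverts F.\<close>
      define U where "U = {z \<in> ball 0 r. eval_fps F z \<noteq> 0}"
      have "open U"
        using continuous_open_preimage[OF holomorphic_on_imp_continuous_on[OF hol] open_ball, of "- {0}"]
        by (simp add: U_def vimage_def Int_def open_Compl)
      moreover have "cball 0 R \<subseteq> U"
        using True r by (auto simp: U_def Z_def)
      ultimately obtain s where s: "s > R" "ball 0 s \<subseteq> U"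
        using cball_subset_open_imp_larger_ball op_bound_nonneg by blast
      have s0: "s > 0" using s op_bound_nonneg by simp
      define k where "k = (\<lambda>z. 1 / eval_fps F z)"
      have hk: "k holomorphic_on eball 0 (ereal s)"
        unfolding k_def
        by (intro holomorphic_intros holomorphic_on_subset[OF hol]) (use s in \<open>auto simp: U_def\<close>)
      define G where "G = fps_expansion k 0"
      have Gs: "fps_conv_radius G \<ge> ereal s"
        unfolding G_def by (rule conv_radius_fps_expansion[OF hk])
      then have GR: "fps_conv_radius G > R"
        using s by (meson less_ereal.simps(1) less_le_trans)
      have G0: "fps_conv_radius G > 0"
        using Gs s0 by (metis ereal_less(2) less_le_trans)
      have "G * F = 1"
      proof (rule eval_fps_eq_imp_eq[OF s0])
        show "fps_conv_radius (G * F) > 0"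
          using fps_conv_radius_mult[of G F] G0 conv0 by (auto simp: min_def split: if_splits)
        fix z :: complex assume z: "norm z < s"
        have "eval_fps G z = k z"
          using eval_fps_expansion'[OF hk, of z] z by (simp add: G_def)
        moreover have "z \<in> U" using z s by auto
        moreover have "ereal (cmod z) < fps_conv_radius G"
          using z Gs by (meson less_ereal.simps(1) less_le_trans)
        ultimately show "eval_fps (G * F) z = eval_fps 1 z"
          by (simp add: eval_fps_mult conv k_def U_def)
      qed auto
      then have "x = opcalc G T (opcalc F T x)"
        using opcalc_mult[OF GR convR, of x] by simp
      also have "\<dots> = 0"
        using less.prems(3) opcalc_scaleC[OF GR, of 0 0] by simp
      finally show ?thesis using less.prems by simp
    next
      case False
      then obtain w where w: "cmod w \<le> R" "eval_fps F w = 0" by (auto simp: Z_def)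
      then have wr: "cmod w < r" using r by simp
      \<comment> \<open>Divide out the zero w with its full order; G has fewer zeros.\<close>
      obtain n G where G: "fps_conv_radius G \<ge> ereal r" "F = (fps_X - fps_const w) ^ n * G"
          "eval_fps G w \<noteq> 0"
        using fps_divide_out_zero[OF less.prems(1) wr less.prems(2) w(2)] .
      have GR: "fps_conv_radius G > R"
        using r G(1) by (meson less_ereal.simps(1) less_le_trans)
      define S where "S = (\<lambda>y. T y - w *\<^sub>C y)"
      have SE: "S y \<in> E" if "y \<in> E" for y
        unfolding S_def using that by (intro cvec.subspace_diff cvec.subspace_scale E)
      have SkE: "(S ^^ k) x \<in> E" for k
        by (induction k) (auto intro: SE less.prems)
      show ?thesis
      proof (cases "\<exists>y\<in>E. y \<noteq> 0 \<and> S y = 0")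
        case True
        then show ?thesis using w by (auto simp: S_def)
      next
        case False
        have ne: "(S ^^ k) x \<noteq> 0" for k
          by (induction k) (use False SkE less.prems in auto)
        have eval: "eval_fps F z = (z - w) ^ n * eval_fps G z" if "cmod z < r" for z
        proof -
          have "ereal (cmod z) < fps_conv_radius G"
            using that G(1) by (meson less_ereal.simps(1) less_le_trans)
          moreover have "fps_conv_radius (fps_X - fps_const w) = \<infinity>"
            using fps_conv_radius_diff[of fps_X "fps_const w"] by (simp add: min_def)
          moreover have "fps_conv_radius ((fps_X - fps_const w) ^ n) = \<infinity>"
            using fps_conv_radius_power[of "fps_X - fps_const w" n] calculation by simp
          ultimately show ?thesis
            unfolding G(2) by (simp add: eval_fps_mult eval_fps_power eval_fps_diff)
        qed
        have sub: "Z G \<subset> Z F"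
        proof
          show "Z G \<subseteq> Z F" using eval r by (auto simp: Z_def)
          show "Z G \<noteq> Z F" using w G(3) by (auto simp: Z_def)
        qed
        have "opcalc G T ((S ^^ n) x) = 0"
          using less.prems(3) unfolding G(2) S_def by (simp add: opcalc_X_power_mult[OF GR])
        moreover have "G \<noteq> 0" using G(2) less.prems(1) by auto
        ultimately have "\<exists>\<mu> y. cmod \<mu> \<le> R \<and> eval_fps G \<mu> = 0 \<and> y \<in> E \<and> y \<noteq> 0 \<and> T y = \<mu> *\<^sub>C y"
          using less.hyps[OF psubset_card_mono[OF fin sub] _ G(1) _ SkE ne, of n] by simp
        then obtain \<mu> y where "cmod \<mu> \<le> R" "eval_fps G \<mu> = 0" "y \<in> E" "y \<noteq> 0" "T y = \<mu> *\<^sub>C y"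
          by (elim conjE exE)
        then show ?thesis using eval[of \<mu>] r by (intro exI[of _ \<mu>] exI[of _ y]) auto
      qed
    qed
    ultimately show ?case ..
  qed
  from this[OF \<open>F \<noteq> 0\<close> less_imp_le[OF r(2)] x(3,1,2)]
  obtain \<mu> y where "cmod \<mu> \<le> R" "eval_fps F \<mu> = 0" "y \<in> E" "y \<noteq> 0" "T y = \<mu> *\<^sub>C y"
    by (elim conjE exE)
  then show ?thesis by (rule that)
qed

section \<open>Chaotic operators from eigenvectors\<close>

lemma subspace_closure:
  fixes S :: "'w::complex_normed set"
  assumes "cvec.subspace S"
  shows "cvec.subspace (closure S)"
proof (rule cvec.subspaceI)
  show "0 \<in> closure S"
    using cvec.subspace_0[OF assms] closure_subset by blast
  fix x y c assume "x \<in> closure S"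
  then obtain f where f: "\<And>n. f n \<in> S" "f \<longlonglongrightarrow> x" by (auto simp: closure_sequential)
  show "c *\<^sub>C x \<in> closure S"
    unfolding closure_sequential
    by (rule exI[of _ "\<lambda>n. c *\<^sub>C f n"]) (auto intro!: tendsto_intros f cvec.subspace_scale assms)
  assume "y \<in> closure S"
  then obtain g where g: "\<And>n. g n \<in> S" "g \<longlonglongrightarrow> y" by (auto simp: closure_sequential)
  show "x + y \<in> closure S"
    unfolding closure_sequential
    by (rule exI[of _ "\<lambda>n. f n + g n"]) (auto intro!: tendsto_intros f g cvec.subspace_add assms)
qed

lemma closure_span_minimal:
  fixes S :: "'w::complex_normed set"
  assumes "S \<subseteq> L" "cvec.subspace L" "closed L"
  shows "closure (cvec.span S) \<subseteq> L"
  using assms by (intro closure_minimal cvec.span_minimal)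

text \<open>
  The countable set of scalars that makes finite combinations of countably many vectors countable.
\<close>

lemma complex_rational_approx:
  obtains q :: "nat \<Rightarrow> rat \<times> rat" where
    "(\<lambda>k. Complex (of_rat (fst (q k))) (of_rat (snd (q k)))) \<longlonglongrightarrow> c"
proof -
  have approx: "\<exists>f::nat \<Rightarrow> rat. (\<lambda>k. of_rat (f k)) \<longlonglongrightarrow> x" for x :: real
  proof -
    have "x \<in> closure \<rat>" using Rats_closure_real by simp
    then obtain g where g: "\<And>n. g n \<in> \<rat>" "g \<longlonglongrightarrow> x" by (auto simp: closure_sequential)
    then have "\<forall>n. \<exists>r. g n = of_rat r" by (metis Rats_cases)
    then obtain f where "\<And>n. g n = of_rat (f n)" by metis
    then have "(\<lambda>n. of_rat (f n)) = g" by (simp add: fun_eq_iff)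
    then show ?thesis using g(2) by (intro exI[of _ f]) simp
  qed
  obtain f g where "(\<lambda>k. of_rat (f k)) \<longlonglongrightarrow> Re c" "(\<lambda>k. of_rat (g k)) \<longlonglongrightarrow> Im c"
    using approx by meson
  then show ?thesis
    by (intro that[of "\<lambda>k. (f k, g k)"]) (auto simp: tendsto_complex_iff)
qed

lemma countable_dense_in_closed_span:
  fixes u :: "nat \<Rightarrow> 'w::complex_normed"
  obtains D where "countable D" "D \<subseteq> cvec.span (range u)" "closure (cvec.span (range u)) \<subseteq> closure D"
proof -
  define step where "step = (\<lambda>S. (\<lambda>(x, (a, b), i). x + Complex (of_rat a) (of_rat b) *\<^sub>C u i) `
      (S \<times> (UNIV :: (rat \<times> rat) set) \<times> UNIV))"
  define D where "D = (\<Union>n. (step ^^ n) {0})"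
  have "countable ((step ^^ n) {0})" for n
  proof (induction n)
    case (Suc n)
    then show ?case unfolding step_def funpow.simps comp_def
      by (intro countable_image countable_SIGMA) auto
  qed simp
  then have "countable D" by (simp add: D_def)
  moreover have "(step ^^ n) {0} \<subseteq> cvec.span (range u)" for n
  proof (induction n)
    case (Suc n)
    have "x + Complex (of_rat a) (of_rat b) *\<^sub>C u i \<in> cvec.span (range u)"
      if "x \<in> (step ^^ n) {0}" for x a b i
      using that Suc by (blast intro: cvec.span_add cvec.span_scale cvec.span_base)
    then have "step ((step ^^ n) {0}) \<subseteq> cvec.span (range u)"
      unfolding step_def by (intro image_subsetI) (simp add: case_prod_unfold mem_Times_iff)
    then show ?case by simp
  qed (simp add: cvec.span_zero)
  then have "D \<subseteq> cvec.span (range u)" by (auto simp: D_def)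
  moreover have "cvec.span (range u) \<subseteq> closure D"
  proof
    fix x assume "x \<in> cvec.span (range u)"
    then show "x \<in> closure D"
    proof (induction rule: cvec.span_induct_alt)
      case base
      have "0 \<in> (step ^^ 0) {0}" by simp
      then have "0 \<in> D" unfolding D_def by (rule UN_I[OF UNIV_I])
      then show ?case using closure_subset by (rule rev_subsetD)
    next
      case (step c v y)
      from step.hyps(1) obtain i where v: "v = u i" by (rule rangeE)
      from step.IH obtain f where f: "\<And>n. f n \<in> D" "f \<longlonglongrightarrow> y"
        unfolding closure_sequential by blast
      obtain q where q: "(\<lambda>k. Complex (of_rat (fst (q k))) (of_rat (snd (q k)))) \<longlonglongrightarrow> c"
        by (rule complex_rational_approx)
      let ?g = "\<lambda>k. f k + Complex (of_rat (fst (q k))) (of_rat (snd (q k))) *\<^sub>C u i"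
      have "?g k \<in> D" for k
      proof -
        obtain n where "f k \<in> (step ^^ n) {0}" using f(1)[of k] by (auto simp: D_def)
        then have "(f k, q k, i) \<in> (step ^^ n) {0} \<times> UNIV \<times> UNIV" by simp
        then have "?g k \<in> step ((step ^^ n) {0})"
          unfolding step_def by (rule rev_image_eqI) (simp add: case_prod_unfold)
        then have "?g k \<in> (step ^^ Suc n) {0}" by simp
        then show ?thesis unfolding D_def by (rule UN_I[OF UNIV_I])
      qed
      moreover have "?g \<longlonglongrightarrow> y + c *\<^sub>C u i" by (intro tendsto_intros f q)
      ultimately have "y + c *\<^sub>C u i \<in> closure D"
        unfolding closure_sequential by (intro exI[of _ ?g]) simp
      then show ?case by (simp add: v add.commute)
    qed
  qed
  then have "closure (cvec.span (range u)) \<subseteq> closure D"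
    by (simp add: closure_minimal)
  ultimately show ?thesis by (rule that)
qed

context bounded_operator
begin

text \<open>
  By Baire's theorem it suffices that, for \<open>d\<close> in a countable dense set, the vectors of \<open>Y\<close> whose
  orbit comes within \<open>1/(m+1)\<close> of \<open>d\<close> form a dense open subset of \<open>Y\<close>. Near \<open>y\<close> such a vector
  is \<open>x + s\<^sub>k\<close> with \<open>x\<close> close to \<open>y\<close> and large \<open>k\<close>: \<open>T\<^sup>k x\<close> and \<open>s\<^sub>k\<close> are small, and
  \<open>T\<^sup>k s\<^sub>k\<close> is the given \<open>z\<close> close to \<open>d\<close>.
\<close>

lemma hypercyclicity_criterion:
  assumes Y: "cvec.subspace Y" "closed Y"
    and D: "countable D" "D \<subseteq> Y" "Y \<subseteq> closure D"
    and X: "X \<subseteq> Y" "Y \<subseteq> closure X" "\<And>x. x \<in> X \<Longrightarrow> (\<lambda>k. (T ^^ k) x) \<longlonglongrightarrow> 0"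
    and Z: "Y \<subseteq> closure Z"
      "\<And>z. z \<in> Z \<Longrightarrow> \<exists>s. (\<forall>k. s k \<in> Y) \<and> s \<longlonglongrightarrow> 0 \<and> (\<forall>k. (T ^^ k) (s k) = z)"
  shows "\<exists>x\<in>Y. Y \<subseteq> closure (range (\<lambda>k. (T ^^ k) x))"
proof -
  define G where "G = (\<lambda>(d, m::nat). {x \<in> Y. \<exists>k. dist ((T ^^ k) x) d < 1 / Suc m})"
  have "openin (top_of_set Y) (G p)" for p
  proof -
    have "open {x. \<exists>k. dist ((T ^^ k) x) d < 1 / Suc m}" for d m
    proof -
      have "{x. \<exists>k. dist ((T ^^ k) x) d < 1 / Suc m} = (\<Union>k. {x. dist ((T ^^ k) x) d < 1 / Suc m})"
        by auto
      moreover have "open {x. dist ((T ^^ k) x) d < 1 / Suc m}" for k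
        by (intro open_Collect_less continuous_intros bounded_linear.continuous_on[OF pow_bounded_linear])
      ultimately show ?thesis by (simp add: open_UN)
    qed
    then show ?thesis
      unfolding openin_open by (cases p) (auto simp: G_def)
  qed
  moreover have "Y \<subseteq> closure (G (d, m))" if "d \<in> D" for d m
  proof
    fix y assume y: "y \<in> Y"
    show "y \<in> closure (G (d, m))"
      unfolding closure_approachable
    proof (intro allI impI)
      fix e :: real assume "e > 0"
      define \<delta> where "\<delta> = 1 / real (Suc m)"
      have "\<delta> > 0" by (simp add: \<delta>_def)
      have "y \<in> closure X" using y X by blast
      then obtain x where x: "x \<in> X" "dist x y < e / 2"
        unfolding closure_approachable using \<open>e > 0\<close> by (meson half_gt_zero)
      have "d \<in> closure Z" using that D Z by blast
      then obtain z where z: "z \<in> Z" "dist z d < \<delta> / 2"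
        unfolding closure_approachable using \<open>\<delta> > 0\<close> by (meson half_gt_zero)
      obtain s where s: "\<And>k. s k \<in> Y" "s \<longlonglongrightarrow> 0" "\<And>k. (T ^^ k) (s k) = z"
        using Z(2)[OF z(1)] by blast
      have "\<forall>\<^sub>F k in sequentially. norm (s k) < e / 2 \<and> norm ((T ^^ k) x) < \<delta> / 2"
        using tendstoD[OF s(2), of "e / 2"] tendstoD[OF X(3)[OF x(1)], of "\<delta> / 2"] \<open>e > 0\<close> \<open>\<delta> > 0\<close>
        by (intro eventually_conj) simp_all
      then obtain k where k: "norm (s k) < e / 2" "norm ((T ^^ k) x) < \<delta> / 2"
        using eventually_happens'[OF sequentially_bot] by blast
      have "dist (x + s k) y \<le> dist x y + norm (s k)"
        using norm_triangle_ineq[of "x - y" "s k"] by (simp add: dist_norm algebra_simps)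
      then have "dist (x + s k) y < e" using x k by simp
      moreover have "dist ((T ^^ k) (x + s k)) d \<le> norm ((T ^^ k) x) + dist z d"
        using norm_triangle_ineq[of "(T ^^ k) x" "z - d"] by (simp add: pow_add s dist_norm algebra_simps)
      then have "dist ((T ^^ k) (x + s k)) d < 1 / Suc m"
        using z k unfolding \<delta>_def by linarith
      then have "x + s k \<in> G (d, m)"
        using s(1) x(1) X(1) Y by (auto simp: G_def intro!: cvec.subspace_add)
      ultimately show "\<exists>g\<in>G (d, m). dist g y < e" by blast
    qed
  qed
  then have "top_of_set Y closure_of (G p) = Y" if "p \<in> D \<times> UNIV" for p
  proof -
    have "G p \<subseteq> Y" by (auto simp: G_def)
    moreover have "Y \<subseteq> closure (G p)"
      using that \<open>\<And>d m. d \<in> D \<Longrightarrow> Y \<subseteq> closure (G (d, m))\<close> by (cases p) auto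
    ultimately show ?thesis by (simp add: closure_of_subtopology Int_absorb1 Int_absorb2)
  qed
  moreover have "completely_metrizable_space (top_of_set Y)"
    by (rule completely_metrizable_space_closedin[OF completely_metrizable_space_euclidean])
       (simp add: Y)
  ultimately have "top_of_set Y closure_of (\<Inter> (G ` (D \<times> UNIV))) = topspace (top_of_set Y)"
    using D(1) by (intro Baire_category) (auto intro!: countable_image countable_SIGMA)
  moreover have "0 \<in> Y" using Y by (simp add: cvec.subspace_0)
  ultimately have "\<Inter> (G ` (D \<times> UNIV)) \<noteq> {}"
    by (metis closure_of_empty empty_iff topspace_euclidean_subtopology)
  then obtain x where x: "\<And>d m. d \<in> D \<Longrightarrow> x \<in> G (d, m)" by fast
  obtain d0 where "d0 \<in> D" using D(3) \<open>0 \<in> Y\<close> by fastforce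
  then have "x \<in> Y" using x[of d0 0] by (simp add: G_def)
  have orbit: "y \<in> closure (range (\<lambda>k. (T ^^ k) x))" if "y \<in> Y" for y
    unfolding closure_approachable
  proof (intro allI impI)
    fix e :: real assume "e > 0"
    obtain d where d: "d \<in> D" "dist d y < e / 2"
      using \<open>y \<in> Y\<close> D(3) \<open>e > 0\<close> closure_approachable by (meson half_gt_zero subsetD)
    obtain m where m: "1 / real (Suc m) < e / 2"
      using \<open>e > 0\<close> by (metis half_gt_zero nat_approx_posE)
    obtain k where "dist ((T ^^ k) x) d < 1 / Suc m"
      using x[OF d(1), of m] by (auto simp: G_def)
    then have "dist ((T ^^ k) x) y < e"
      using d m dist_triangle[of "(T ^^ k) x" y d] by simp
    then show "\<exists>z\<in>range (\<lambda>k. (T ^^ k) x). dist z y < e"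
      by (intro bexI[of _ "(T ^^ k) x"] rangeI)
  qed
  show ?thesis
    by (intro bexI[of _ x] subsetI orbit \<open>x \<in> Y\<close>)
qed

definition eigenvectors_in :: "'w set \<Rightarrow> (complex \<Rightarrow> bool) \<Rightarrow> 'w set"
  where "eigenvectors_in Y P = {v \<in> Y. \<exists>\<mu>. P \<mu> \<and> T v = \<mu> *\<^sub>C v}"

lemma pow_eigenvector: "T v = \<mu> *\<^sub>C v \<Longrightarrow> (T ^^ k) v = \<mu> ^ k *\<^sub>C v"
  by (induction k) (simp_all add: scaleC_one op_scaleC scaleC_scaleC mult.commute)

lemma span_eigenvectors_in:
  "cvec.subspace Y \<Longrightarrow> cvec.span (eigenvectors_in Y P) \<subseteq> Y"
  by (rule cvec.span_minimal) (auto simp: eigenvectors_in_def)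

text \<open>
  On combinations of eigenvectors with \<open>|\<mu>| < 1\<close> the iterates tend to zero; for \<open>|\<mu>| > 1\<close> they have the
  right inverses \<open>v \<mapsto> \<mu>\<^sup>-\<^sup>k v\<close>, which tend to zero.
\<close>

lemma godefroy_shapiro:
  assumes Y: "cvec.subspace Y" "closed Y"
    and D: "countable D" "D \<subseteq> Y" "Y \<subseteq> closure D"
    and contracted: "Y \<subseteq> closure (cvec.span (eigenvectors_in Y (\<lambda>\<mu>. cmod \<mu> < 1)))"
    and expanded: "Y \<subseteq> closure (cvec.span (eigenvectors_in Y (\<lambda>\<mu>. cmod \<mu> > 1)))"
  shows "\<exists>x\<in>Y. Y \<subseteq> closure (range (\<lambda>k. (T ^^ k) x))"
proof (rule hypercyclicity_criterion[OF Y D span_eigenvectors_in[OF Y(1)] contracted _ expanded])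
  fix x assume "x \<in> cvec.span (eigenvectors_in Y (\<lambda>\<mu>. cmod \<mu> < 1))"
  then show "(\<lambda>k. (T ^^ k) x) \<longlonglongrightarrow> 0"
  proof (induction rule: cvec.span_induct_alt)
    case base
    have "(T ^^ k) 0 = 0" for k by (induction k) auto
    then show ?case by simp
  next
    case (step c v y)
    then obtain \<mu> where \<mu>: "cmod \<mu> < 1" "T v = \<mu> *\<^sub>C v" by (auto simp: eigenvectors_in_def)
    have "(\<lambda>k. c *\<^sub>C \<mu> ^ k *\<^sub>C v + (T ^^ k) y) \<longlonglongrightarrow> c *\<^sub>C 0 *\<^sub>C v + 0"
      by (intro tendsto_intros step LIMSEQ_power_zero \<mu>)
    then show ?case by (simp add: pow_add pow_scaleC pow_eigenvector[OF \<mu>(2)])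
  qed
next
  fix z assume "z \<in> cvec.span (eigenvectors_in Y (\<lambda>\<mu>. cmod \<mu> > 1))"
  then show "\<exists>s. (\<forall>k. s k \<in> Y) \<and> s \<longlonglongrightarrow> 0 \<and> (\<forall>k. (T ^^ k) (s k) = z)"
  proof (induction rule: cvec.span_induct_alt)
    case base
    have "(T ^^ k) 0 = 0" for k by (induction k) auto
    then show ?case using Y by (intro exI[of _ "\<lambda>_. 0"]) (auto simp: cvec.subspace_0)
  next
    case (step c v y)
    then obtain s where s: "\<And>k. s k \<in> Y" "s \<longlonglongrightarrow> 0" "\<And>k. (T ^^ k) (s k) = y" by blast
    obtain \<mu> where \<mu>: "cmod \<mu> > 1" "T v = \<mu> *\<^sub>C v" "v \<in> Y"
      using step by (auto simp: eigenvectors_in_def)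
    have inv: "cmod (inverse \<mu>) < 1"
      using \<mu>(1) by (simp add: norm_inverse inverse_less_1_iff)
    have one: "\<mu> ^ k * inverse \<mu> ^ k = 1" for k
    proof -
      have "\<mu> \<noteq> 0" using \<mu>(1) by auto
      then show ?thesis by (simp flip: power_mult_distrib)
    qed
    have "(\<lambda>k. c *\<^sub>C inverse \<mu> ^ k *\<^sub>C v + s k) \<longlonglongrightarrow> c *\<^sub>C 0 *\<^sub>C v + 0"
      by (intro tendsto_intros s LIMSEQ_power_zero inv)
    moreover have "(T ^^ k) (c *\<^sub>C inverse \<mu> ^ k *\<^sub>C v + s k) = c *\<^sub>C v + y" for k
    proof -
      have "(T ^^ k) (inverse \<mu> ^ k *\<^sub>C v) = (\<mu> ^ k * inverse \<mu> ^ k) *\<^sub>C v"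
        by (simp only: pow_scaleC pow_eigenvector[OF \<mu>(2)] scaleC_scaleC mult.commute)
      then show ?thesis by (simp only: pow_add pow_scaleC[of k c] one scaleC_one s(3))
    qed
    moreover have "c *\<^sub>C inverse \<mu> ^ k *\<^sub>C v + s k \<in> Y" for k
      by (intro cvec.subspace_add cvec.subspace_scale Y \<mu> s)
    ultimately show ?case
      by (intro exI[of _ "\<lambda>k. c *\<^sub>C inverse \<mu> ^ k *\<^sub>C v + s k"]) simp
  qed
qed

text \<open>
  A finite sum of periodic vectors is periodic, with the product of the periods as a period.
\<close>

lemma periodic_points_dense:
  assumes Y: "cvec.subspace Y"
    and periodic: "Y \<subseteq> closure (cvec.span (eigenvectors_in Y (\<lambda>\<mu>. \<exists>k>0. \<mu> ^ k = 1)))"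
  shows "Y \<subseteq> closure {x \<in> Y. \<exists>k>0. (T ^^ k) x = x}"
proof -
  have mult: "(T ^^ (k * m)) x = x" if "(T ^^ k) x = x" for k m x
    using that by (induction m) (simp_all add: funpow_add)
  have "\<exists>k>0. (T ^^ k) x = x" if "x \<in> cvec.span (eigenvectors_in Y (\<lambda>\<mu>. \<exists>k>0. \<mu> ^ k = 1))" for x
    using that
  proof (induction rule: cvec.span_induct_alt)
    case base
    then show ?case by (intro exI[of _ 1]) simp
  next
    case (step c v y)
    then obtain k where k: "k > 0" "(T ^^ k) y = y" by blast
    obtain \<mu> m where \<mu>: "m > 0" "\<mu> ^ m = 1" "T v = \<mu> *\<^sub>C v" "v \<in> Y"
      using step by (auto simp: eigenvectors_in_def)
    have "(T ^^ m) v = v" using pow_eigenvector[OF \<mu>(3), of m] \<mu>(2) by (simp add: scaleC_one)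
    then have "(T ^^ (k * m)) (c *\<^sub>C v + y) = c *\<^sub>C v + y"
      using mult[of k y m] mult[of m v k] k by (simp add: pow_add pow_scaleC mult.commute)
    then show ?case using k \<mu> by (intro exI[of _ "k * m"]) simp
  qed
  then have "cvec.span (eigenvectors_in Y (\<lambda>\<mu>. \<exists>k>0. \<mu> ^ k = 1)) \<subseteq> {x \<in> Y. \<exists>k>0. (T ^^ k) x = x}"
    using span_eigenvectors_in[OF Y] by blast
  then show ?thesis using periodic closure_mono by blast
qed

end

section \<open>Holomorphic families of vectors\<close>

text \<open>
  A uniform limit of bounded continuous functions is bounded and continuous, whatever topological
  space the domain is.
\<close>

instance bcontfun :: (topological_space, complete_space) complete_space
proof
  fix f :: "nat \<Rightarrow> 'a \<Rightarrow>\<^sub>C 'b"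
  assume f: "Cauchy f"
  have "uniformly_Cauchy_on UNIV (\<lambda>n. apply_bcontfun (f n))"
  proof (rule uniformly_Cauchy_onI)
    fix e :: real assume "e > 0"
    with f obtain M where M: "\<And>m n. m \<ge> M \<Longrightarrow> n \<ge> M \<Longrightarrow> dist (f m) (f n) < e"
      unfolding Cauchy_def by blast
    show "\<exists>M. \<forall>x\<in>UNIV. \<forall>m\<ge>M. \<forall>n\<ge>M. dist (f m x) (f n x) < e"
      by (intro exI[of _ M]) (use M in \<open>auto intro: dist_fun_lt_imp_dist_val_lt\<close>)
  qed
  then obtain g where "uniform_limit UNIV (\<lambda>n. apply_bcontfun (f n)) g sequentially"
    using Cauchy_uniformly_convergent unfolding uniformly_convergent_on_def by blast
  then show "convergent f"
    by (rule uniform_limit_bcontfunE[OF _ sequentially_bot]) (rule convergentI)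
qed

instance bcontfun :: (topological_space, banach) banach ..

text \<open>
  Pairs of natural numbers carry the discrete topology, so these are all bounded double sequences with
  the supremum norm.
\<close>

type_synonym array = "(nat \<times> nat) \<Rightarrow>\<^sub>C complex"

lemma continuous_on_nat_prod: "continuous_on A (f :: nat \<times> nat \<Rightarrow> 'b::topological_space)"
proof (rule continuous_on_subset[OF _ subset_UNIV])
  have "open S" for S :: "(nat \<times> nat) set"
    unfolding open_subopen[of S]
  proof
    fix p assume "p \<in> S"
    then show "\<exists>T. open T \<and> p \<in> T \<and> T \<subseteq> S"
      by (intro exI[of _ "{fst p} \<times> {snd p}"] conjI open_Times open_discrete) auto
  qed
  then show "continuous_on UNIV f" by (simp add: continuous_on_open_vimage)
qed

lemma apply_Bcontfun_array:
  fixes a :: "nat \<times> nat \<Rightarrow> complex"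
  assumes "\<And>q. norm (a q) \<le> B"
  shows "apply_bcontfun (Bcontfun a) p = a p"
  using bcontfun_normI[OF continuous_on_nat_prod assms] by (simp add: Bcontfun_inverse)

lemma bounded_linear_apply_bcontfun:
  "bounded_linear (\<lambda>f::'a::topological_space \<Rightarrow>\<^sub>C 'b::real_normed_vector. apply_bcontfun f p)"
  by (rule bounded_linear_intro[where K = 1]) (auto simp: norm_bounded)

text \<open>
  The Cauchy estimates of the Taylor coefficients are uniform in the entry \<open>p\<close>, hence the entrywise
  Taylor series converges in the supremum norm.
\<close>

lemma holomorphic_family_power_series:
  fixes F :: "complex \<Rightarrow> array"
  assumes "0 < r" and hol: "\<And>p. (\<lambda>z. F z p) holomorphic_on ball c r"
    and bound: "\<And>z. z \<in> ball c r \<Longrightarrow> norm (F z) \<le> B"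
  obtains u where "\<And>z. z \<in> ball c r \<Longrightarrow> (\<lambda>m. (z - c) ^ m *\<^sub>C u m) sums F z"
proof -
  define a where "a = (\<lambda>m p. (deriv ^^ m) (\<lambda>z. F z p) c / fact m)"
  have a: "cmod (a m p) \<le> B / s ^ m" if s: "0 < s" "s < r" for m p s
  proof -
    have sub: "cball c s \<subseteq> ball c r" using s by auto
    have "cmod ((deriv ^^ m) (\<lambda>z. F z p) c) \<le> fact m * B / s ^ m"
    proof (rule Cauchy_inequality)
      show "(\<lambda>z. F z p) holomorphic_on ball c s"
        by (rule holomorphic_on_subset[OF hol]) (use sub in auto)
      show "continuous_on (cball c s) (\<lambda>z. F z p)"
        by (rule holomorphic_on_imp_continuous_on[OF holomorphic_on_subset[OF hol sub]])
      fix x assume "cmod (c - x) = s"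
      then have "x \<in> ball c r" using s by (simp add: dist_norm)
      then show "cmod (F x p) \<le> B" using bound norm_bounded order_trans by blast
    qed (use s in auto)
    then show ?thesis
      using s by (simp add: a_def norm_divide pos_le_divide_eq pos_divide_le_eq mult.commute)
  qed
  define u :: "nat \<Rightarrow> array" where "u = (\<lambda>m. Bcontfun (a m))"
  have u: "u m p = a m p" for m p
    \<comment> \<open>Any radius below r bounds the coefficients; half of it is one.\<close>
    unfolding u_def by (rule apply_Bcontfun_array, rule a[of "r/2"]) (use \<open>0 < r\<close> in auto)
  have "(\<lambda>m. (z - c) ^ m *\<^sub>C u m) sums F z" if z: "z \<in> ball c r" for z
  proof -
    obtain s where s: "cmod (z - c) < s" "s < r"
      using z dense[of "cmod (z - c)" r] by (auto simp: dist_norm norm_minus_commute)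
    then have s0: "0 < s" using norm_ge_zero[of "z - c"] by linarith
    have "norm (u m) \<le> B / s ^ m" for m
      by (rule norm_bound) (simp add: u a s s0)
    then have le: "norm ((z - c) ^ m *\<^sub>C u m) \<le> B * (cmod (z - c) / s) ^ m" for m
      using mult_left_mono[of "norm (u m)" "B / s ^ m" "cmod (z - c) ^ m"]
      by (simp add: norm_scaleC norm_power power_divide mult.commute)
    have "summable (\<lambda>m. B * (cmod (z - c) / s) ^ m)"
      using s s0 by (intro summable_mult summable_geometric) simp
    then have "summable (\<lambda>m. (z - c) ^ m *\<^sub>C u m)"
      by (rule summable_comparison_test') (rule le)
    then have sums: "(\<lambda>m. (z - c) ^ m *\<^sub>C u m) sums (\<Sum>m. (z - c) ^ m *\<^sub>C u m)"
      by (rule summable_sums)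
    have "(\<Sum>m. (z - c) ^ m *\<^sub>C u m) = F z"
    proof (rule bcontfun_eqI)
      fix p
      have "(\<lambda>m. a m p * (z - c) ^ m) sums apply_bcontfun (\<Sum>m. (z - c) ^ m *\<^sub>C u m) p"
        using bounded_linear.sums[OF bounded_linear_apply_bcontfun sums, of p]
        by (simp add: u scaleC_complex_def mult.commute)
      moreover have "(\<lambda>m. a m p * (z - c) ^ m) sums F z p"
        using holomorphic_power_series[OF hol z, of p] by (simp add: a_def)
      ultimately show "apply_bcontfun (\<Sum>m. (z - c) ^ m *\<^sub>C u m) p = F z p"
        by (rule sums_unique2)
    qed
    then show ?thesis using sums by simp
  qed
  then show ?thesis by (rule that)
qed

text \<open>
  The terms of a convergent series are bounded, so on the disc of a quarter of the radius the remainder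
  is dominated by a geometric series with ratio \<open>1/2\<close>.
\<close>

lemma power_series_remainder_bound:
  fixes F :: "complex \<Rightarrow> 'w::{complex_normed,banach}"
  assumes "0 < r" and sums: "\<And>z. z \<in> ball c r \<Longrightarrow> (\<lambda>m. (z - c) ^ m *\<^sub>C u m) sums F z"
  obtains K d where "d > 0" "d \<le> r"
    "\<And>z. z \<in> ball c d \<Longrightarrow> norm (F z - (\<Sum>j<M. (z - c) ^ j *\<^sub>C u j)) \<le> K * cmod (z - c) ^ M"
proof -
  define s where "s = r / 2"
  have s: "0 < s" "s < r" using \<open>0 < r\<close> by (auto simp: s_def)
  have "c + of_real s \<in> ball c r" using s by (simp add: dist_norm)
  from sums_summable[OF sums[OF this]] have "summable (\<lambda>m. of_real s ^ m *\<^sub>C u m)" by simp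
  then have "Bseq (\<lambda>m. of_real s ^ m *\<^sub>C u m)"
    by (intro convergent_imp_Bseq convergentI[OF summable_LIMSEQ_zero])
  then obtain B where B: "\<And>m. norm (of_real s ^ m *\<^sub>C u m) \<le> B" and B0: "B > 0"
    unfolding Bseq_def by blast
  have u: "norm (u m) \<le> B / s ^ m" for m
    using B[of m] s by (simp add: norm_scaleC norm_power pos_le_divide_eq mult.commute)
  define K where "K = B / s ^ M * 2"
  have "norm (F z - (\<Sum>j<M. (z - c) ^ j *\<^sub>C u j)) \<le> K * cmod (z - c) ^ M"
    if z: "z \<in> ball c (s / 2)" for z
  proof -
    have zs: "cmod (z - c) \<le> s / 2" using z by (simp add: dist_norm norm_minus_commute)
    have "z \<in> ball c r" using z s by auto
    then have "(\<lambda>j. (z - c) ^ (j + M) *\<^sub>C u (j + M)) sums (F z - (\<Sum>j<M. (z - c) ^ j *\<^sub>C u j))"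
      using sums_split_initial_segment[OF sums, of z M] by simp
    moreover have "(\<lambda>j. B / s ^ M * cmod (z - c) ^ M * (1 / 2) ^ j) sums (B / s ^ M * cmod (z - c) ^ M * 2)"
      using sums_mult[OF geometric_sums[of "1 / 2 :: real"], of "B / s ^ M * cmod (z - c) ^ M"] by simp
    moreover have "norm ((z - c) ^ (j + M) *\<^sub>C u (j + M)) \<le> B / s ^ M * cmod (z - c) ^ M * (1 / 2) ^ j" for j
    proof -
      have "norm ((z - c) ^ (j + M) *\<^sub>C u (j + M)) \<le> cmod (z - c) ^ (j + M) * (B / s ^ (j + M))"
        unfolding norm_scaleC norm_power by (intro mult_left_mono u) simp
      also have "\<dots> \<le> (s / 2) ^ j * cmod (z - c) ^ M * (B / s ^ (j + M))"
        unfolding power_add using B0 s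
        by (intro mult_right_mono power_mono zs) auto
      also have "\<dots> = B / s ^ M * cmod (z - c) ^ M * (1 / 2) ^ j"
        using s by (simp add: power_add power_divide mult_ac)
      finally show ?thesis .
    qed
    ultimately have "norm (F z - (\<Sum>j<M. (z - c) ^ j *\<^sub>C u j)) \<le> B / s ^ M * cmod (z - c) ^ M * 2"
      by (metis (no_types, lifting) norm_suminf_le sums_iff)
    then show ?thesis by (simp add: K_def mult_ac)
  qed
  then show ?thesis using s by (intro that[of "s / 2" K]) (auto simp: s_def)
qed

text \<open>
  The identity theorem for vector-valued power series. Once the coefficients before \<open>u\<^sub>M\<close> lie in \<open>L\<close>,
  the quotients \<open>(F z - \<Sum>\<^bsub>j<M\<^esub> (z - c)\<^sup>j u\<^sub>j) / (z - c)\<^sup>M\<close> for \<open>z\<close> in \<open>\<Lambda>\<close> lie in \<open>L\<close> too, and they tend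
  to \<open>u\<^sub>M\<close> as \<open>z\<close> approaches \<open>c\<close>.
\<close>

lemma power_series_coeffs_in_closed_subspace:
  fixes F :: "complex \<Rightarrow> 'w::{complex_normed,banach}"
  assumes "0 < r" and sums: "\<And>z. z \<in> ball c r \<Longrightarrow> (\<lambda>m. (z - c) ^ m *\<^sub>C u m) sums F z"
    and L: "cvec.subspace L" "closed L"
    and limpt: "c islimpt \<Lambda>" and F: "\<And>z. z \<in> \<Lambda> \<Longrightarrow> z \<in> ball c r \<Longrightarrow> F z \<in> L"
  shows "u M \<in> L"
proof (induction M rule: less_induct)
  case (less M)
  obtain K d where d: "d > 0" "d \<le> r" and
    K: "\<And>z. z \<in> ball c d \<Longrightarrow> norm (F z - (\<Sum>j<Suc M. (z - c) ^ j *\<^sub>C u j)) \<le> K * cmod (z - c) ^ Suc M"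
    using power_series_remainder_bound[OF \<open>0 < r\<close> sums, where M = "Suc M"] by metis
  define H where "H = (\<lambda>z. inverse ((z - c) ^ M) *\<^sub>C (F z - (\<Sum>j<M. (z - c) ^ j *\<^sub>C u j)))"
  have close: "norm (H z - u M) \<le> K * cmod (z - c)" if "z \<in> ball c d" "z \<noteq> c" for z
  proof -
    have "H z - u M = inverse ((z - c) ^ M) *\<^sub>C (F z - (\<Sum>j<Suc M. (z - c) ^ j *\<^sub>C u j))"
      using that(2) by (simp add: H_def cvec.scale_right_diff_distrib scaleC_scaleC scaleC_one
          cvec.scale_right_distrib diff_diff_eq)
    then have "norm (H z - u M) \<le> inverse (cmod (z - c) ^ M) * (K * cmod (z - c) ^ Suc M)"
      using mult_left_mono[OF K[OF that(1)], of "inverse (cmod (z - c) ^ M)"]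
      by (simp add: norm_scaleC norm_inverse norm_power)
    also have "\<dots> = K * cmod (z - c)" using that(2) by (simp add: field_simps)
    finally show ?thesis .
  qed
  have "c islimpt (\<Lambda> \<inter> ball c d)"
    using d(1) by (intro islimpt_Int_eventually[OF limpt] eventually_at_in_open') auto
  then obtain z where z: "\<And>k. z k \<in> \<Lambda> \<inter> ball c d - {c}" "z \<longlonglongrightarrow> c"
    unfolding islimpt_sequential by blast
  have "(\<lambda>k. H (z k) - u M) \<longlonglongrightarrow> 0"
  proof (rule Lim_null_comparison)
    show "\<forall>\<^sub>F k in sequentially. norm (H (z k) - u M) \<le> K * cmod (z k - c)"
      using close z(1) by (intro always_eventually) blast
    have "(\<lambda>k. K * cmod (z k - c)) \<longlonglongrightarrow> K * cmod (c - c)"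
      by (intro tendsto_intros z(2))
    then show "(\<lambda>k. K * cmod (z k - c)) \<longlonglongrightarrow> 0" by simp
  qed
  then have "(\<lambda>k. H (z k)) \<longlonglongrightarrow> u M" by (simp add: LIM_zero_iff)
  moreover have "H (z k) \<in> L" for k
  proof -
    have "z k \<in> \<Lambda>" "z k \<in> ball c r" using z(1)[of k] d(2) by auto
    then show ?thesis
      unfolding H_def
      by (intro cvec.subspace_scale cvec.subspace_diff cvec.subspace_sum F less.IH L) auto
  qed
  ultimately show ?case using closed_sequentially[OF L(2), of "\<lambda>k. H (z k)"] by blast
qed

lemma power_series_in_closed_subspace:
  fixes F :: "complex \<Rightarrow> 'w::{complex_normed,banach}"
  assumes "(\<lambda>m. (z - c) ^ m *\<^sub>C u m) sums F z" and L: "cvec.subspace L" "closed L" and "\<And>m. u m \<in> L"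
  shows "F z \<in> L"
  using assms(1) unfolding sums_def
  by (rule closed_sequentially[OF L(2), rotated]) (intro cvec.subspace_sum cvec.subspace_scale L assms)

section \<open>A holomorphic implicit function theorem\<close>

text \<open>
  The simplified Newton map \<open>\<Phi>\<^sub>l z = z - G l z / b\<close> with \<open>b = G' l\<^sub>0 z\<^sub>0\<close> contracts a small disc
  around \<open>z\<^sub>0\<close> by the factor \<open>1/2\<close> for all \<open>l\<close> near \<open>l\<^sub>0\<close>. Its iterates from \<open>z\<^sub>0\<close> are holomorphic in \<open>l\<close> and
  converge uniformly; the limit is a fixed point of \<open>\<Phi>\<^sub>l\<close>, that is, a zero of \<open>G l\<close>. The hypothesis
  on the compositions \<open>G l (g l)\<close> expresses joint holomorphy by functions of one variable.
\<close>

lemma holomorphic_implicit_function: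
  fixes G G' :: "complex \<Rightarrow> complex \<Rightarrow> complex"
  assumes S: "open S" "z\<^sub>0 \<in> S"
    and deriv: "\<And>l z. z \<in> S \<Longrightarrow> (G l has_field_derivative G' l z) (at z)"
    and cont: "continuous_on (UNIV \<times> S) (\<lambda>(l, z). G' l z)"
    and hol: "\<And>g U. open U \<Longrightarrow> g holomorphic_on U \<Longrightarrow> g ` U \<subseteq> S \<Longrightarrow> (\<lambda>l. G l (g l)) holomorphic_on U"
    and zero: "G l\<^sub>0 z\<^sub>0 = 0" and nz: "G' l\<^sub>0 z\<^sub>0 \<noteq> 0"
  obtains \<delta> g where "\<delta> > 0" "g holomorphic_on ball l\<^sub>0 \<delta>" "g l\<^sub>0 = z\<^sub>0"
    "\<And>l. l \<in> ball l\<^sub>0 \<delta> \<Longrightarrow> g l \<in> S \<and> G l (g l) = 0"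
proof -
  define b where "b = G' l\<^sub>0 z\<^sub>0"
  have b: "b \<noteq> 0" using nz by (simp add: b_def)
  \<comment> \<open>The derivative of the Newton map, which vanishes at the base point.\<close>
  define q where "q = (\<lambda>p. 1 - (\<lambda>(l, z). G' l z) p / b)"
  have "continuous_on (UNIV \<times> S) q"
    unfolding q_def by (intro continuous_intros cont) (use b in auto)
  then have "isCont q (l\<^sub>0, z\<^sub>0)"
    using S by (simp add: continuous_on_eq_continuous_at open_Times)
  then have "\<exists>e>0. \<forall>p. dist p (l\<^sub>0, z\<^sub>0) < e \<longrightarrow> dist (q p) (q (l\<^sub>0, z\<^sub>0)) < 1 / 2"
    unfolding continuous_at_eps_delta by (rule allE[of _ "1 / 2"]) simp
  then obtain e where e: "e > 0" "\<And>p. dist p (l\<^sub>0, z\<^sub>0) < e \<Longrightarrow> dist (q p) (q (l\<^sub>0, z\<^sub>0)) < 1 / 2"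
    by blast
  obtain \<eta>' where \<eta>': "\<eta>' > 0" "cball z\<^sub>0 \<eta>' \<subseteq> S" using S open_contains_cball by blast
  \<comment> \<open>The distances e / 3 and e / 2 of the two variables add up to less than e.\<close>
  define \<eta> where "\<eta> = min \<eta>' (e / 3)"
  have \<eta>: "\<eta> > 0" "cball z\<^sub>0 \<eta> \<subseteq> S" using \<eta>' e by (auto simp: \<eta>_def)
  have half: "cmod (1 - G' l z / b) \<le> 1 / 2" if "dist l l\<^sub>0 < e / 2" "z \<in> cball z\<^sub>0 \<eta>" for l z
  proof -
    have "dist z z\<^sub>0 \<le> e / 3" using that(2) by (auto simp: \<eta>_def dist_commute)
    then have "dist (l, z) (l\<^sub>0, z\<^sub>0) < e"
      using that(1) \<open>e > 0\<close> sqrt_sum_squares_le_sum[of "dist l l\<^sub>0" "dist z z\<^sub>0"]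
      by (simp add: dist_Pair_Pair)
    from e(2)[OF this] show ?thesis
      using b by (simp add: dist_norm b_def q_def)
  qed
  have "(\<lambda>l. G l z\<^sub>0) holomorphic_on UNIV"
    using hol[of UNIV "\<lambda>_. z\<^sub>0"] S by auto
  then have "isCont (\<lambda>l. G l z\<^sub>0) l\<^sub>0"
    using holomorphic_on_imp_continuous_on by (fastforce simp: continuous_on_eq_continuous_at)
  then have "isCont (\<lambda>l. G l z\<^sub>0 / b) l\<^sub>0"
    by (intro continuous_intros) (use b in auto)
  then have "\<exists>d>0. \<forall>l. dist l l\<^sub>0 < d \<longrightarrow> dist (G l z\<^sub>0 / b) (G l\<^sub>0 z\<^sub>0 / b) < \<eta> / 2"
    unfolding continuous_at_eps_delta by (rule allE[of _ "\<eta> / 2"]) (use \<eta>(1) in simp)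
  then obtain \<delta>' where \<delta>': "\<delta>' > 0" "\<And>l. dist l l\<^sub>0 < \<delta>' \<Longrightarrow> dist (G l z\<^sub>0 / b) (G l\<^sub>0 z\<^sub>0 / b) < \<eta> / 2"
    by blast
  define \<delta> where "\<delta> = min \<delta>' (e / 2)"
  have \<delta>: "\<delta> > 0" using \<delta>' e by (simp add: \<delta>_def)
  \<comment> \<open>A first step of length at most half the radius keeps all iterates in the disc.\<close>
  have start: "cmod (G l z\<^sub>0 / b) \<le> \<eta> / 2" if "l \<in> ball l\<^sub>0 \<delta>" for l
    using \<delta>'(2)[of l] that zero by (simp add: \<delta>_def dist_commute)
  define \<Phi> where "\<Phi> = (\<lambda>l z. z - G l z / b)"
  have contr: "cmod (\<Phi> l z - \<Phi> l z') \<le> 1 / 2 * cmod (z - z')"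
    if "l \<in> ball l\<^sub>0 \<delta>" "z \<in> cball z\<^sub>0 \<eta>" "z' \<in> cball z\<^sub>0 \<eta>" for l z z'
  proof (rule field_differentiable_bound[of "cball z\<^sub>0 \<eta>" "\<Phi> l" "\<lambda>z. 1 - G' l z / b"])
    fix w assume w: "w \<in> cball z\<^sub>0 \<eta>"
    then have "w \<in> S" using \<eta> by blast
    then show "(\<Phi> l has_field_derivative 1 - G' l w / b) (at w within cball z\<^sub>0 \<eta>)"
      unfolding \<Phi>_def by (intro DERIV_diff DERIV_ident DERIV_cdivide DERIV_subset[OF deriv]) auto
    show "cmod (1 - G' l w / b) \<le> 1 / 2"
      using half[OF _ w] that(1) by (simp add: \<delta>_def dist_commute)
  qed (use that in auto)
  define h where "h = (\<lambda>k l. (\<Phi> l ^^ k) z\<^sub>0)"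
  have h_simps: "h 0 l = z\<^sub>0" "h (Suc k) l = \<Phi> l (h k l)" for k l
    by (simp_all add: h_def)
  have near: "cmod (h k l - z\<^sub>0) \<le> \<eta> * (1 - (1 / 2) ^ k) \<and> cmod (h (Suc k) l - h k l) \<le> \<eta> / 2 * (1 / 2) ^ k"
    if l: "l \<in> ball l\<^sub>0 \<delta>" for k l
  proof (induction k)
    case 0
    then show ?case using start[OF l] by (simp add: h_simps \<Phi>_def)
  next
    case (Suc k)
    have le: "cmod (h j l - z\<^sub>0) \<le> \<eta>" if "cmod (h j l - z\<^sub>0) \<le> \<eta> * (1 - (1 / 2) ^ j)" for j
    proof -
      have "\<eta> * (1 - (1 / 2) ^ j) \<le> \<eta> * 1" using \<eta>(1) by (intro mult_left_mono) auto
      then show ?thesis using that by simp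
    qed
    have "cmod (h (Suc k) l - z\<^sub>0) \<le> cmod (h k l - z\<^sub>0) + cmod (h (Suc k) l - h k l)"
      using norm_triangle_ineq[of "h k l - z\<^sub>0" "h (Suc k) l - h k l"] by (simp add: add.commute)
    also have "\<dots> \<le> \<eta> * (1 - (1 / 2) ^ Suc k)"
      using Suc by (simp add: algebra_simps)
    finally have 1: "cmod (h (Suc k) l - z\<^sub>0) \<le> \<eta> * (1 - (1 / 2) ^ Suc k)" .
    have "cmod (h (Suc (Suc k)) l - h (Suc k) l) \<le> 1 / 2 * cmod (h (Suc k) l - h k l)"
      unfolding h_simps(2)[of "Suc k"] h_simps(2)[of k l, symmetric]
      by (subst (2) h_simps(2), rule contr[OF l])
         (use le[OF 1] le[OF conjunct1[OF Suc]] in \<open>auto simp: dist_norm norm_minus_commute\<close>)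
    then show ?case using 1 Suc by simp
  qed
  have in_cball: "h k l \<in> cball z\<^sub>0 \<eta>" if l: "l \<in> ball l\<^sub>0 \<delta>" for k l
  proof -
    have "\<eta> * (1 - (1 / 2) ^ k) \<le> \<eta> * 1" using \<eta>(1) by (intro mult_left_mono) auto
    then show ?thesis using near[OF l, of k] by (simp add: dist_norm norm_minus_commute)
  qed
  have h_hol: "h k holomorphic_on ball l\<^sub>0 \<delta>" for k
  proof (induction k)
    case (Suc k)
    have "(\<lambda>l. h k l - G l (h k l) / b) holomorphic_on ball l\<^sub>0 \<delta>"
      using b \<eta>(2) in_cball by (intro holomorphic_intros Suc hol) auto
    then show ?case by (simp add: h_simps(2)[abs_def] \<Phi>_def)
  qed (simp add: h_simps(1)[abs_def])
  define g where "g = (\<lambda>l. z\<^sub>0 + (\<Sum>k. h (Suc k) l - h k l))"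
  have tele: "z\<^sub>0 + (\<Sum>k<n. h (Suc k) l - h k l) = h n l" for n l
    using sum_lessThan_telescope[of "\<lambda>k. h k l" n] by (simp add: h_simps(1))
  have "uniform_limit (ball l\<^sub>0 \<delta>) (\<lambda>n l. \<Sum>k<n. h (Suc k) l - h k l) (\<lambda>l. \<Sum>k. h (Suc k) l - h k l) sequentially"
  proof (rule Weierstrass_m_test)
    show "cmod (h (Suc k) l - h k l) \<le> \<eta> / 2 * (1 / 2) ^ k" if "l \<in> ball l\<^sub>0 \<delta>" for k l
      using near[OF that] by blast
    show "summable (\<lambda>k. \<eta> / 2 * (1 / 2) ^ k)" by (intro summable_mult summable_geometric) simp
  qed
  then have "uniform_limit (ball l\<^sub>0 \<delta>) (\<lambda>n l. z\<^sub>0 + (\<Sum>k<n. h (Suc k) l - h k l)) g sequentially"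
    unfolding g_def by (intro uniform_limit_add uniform_limit_const)
  then have lim: "uniform_limit (ball l\<^sub>0 \<delta>) h g sequentially"
    unfolding tele by (simp add: eta_contract_eq)
  have g_hol: "g holomorphic_on ball l\<^sub>0 \<delta>"
  proof (rule holomorphic_uniform_sequence[OF open_ball h_hol])
    fix l assume "l \<in> ball l\<^sub>0 \<delta>"
    then obtain d where "d > 0" "cball l d \<subseteq> ball l\<^sub>0 \<delta>"
      using open_contains_cball open_ball by meson
    then show "\<exists>d>0. cball l d \<subseteq> ball l\<^sub>0 \<delta> \<and> uniform_limit (cball l d) h g sequentially"
      using uniform_limit_on_subset[OF lim] by blast
  qed
  have point: "(\<lambda>k. h k l) \<longlonglongrightarrow> g l" if "l \<in> ball l\<^sub>0 \<delta>" for l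
    using tendsto_uniform_limitI[OF lim that] .
  have g_in: "g l \<in> S" if l: "l \<in> ball l\<^sub>0 \<delta>" for l
    using closed_sequentially[OF closed_cball in_cball[OF l] point[OF l]] \<eta>(2) by blast
  have "G l (g l) = 0" if l: "l \<in> ball l\<^sub>0 \<delta>" for l
  proof -
    have "isCont (G l) (g l)" using deriv[OF g_in[OF l]] by (rule DERIV_isCont)
    then have "(\<lambda>k. h k l - G l (h k l) / b) \<longlonglongrightarrow> g l - G l (g l) / b"
      by (intro tendsto_intros point[OF l] b isCont_tendsto_compose[of _ "G l"])
    moreover have "(\<lambda>k. h k l - G l (h k l) / b) = (\<lambda>k. h (Suc k) l)"
      by (simp add: h_simps(2) \<Phi>_def)
    ultimately have "(\<lambda>k. h (Suc k) l) \<longlonglongrightarrow> g l - G l (g l) / b" by simp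
    from LIMSEQ_unique[OF this LIMSEQ_Suc[OF point[OF l]]] have "g l - G l (g l) / b = g l" .
    then show ?thesis using b by simp
  qed
  moreover have "g l\<^sub>0 = z\<^sub>0"
  proof -
    have "h k l\<^sub>0 = z\<^sub>0" for k
      by (induction k) (simp_all add: h_simps \<Phi>_def zero)
    then have "(\<lambda>k. h k l\<^sub>0) \<longlonglongrightarrow> z\<^sub>0" by simp
    moreover have "(\<lambda>k. h k l\<^sub>0) \<longlonglongrightarrow> g l\<^sub>0" using point[of l\<^sub>0] \<delta> by simp
    ultimately show ?thesis using LIMSEQ_unique by blast
  qed
  ultimately show ?thesis using \<delta> g_hol g_in by (intro that[of \<delta> g]) auto
qed

section \<open>Spaces given by a carrier and a norm as isometric images\<close>

text \<open>
  The spaces of the theorem are sets of functions with a norm that is a mere function on them. Such a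
  space \<open>(V, N)\<close> is studied as the image of a subspace \<open>E\<close> of a Banach space under a linear isometry
  \<open>\<psi>\<close>; completeness, integration and Baire's theorem are then at hand in the type of \<open>E\<close>, and limits and
  closures in \<open>V\<close> are images of those in \<open>E\<close>.
\<close>

locale isometric_model =
  fixes V :: "'v::complex_vector set" and N :: "'v \<Rightarrow> real"
    and \<psi> :: "'w::{complex_normed,banach} \<Rightarrow> 'v" and E :: "'w set"
  assumes subspace_E: "cvec.subspace E"
    and psi_add: "x \<in> E \<Longrightarrow> y \<in> E \<Longrightarrow> \<psi> (x + y) = \<psi> x + \<psi> y"
    and psi_scaleC: "x \<in> E \<Longrightarrow> \<psi> (c *\<^sub>C x) = c *\<^sub>C \<psi> x"
    and psi_image: "\<psi> ` E = V"
    and N_psi: "x \<in> E \<Longrightarrow> N (\<psi> x) = norm x"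
begin

lemma zero_E: "0 \<in> E"
  using subspace_E by (rule cvec.subspace_0)

lemma psi_zero: "\<psi> 0 = 0"
  using psi_scaleC[OF zero_E, of 0] by simp

lemma psi_minus: "x \<in> E \<Longrightarrow> \<psi> (- x) = - \<psi> x"
  using psi_scaleC[of x "-1"] by (simp add: scaleC_one)

lemma psi_diff: "x \<in> E \<Longrightarrow> y \<in> E \<Longrightarrow> \<psi> (x - y) = \<psi> x - \<psi> y"
  using psi_add[of x "- y"] psi_minus[of y] cvec.subspace_neg[OF subspace_E, of y] by simp

lemma psi_sum:
  "finite I \<Longrightarrow> (\<And>i. i \<in> I \<Longrightarrow> x i \<in> E) \<Longrightarrow> \<psi> (sum x I) = (\<Sum>i\<in>I. \<psi> (x i))"
proof (induction I rule: finite_induct)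
  case (insert i I)
  then show ?case by (simp add: psi_add cvec.subspace_sum[OF subspace_E])
qed (simp add: psi_zero)

lemma N_diff: "x \<in> E \<Longrightarrow> y \<in> E \<Longrightarrow> N (\<psi> x - \<psi> y) = dist x y"
  using N_psi[of "x - y"] cvec.subspace_diff[OF subspace_E, of x y] by (simp add: psi_diff dist_norm)

lemma psi_in_V: "x \<in> E \<Longrightarrow> \<psi> x \<in> V"
  using psi_image by blast

lemma psi_inject: "x \<in> E \<Longrightarrow> y \<in> E \<Longrightarrow> \<psi> x = \<psi> y \<longleftrightarrow> x = y"
proof
  assume "x \<in> E" "y \<in> E" "\<psi> x = \<psi> y"
  then show "x = y" using N_diff[of x y] N_diff[of x x] by simp
qed simp

lemma V_cases: "v \<in> V \<Longrightarrow> (\<And>x. x \<in> E \<Longrightarrow> v = \<psi> x \<Longrightarrow> P) \<Longrightarrow> P"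
  using psi_image by blast

abbreviation V_dist :: "'v \<Rightarrow> 'v \<Rightarrow> real"
  where "V_dist \<equiv> (\<lambda>x y. if x \<in> V \<and> y \<in> V then N (x - y) else 0)"

lemma V_dist_psi: "x \<in> E \<Longrightarrow> y \<in> E \<Longrightarrow> V_dist (\<psi> x) (\<psi> y) = dist x y"
  by (simp add: psi_in_V N_diff)

lemma Metric_space_V: "Metric_space V V_dist"
proof
  have V: "\<exists>x\<in>E. v = \<psi> x" if "v \<in> V" for v using that psi_image by blast
  fix u v :: 'v
  show "0 \<le> V_dist u v"
  proof (cases "u \<in> V \<and> v \<in> V")
    case True
    then obtain x y where "x \<in> E" "u = \<psi> x" "y \<in> E" "v = \<psi> y" using V by meson
    then show ?thesis by (simp only: V_dist_psi zero_le_dist)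
  qed auto
  show "V_dist u v = V_dist v u"
  proof (cases "u \<in> V \<and> v \<in> V")
    case True
    then obtain x y where "x \<in> E" "u = \<psi> x" "y \<in> E" "v = \<psi> y" using V by meson
    then show ?thesis by (simp only: V_dist_psi dist_commute)
  qed auto
next
  have V: "\<exists>x\<in>E. v = \<psi> x" if "v \<in> V" for v using that psi_image by blast
  fix u v assume "u \<in> V" "v \<in> V"
  then obtain x y where xy: "x \<in> E" "u = \<psi> x" "y \<in> E" "v = \<psi> y" using V by meson
  then show "V_dist u v = 0 \<longleftrightarrow> u = v" by (simp only: V_dist_psi psi_inject dist_eq_0_iff)
  fix w assume "w \<in> V"
  then obtain z where "z \<in> E" "w = \<psi> z" using V by meson
  then show "V_dist u w \<le> V_dist u v + V_dist v w"
    using xy by (simp only: V_dist_psi dist_triangle)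
qed

lemma topspace_ntop: "topspace (ntop V N) = V"
  unfolding ntop_def by (rule Metric_space.topspace_mtopology[OF Metric_space_V])

lemma limitin_contraction:
  assumes "l \<in> V" and "\<forall>\<^sub>F i in F. h i \<in> V \<and> N (h i - l) \<le> b i" and "(b \<longlongrightarrow> 0) F"
  shows "limitin (ntop V N) h l F"
  unfolding ntop_def Metric_space.limitin_metric[OF Metric_space_V]
proof (intro conjI allI impI)
  fix e :: real assume "e > 0"
  then have "\<forall>\<^sub>F i in F. \<bar>b i\<bar> < e" using tendstoD[OF assms(3), of e] by simp
  with assms(2) show "\<forall>\<^sub>F i in F. h i \<in> V \<and> V_dist (h i) l < e"
    by eventually_elim (use assms(1) in auto)
qed fact

lemma limitin_psi:
  assumes "x \<in> E" and "\<forall>\<^sub>F i in F. g i \<in> E \<and> h i = \<psi> (g i)" and "(g \<longlongrightarrow> x) F"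
  shows "limitin (ntop V N) h (\<psi> x) F"
proof (rule limitin_contraction)
  show "\<forall>\<^sub>F i in F. h i \<in> V \<and> N (h i - \<psi> x) \<le> dist (g i) x"
    using assms(2) by eventually_elim (simp add: N_diff psi_in_V assms(1))
  show "((\<lambda>i. dist (g i) x) \<longlongrightarrow> 0) F" by (rule tendsto_dist_iff[THEN iffD1, OF assms(3)])
qed (use assms(1) psi_in_V in auto)

lemma limitin_unique:
  "F \<noteq> bot \<Longrightarrow> limitin (ntop V N) h l F \<Longrightarrow> limitin (ntop V N) h l' F \<Longrightarrow> l = l'"
  unfolding ntop_def using Metric_space.limitin_metric_unique[OF Metric_space_V] by blast

lemma closure_of_psi:
  assumes "S \<subseteq> E"
  shows "ntop V N closure_of (\<psi> ` S) = \<psi> ` (closure S \<inter> E)"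
proof -
  have "v \<in> ntop V N closure_of (\<psi> ` S) \<longleftrightarrow> v \<in> \<psi> ` (closure S \<inter> E)" for v
  proof (cases "v \<in> V")
    case True
    then obtain x where x: "x \<in> E" "v = \<psi> x" using psi_image by blast
    have "v \<in> ntop V N closure_of (\<psi> ` S) \<longleftrightarrow> (\<forall>r>0. \<exists>y\<in>S. V_dist v (\<psi> y) < r)"
    proof -
      have "\<psi> y \<in> Metric_space.mball V V_dist v r \<longleftrightarrow> V_dist v (\<psi> y) < r" if "y \<in> S" for y r
        using True that assms psi_in_V unfolding Metric_space.in_mball[OF Metric_space_V] by blast
      then show ?thesis
        unfolding ntop_def Metric_space.metric_closure_of[OF Metric_space_V]
        using True by (simp cong: bex_cong)
    qed
    also have "\<dots> \<longleftrightarrow> (\<forall>r>0. \<exists>y\<in>S. dist y x < r)"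
    proof -
      have "V_dist v (\<psi> y) = dist y x" if "y \<in> S" for y
        unfolding x(2) using V_dist_psi[OF x(1), of y] that assms by (metis dist_commute subsetD)
      then show ?thesis by (auto cong: bex_cong)
    qed
    also have "\<dots> \<longleftrightarrow> x \<in> closure S" by (simp add: closure_approachable)
    also have "\<dots> \<longleftrightarrow> v \<in> \<psi> ` (closure S \<inter> E)"
      using x by (auto simp: psi_inject)
    finally show ?thesis .
  next
    case False
    then show ?thesis
      using closure_of_subset_topspace[of "ntop V N" "\<psi> ` S"] topspace_ntop psi_in_V by auto
  qed
  then show ?thesis by blast
qed

lemma submodel:
  assumes "cvec.subspace Y" "Y \<subseteq> E"
  shows "isometric_model (\<psi> ` Y) N \<psi> Y"
  by standard (use assms in \<open>auto simp: psi_add psi_scaleC N_psi subsetD\<close>)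

lemma subspace_psi_image:
  assumes Y: "cvec.subspace Y" "Y \<subseteq> E"
  shows "cvec.subspace (\<psi> ` Y)"
proof (rule cvec.subspaceI)
  show "0 \<in> \<psi> ` Y" using psi_zero cvec.subspace_0[OF Y(1)] by (metis imageI)
  fix u v c assume "u \<in> \<psi> ` Y"
  then obtain x where x: "x \<in> Y" "u = \<psi> x" by blast
  then show "c *\<^sub>C u \<in> \<psi> ` Y"
    using psi_scaleC[of x c] Y cvec.subspace_scale[OF Y(1)] by (metis imageI subsetD)
  assume "v \<in> \<psi> ` Y"
  then obtain y where "y \<in> Y" "v = \<psi> y" by blast
  then show "u + v \<in> \<psi> ` Y"
    using x psi_add[of x y] Y cvec.subspace_add[OF Y(1)] by (metis imageI subsetD)
qed

lemma closed_subspace_psi_image: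
  assumes "cvec.subspace Y" "Y \<subseteq> E" "closed Y"
  shows "closed_subspace V N (\<psi> ` Y)"
proof -
  have "\<psi> ` Y \<subseteq> topspace (ntop V N)" using assms(2) psi_in_V by (auto simp: topspace_ntop)
  moreover have "ntop V N closure_of (\<psi> ` Y) \<subseteq> \<psi> ` Y"
    using assms by (simp add: closure_of_psi closure_closed image_mono)
  ultimately show ?thesis
    unfolding closed_subspace_def
    using subspace_psi_image[OF assms(1,2)] closure_of_subset_eq by blast
qed

text \<open>
  An arbitrary subspace of \<open>V\<close>, such as one on which an operator is assumed to be chaotic, inherits
  the model.
\<close>

lemma model_of_subspace:
  assumes Z: "cvec.subspace Z" "Z \<subseteq> V"
  shows "isometric_model Z N \<psi> {x \<in> E. \<psi> x \<in> Z}"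
proof
  show "cvec.subspace {x \<in> E. \<psi> x \<in> Z}"
    by (rule cvec.subspaceI)
       (auto simp: zero_E psi_zero psi_add psi_scaleC Z(1) intro: cvec.subspace_0 cvec.subspace_add
         cvec.subspace_scale subspace_E)
  show "\<psi> ` {x \<in> E. \<psi> x \<in> Z} = Z" using Z(2) psi_image by blast
qed (auto simp: psi_add psi_scaleC N_psi)

lemma dense_imp_nonzero_element:
  assumes "ntop V N closure_of P = V" "P \<subseteq> V" "V \<noteq> {0}"
  shows "\<exists>x\<in>P. x \<noteq> 0"
proof (rule ccontr)
  assume "\<not> (\<exists>x\<in>P. x \<noteq> 0)"
  then have "P \<subseteq> \<psi> ` {0}" using psi_zero by auto
  then have "ntop V N closure_of P \<subseteq> ntop V N closure_of (\<psi> ` {0})" by (rule closure_of_mono)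
  also have "\<dots> \<subseteq> {0}"
    using zero_E psi_zero by (subst closure_of_psi) auto
  finally have "V \<subseteq> {0}" using assms(1) by simp
  moreover have "0 \<in> V" using psi_in_V[OF zero_E] psi_zero by simp
  ultimately show False using assms(3) by blast
qed

lemma bounded_op_psi:
  assumes "bounded_operator T R" and "\<And>x. x \<in> E \<Longrightarrow> T x \<in> E" and S: "\<And>x. x \<in> E \<Longrightarrow> S (\<psi> x) = \<psi> (T x)"
  shows "bounded_op V N S"
proof -
  interpret bounded_operator T R by fact
  have 1: "S u \<in> V" if "u \<in> V" for u
    using that by (rule V_cases) (simp add: S assms(2) psi_in_V)
  have 2: "S (u + v) = S u + S v" if "u \<in> V" "v \<in> V" for u v
  proof -
    obtain x y where xy: "x \<in> E" "u = \<psi> x" "y \<in> E" "v = \<psi> y"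
      using \<open>u \<in> V\<close> \<open>v \<in> V\<close> unfolding psi_image[symmetric] by blast
    have "S (u + v) = S (\<psi> (x + y))" using xy by (simp add: psi_add)
    also have "\<dots> = \<psi> (T (x + y))"
      using xy cvec.subspace_add[OF subspace_E] by (simp add: S)
    also have "\<dots> = S u + S v"
      using xy by (simp add: S assms(2) psi_add[symmetric] op_add)
    finally show ?thesis .
  qed
  have 3: "S (c *\<^sub>C u) = c *\<^sub>C S u" if "u \<in> V" for u c
  proof -
    obtain x where x: "x \<in> E" "u = \<psi> x"
      using \<open>u \<in> V\<close> unfolding psi_image[symmetric] by blast
    have "S (c *\<^sub>C u) = S (\<psi> (c *\<^sub>C x))" using x by (simp add: psi_scaleC)
    also have "\<dots> = \<psi> (T (c *\<^sub>C x))"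
      using x cvec.subspace_scale[OF subspace_E] by (simp add: S)
    also have "\<dots> = c *\<^sub>C S u"
      using x by (simp add: S assms(2) psi_scaleC[symmetric] op_scaleC)
    finally show ?thesis .
  qed
  have 4: "N (S u) \<le> R * N u" if "u \<in> V" for u
    using that by (rule V_cases) (simp add: S assms(2) N_psi op_bound)
  show ?thesis
    unfolding bounded_op_def by (intro conjI ballI allI exI[of _ R] 1 2 3 4)
qed

end

section \<open>The Herzog space in coordinates\<close>

definition herzog_fun :: "real \<Rightarrow> (nat \<Rightarrow> complex) \<Rightarrow> real \<Rightarrow> complex"
  where "herzog_fun \<rho> a x = (\<Sum>k. a k * of_real (\<rho> ^ k / fact k) * of_real (x ^ k))"

lemma herzog_fun_summable:
  fixes z :: complex
  assumes "Bseq a"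
  shows "summable (\<lambda>k. a k * of_real (\<rho> ^ k / fact k) * z ^ k)"
proof -
  obtain B where B: "\<And>k. cmod (a k) \<le> B" using assms unfolding Bseq_def by blast
  have "summable (\<lambda>k. B * (\<bar>\<rho>\<bar> * cmod z) ^ k / fact k)"
    using summable_mult[OF summable_exp_generic[of "\<bar>\<rho>\<bar> * cmod z"], of B]
    by (simp add: field_simps)
  then show ?thesis
  proof (rule summable_comparison_test')
    fix k
    have "norm (a k * of_real (\<rho> ^ k / fact k) * z ^ k) = cmod (a k) * ((\<bar>\<rho>\<bar> * cmod z) ^ k / fact k)"
      by (simp add: norm_mult norm_power norm_divide power_abs power_mult_distrib)
    also have "\<dots> \<le> B * ((\<bar>\<rho>\<bar> * cmod z) ^ k / fact k)" by (intro mult_right_mono B) auto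
    finally show "norm (a k * of_real (\<rho> ^ k / fact k) * z ^ k) \<le> B * (\<bar>\<rho>\<bar> * cmod z) ^ k / fact k"
      by simp
  qed
qed

lemma herzog_fun_sums:
  "Bseq a \<Longrightarrow> (\<lambda>k. a k * of_real (\<rho> ^ k / fact k) * of_real (x ^ k)) sums herzog_fun \<rho> a x"
  unfolding herzog_fun_def using summable_sums[OF herzog_fun_summable[of a \<rho> "of_real x"]] by simp

lemma null_imp_Bseq: "a \<longlonglongrightarrow> (0::complex) \<Longrightarrow> Bseq a"
  by (intro convergent_imp_Bseq convergentI)

lemma herzog_expansion_fun: "a \<longlonglongrightarrow> 0 \<Longrightarrow> herzog_expansion \<rho> (herzog_fun \<rho> a) a"
  unfolding herzog_expansion_def using herzog_fun_sums[OF null_imp_Bseq] by blast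

lemma herzog_expansion_imp_fun:
  assumes "herzog_expansion \<rho> f a"
  shows "f = herzog_fun \<rho> a"
  using assms unfolding herzog_expansion_def herzog_fun_def by (auto simp: fun_eq_iff sums_iff)

lemma herzog_fun_add:
  assumes "Bseq a" "Bseq b"
  shows "herzog_fun \<rho> (\<lambda>k. a k + b k) = herzog_fun \<rho> a + herzog_fun \<rho> b"
proof
  fix x
  have "(\<lambda>k. (a k + b k) * of_real (\<rho> ^ k / fact k) * of_real (x ^ k)) sums
      (herzog_fun \<rho> a x + herzog_fun \<rho> b x)"
    unfolding distrib_right by (intro sums_add herzog_fun_sums assms)
  then show "herzog_fun \<rho> (\<lambda>k. a k + b k) x = (herzog_fun \<rho> a + herzog_fun \<rho> b) x"
    unfolding herzog_fun_def[of \<rho> "\<lambda>k. a k + b k"] by (simp add: sums_iff)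
qed

lemma herzog_fun_scaleC:
  assumes "Bseq a"
  shows "herzog_fun \<rho> (\<lambda>k. c * a k) = c *\<^sub>C herzog_fun \<rho> a"
proof
  fix x
  show "herzog_fun \<rho> (\<lambda>k. c * a k) x = (c *\<^sub>C herzog_fun \<rho> a) x"
    using sums_mult[OF herzog_fun_sums[OF assms], of c \<rho> x]
    unfolding herzog_fun_def[of \<rho> "\<lambda>k. c * a k"]
    by (simp add: sums_iff mult.assoc scaleC_fun_def scaleC_complex_def)
qed

lemma herzog_norm_fun:
  "\<rho> > 0 \<Longrightarrow> a \<longlonglongrightarrow> 0 \<Longrightarrow> herzog_norm \<rho> (herzog_fun \<rho> a) = (SUP k. cmod (a k))"
  by (simp add: herzog_norm_def herzog_coeff_eq[OF _ herzog_expansion_fun])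

lemma herzog_fun_in_space: "a \<longlonglongrightarrow> 0 \<Longrightarrow> herzog_fun \<rho> a \<in> herzog_space \<rho>"
  unfolding herzog_space_def using herzog_expansion_fun by blast

lemma diff_op_herzog_fun:
  assumes "Bseq a"
  shows "diff_op (herzog_fun \<rho> a) = herzog_fun \<rho> (\<lambda>k. \<rho> * a (Suc k))"
proof
  fix x
  define c where "c = (\<lambda>k. a k * of_real (\<rho> ^ k / fact k))"
  have "((\<lambda>z. \<Sum>k. c k * z ^ k) has_field_derivative (\<Sum>k. diffs c k * of_real x ^ k)) (at (of_real x))"
    by (rule termdiffs_strong_converges_everywhere) (use herzog_fun_summable[OF assms] in \<open>simp add: c_def\<close>)
  then have "((\<lambda>x. \<Sum>k. c k * of_real x ^ k) has_vector_derivative (\<Sum>k. diffs c k * of_real x ^ k)) (at x)"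
    by (rule has_vector_derivative_real_field)
  moreover have "(\<lambda>x. \<Sum>k. c k * of_real x ^ k) = herzog_fun \<rho> a"
    by (simp add: herzog_fun_def c_def fun_eq_iff)
  moreover have "diffs c k = \<rho> * a (Suc k) * of_real (\<rho> ^ k / fact k)" for k
  proof -
    have "(of_nat (Suc k) :: complex) / fact (Suc k) = 1 / fact k"
      by (simp del: of_nat_Suc)
    then show ?thesis unfolding diffs_def c_def by (simp add: field_simps del: of_nat_Suc fact_Suc)
  qed
  ultimately show "diff_op (herzog_fun \<rho> a) x = herzog_fun \<rho> (\<lambda>k. \<rho> * a (Suc k)) x"
    unfolding diff_op_def by (simp add: vector_derivative_at herzog_fun_def)
qed

text \<open>
  Coordinate \<open>i\<close> of an element of the product space is given by the coefficients in row \<open>i\<close>. The arrays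
  of \<open>null_rows n\<close> represent \<open>X\<^sub>\<rho>\<^sup>n\<close>, those of \<open>null_rows 1\<close> represent \<open>X\<^sub>\<rho>\<close> itself.
\<close>

definition rows_fun :: "real \<Rightarrow> array \<Rightarrow> nat \<Rightarrow> real \<Rightarrow> complex"
  where "rows_fun \<rho> w i = herzog_fun \<rho> (\<lambda>k. w (i, k))"

definition null_rows :: "nat \<Rightarrow> array set"
  where "null_rows n = {w :: array. (\<forall>i. (\<lambda>k. w (i, k)) \<longlonglongrightarrow> 0) \<and> (\<forall>i k. i \<notin> {1..n} \<longrightarrow> w (i, k) = 0)}"

lemma null_rowsD: "w \<in> null_rows n \<Longrightarrow> (\<lambda>k. w (i, k)) \<longlonglongrightarrow> 0"
  "w \<in> null_rows n \<Longrightarrow> i \<notin> {1..n} \<Longrightarrow> w (i, k) = 0"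
  by (auto simp: null_rows_def)

lemma Bseq_row: "Bseq (\<lambda>k. apply_bcontfun (w :: array) (i, k))"
  by (rule BseqI'[of _ "norm w"]) (rule norm_bounded)

lemma rows_fun_add: "rows_fun \<rho> (v + w) = rows_fun \<rho> v + rows_fun \<rho> w"
proof
  fix i
  show "rows_fun \<rho> (v + w) i = (rows_fun \<rho> v + rows_fun \<rho> w) i"
    using herzog_fun_add[OF Bseq_row[of v i] Bseq_row[of w i]] by (simp add: rows_fun_def)
qed

lemma rows_fun_scaleC: "rows_fun \<rho> (c *\<^sub>C w) = c *\<^sub>C rows_fun \<rho> w"
proof
  fix i
  show "rows_fun \<rho> (c *\<^sub>C w) i = (c *\<^sub>C rows_fun \<rho> w) i"
    using herzog_fun_scaleC[OF Bseq_row[of w i]] unfolding scaleC_fun_def[of c "rows_fun \<rho> w"]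
    by (simp add: rows_fun_def scaleC_complex_def)
qed

lemma rows_fun_scaleC_row: "rows_fun \<rho> (c *\<^sub>C w) i = c *\<^sub>C rows_fun \<rho> w i"
  by (simp add: rows_fun_scaleC scaleC_fun_def)

lemma subspace_null_rows: "cvec.subspace (null_rows n)"
  by (rule cvec.subspaceI)
     (auto simp: null_rows_def scaleC_complex_def intro: tendsto_add_zero tendsto_mult_right_zero)

lemma closed_null_rows: "closed (null_rows n)"
  unfolding closed_sequential_limits
proof (intro allI impI)
  fix f :: "nat \<Rightarrow> array" and w
  assume "(\<forall>m. f m \<in> null_rows n) \<and> f \<longlonglongrightarrow> w"
  then have f: "\<And>m. f m \<in> null_rows n" and lim: "f \<longlonglongrightarrow> w" by auto
  have "w (i, k) = 0" if "i \<notin> {1..n}" for i k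
  proof -
    have "(\<lambda>m. f m (i, k)) \<longlonglongrightarrow> w (i, k)"
      by (rule bounded_linear.tendsto[OF bounded_linear_apply_bcontfun lim])
    moreover have "(\<lambda>m. f m (i, k)) = (\<lambda>m. 0)" using null_rowsD(2)[OF f that] by simp
    ultimately show ?thesis using LIMSEQ_const_iff by metis
  qed
  moreover have "(\<lambda>k. w (i, k)) \<longlonglongrightarrow> 0" for i
  proof (rule LIMSEQ_I)
    fix e :: real assume "e > 0"
    then obtain m where m: "dist (f m) w < e / 2"
      using metric_LIMSEQ_D[OF lim, of "e / 2"] by auto
    obtain K where K: "\<And>k. k \<ge> K \<Longrightarrow> cmod (f m (i, k)) < e / 2"
      using LIMSEQ_D[OF null_rowsD(1)[OF f], of "e / 2" m i] \<open>e > 0\<close> by auto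
    have "cmod (w (i, k) - 0) < e" if "k \<ge> K" for k
    proof -
      have "dist (f m (i, k)) (w (i, k)) < e / 2"
        using m by (rule dist_fun_lt_imp_dist_val_lt)
      then show ?thesis
        using K[OF that] norm_triangle_ineq[of "f m (i, k)" "w (i, k) - f m (i, k)"]
        by (simp add: dist_norm norm_minus_commute)
    qed
    then show "\<exists>K. \<forall>k\<ge>K. cmod (w (i, k) - 0) < e" by blast
  qed
  ultimately show "w \<in> null_rows n" by (simp add: null_rows_def)
qed

lemma array_of_rows:
  fixes a :: "nat \<Rightarrow> nat \<Rightarrow> complex"
  assumes "\<And>i. i \<in> {1..n} \<Longrightarrow> a i \<longlonglongrightarrow> 0"
  obtains w where "w \<in> null_rows n" "\<And>i k. apply_bcontfun w (i, k) = (if i \<in> {1..n} then a i k else 0)"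
proof -
  have "\<forall>i. \<exists>B. i \<in> {1..n} \<longrightarrow> (\<forall>k. cmod (a i k) \<le> B)"
    using null_imp_Bseq[OF assms] unfolding Bseq_def by blast
  then obtain B where B: "\<And>i k. i \<in> {1..n} \<Longrightarrow> cmod (a i k) \<le> B i" by metis
  define C where "C = (\<Sum>i\<in>{1..n}. \<bar>B i\<bar>)"
  have "norm (case q of (i, k) \<Rightarrow> if i \<in> {1..n} then a i k else 0) \<le> C" for q
  proof (cases q)
    case (Pair i k)
    have "cmod (a i k) \<le> C" if "i \<in> {1..n}"
    proof -
      have "cmod (a i k) \<le> \<bar>B i\<bar>" using B[OF that, of k] by linarith
      also have "\<dots> \<le> C" unfolding C_def using that by (intro member_le_sum) auto
      finally show ?thesis .
    qed
    moreover have "0 \<le> C" by (simp add: C_def sum_nonneg)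
    ultimately show ?thesis using Pair by simp
  qed
  note w = apply_Bcontfun_array[OF this]
  define v where "v = Bcontfun (\<lambda>(i, k). if i \<in> {1..n} then a i k else 0)"
  have v: "v (i, k) = (if i \<in> {1..n} then a i k else 0)" for i k
    unfolding v_def w by simp
  show ?thesis
  proof (rule that[OF _ v])
    have "(\<lambda>k. v (i, k)) \<longlonglongrightarrow> 0" for i
    proof (cases "i \<in> {1..n}")
      case True
      then show ?thesis using assms[OF True] by (simp add: v)
    next
      case False
      then have "(\<lambda>k. v (i, k)) = (\<lambda>k. 0)" by (simp only: v if_False)
      then show ?thesis by simp
    qed
    then show "v \<in> null_rows n" by (auto simp: null_rows_def v)
  qed
qed

lemma herzog_model:
  assumes "\<rho> > 0"
  shows "isometric_model (herzog_space \<rho>) (herzog_norm \<rho>) (\<lambda>w. rows_fun \<rho> w 1) (null_rows 1)"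
proof
  show "(\<lambda>w. rows_fun \<rho> w 1) ` null_rows 1 = herzog_space \<rho>"
  proof
    show "(\<lambda>w. rows_fun \<rho> w 1) ` null_rows 1 \<subseteq> herzog_space \<rho>"
      by (auto simp: rows_fun_def intro!: herzog_fun_in_space null_rowsD)
    show "herzog_space \<rho> \<subseteq> (\<lambda>w. rows_fun \<rho> w 1) ` null_rows 1"
    proof
      fix f assume "f \<in> herzog_space \<rho>"
      then obtain a where a: "herzog_expansion \<rho> f a" unfolding herzog_space_def by blast
      then have "a \<longlonglongrightarrow> 0" by (simp add: herzog_expansion_def)
      then obtain w where w: "w \<in> null_rows 1" "\<And>i k. w (i, k) = (if i \<in> {1..1} then a k else 0)"
        using array_of_rows[of 1 "\<lambda>_. a"] by blast
      have "f = rows_fun \<rho> w 1"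
        unfolding herzog_expansion_imp_fun[OF a] rows_fun_def w(2) by simp
      then show "f \<in> (\<lambda>w. rows_fun \<rho> w 1) ` null_rows 1" using w(1) by blast
    qed
  qed
  fix w assume w: "w \<in> null_rows 1"
  have "(SUP k. cmod (w (1, k))) = norm w"
  proof (rule antisym)
    show "(SUP k. cmod (w (1, k))) \<le> norm w" by (rule cSUP_least) (auto simp: norm_bounded)
    have bdd: "bdd_above (range (\<lambda>k. cmod (w (1, k))))"
      by (rule bdd_aboveI2[of _ _ "norm w"]) (rule norm_bounded)
    show "norm w \<le> (SUP k. cmod (w (1, k)))"
    proof (rule norm_bound)
      fix p :: "nat \<times> nat"
      obtain i k where p: "p = (i, k)" by (cases p)
      have "cmod (w (1, k)) \<le> (SUP k. cmod (w (1, k)))" by (rule cSUP_upper[OF _ bdd]) simp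
      moreover from this have "0 \<le> (SUP k. cmod (w (1, k)))" using norm_ge_zero order_trans by blast
      ultimately show "cmod (w p) \<le> (SUP k. cmod (w (1, k)))"
        using null_rowsD(2)[OF w, of i k] by (cases "i = 1") (auto simp: p)
    qed
  qed
  then show "herzog_norm \<rho> (rows_fun \<rho> w 1) = norm w"
    using herzog_norm_fun[OF assms null_rowsD(1)[OF w]] by (simp add: rows_fun_def)
qed (auto simp: subspace_null_rows rows_fun_add rows_fun_scaleC_row)

lemma rows_fun_in_space: "w \<in> null_rows n \<Longrightarrow> rows_fun \<rho> w i \<in> herzog_space \<rho>"
  unfolding rows_fun_def by (intro herzog_fun_in_space null_rowsD)

lemma herzog_norm_rows_fun:
  "\<rho> > 0 \<Longrightarrow> w \<in> null_rows n \<Longrightarrow> herzog_norm \<rho> (rows_fun \<rho> w i) = (SUP k. cmod (w (i, k)))"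
  unfolding rows_fun_def by (intro herzog_norm_fun null_rowsD)

lemma herzog_norm_rows_fun_le:
  "\<rho> > 0 \<Longrightarrow> w \<in> null_rows n \<Longrightarrow> herzog_norm \<rho> (rows_fun \<rho> w i) \<le> norm w"
  by (subst herzog_norm_rows_fun) (auto intro!: cSUP_least simp: norm_bounded)

lemma product_model:
  assumes "\<rho> > 0" "n \<ge> 1"
  shows "isometric_model (prod_space n (herzog_space \<rho>)) (prod_norm n (herzog_norm \<rho>))
    (rows_fun \<rho>) (null_rows n)"
proof
  interpret X: isometric_model "herzog_space \<rho>" "herzog_norm \<rho>" "\<lambda>w. rows_fun \<rho> w 1" "null_rows 1"
    by (rule herzog_model[OF assms(1)])
  have zero: "herzog_fun \<rho> (\<lambda>k. 0) = 0" by (simp add: herzog_fun_def fun_eq_iff)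
  show "rows_fun \<rho> ` null_rows n = prod_space n (herzog_space \<rho>)"
  proof
    show "rows_fun \<rho> ` null_rows n \<subseteq> prod_space n (herzog_space \<rho>)"
    proof
      fix F assume "F \<in> rows_fun \<rho> ` null_rows n"
      then obtain w where w: "w \<in> null_rows n" "F = rows_fun \<rho> w" by blast
      have "F i = 0" if "i \<notin> {1..n}" for i
        using null_rowsD(2)[OF w(1) that] zero by (simp add: w(2) rows_fun_def)
      then show "F \<in> prod_space n (herzog_space \<rho>)"
        unfolding prod_space_def w(2) using rows_fun_in_space[OF w(1)] by blast
    qed
    show "prod_space n (herzog_space \<rho>) \<subseteq> rows_fun \<rho> ` null_rows n"
    proof
      fix F assume F: "F \<in> prod_space n (herzog_space \<rho>)"
      then have "\<forall>i. \<exists>a. i \<in> {1..n} \<longrightarrow> herzog_expansion \<rho> (F i) a"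
        by (auto simp: prod_space_def herzog_space_def)
      then obtain a where a: "\<And>i. i \<in> {1..n} \<Longrightarrow> herzog_expansion \<rho> (F i) (a i)" by metis
      then have "\<And>i. i \<in> {1..n} \<Longrightarrow> a i \<longlonglongrightarrow> 0" by (simp add: herzog_expansion_def)
      then obtain w where w: "w \<in> null_rows n" "\<And>i k. w (i, k) = (if i \<in> {1..n} then a i k else 0)"
        using array_of_rows[of n a] by blast
      have "F i = rows_fun \<rho> w i" for i
      proof (cases "i \<in> {1..n}")
        case True
        then show ?thesis using herzog_expansion_imp_fun[OF a[OF True]] by (simp add: rows_fun_def w(2))
      next
        case False
        then show ?thesis
          using F zero unfolding rows_fun_def w(2) by (auto simp: prod_space_def)
      qed
      then show "F \<in> rows_fun \<rho> ` null_rows n" using w(1) by blast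
    qed
  qed
  fix w assume w: "w \<in> null_rows n"
  have fin: "finite ((\<lambda>i. herzog_norm \<rho> (rows_fun \<rho> w i)) ` {1..n})" by simp
  have bdd: "bdd_above (range (\<lambda>k. cmod (w (i, k))))" for i
    by (rule bdd_aboveI2[of _ _ "norm w"]) (rule norm_bounded)
  show "prod_norm n (herzog_norm \<rho>) (rows_fun \<rho> w) = norm w"
    unfolding prod_norm_def
  proof (rule antisym)
    show "(MAX i\<in>{1..n}. herzog_norm \<rho> (rows_fun \<rho> w i)) \<le> norm w"
      using assms(2) by (intro Max.boundedI fin) (auto intro: herzog_norm_rows_fun_le[OF assms(1) w])
    have le: "cmod (w (i, k)) \<le> (MAX i\<in>{1..n}. herzog_norm \<rho> (rows_fun \<rho> w i))" if "i \<in> {1..n}" for i k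
    proof -
      have "cmod (w (i, k)) \<le> herzog_norm \<rho> (rows_fun \<rho> w i)"
        unfolding herzog_norm_rows_fun[OF assms(1) w] by (rule cSUP_upper[OF _ bdd]) simp
      also have "\<dots> \<le> (MAX i\<in>{1..n}. herzog_norm \<rho> (rows_fun \<rho> w i))"
        using that by (intro Max_ge fin) blast
      finally show ?thesis .
    qed
    show "norm w \<le> (MAX i\<in>{1..n}. herzog_norm \<rho> (rows_fun \<rho> w i))"
    proof (rule norm_bound)
      fix p :: "nat \<times> nat"
      obtain i k where p: "p = (i, k)" by (cases p)
      have "0 \<le> (MAX i\<in>{1..n}. herzog_norm \<rho> (rows_fun \<rho> w i))"
        using order_trans[OF norm_ge_zero le[of 1 0]] assms(2) by simp
      then show "cmod (w p) \<le> (MAX i\<in>{1..n}. herzog_norm \<rho> (rows_fun \<rho> w i))"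
        using le[of i k] null_rowsD(2)[OF w, of i k] by (cases "i \<in> {1..n}") (auto simp: p)
    qed
  qed
qed (auto simp: subspace_null_rows rows_fun_add rows_fun_scaleC)

section \<open>Differentiation as a weighted backward shift\<close>

definition row_shift :: "real \<Rightarrow> array \<Rightarrow> array"
  where "row_shift \<rho> w = Bcontfun (\<lambda>(i, k). of_real \<rho> * w (i, Suc k))"

lemma row_shift_apply [simp]:
  "apply_bcontfun (row_shift \<rho> w) (i, k) = of_real \<rho> * apply_bcontfun w (i, Suc k)"
proof -
  have "norm (case q of (i, k) \<Rightarrow> of_real \<rho> * apply_bcontfun w (i, Suc k)) \<le> \<bar>\<rho>\<bar> * norm w" for q
    by (cases q) (auto simp: norm_mult intro!: mult_left_mono norm_bounded)
  from apply_Bcontfun_array[OF this] show ?thesis by (simp add: row_shift_def)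
qed

lemma array_eqI: "(\<And>i k. apply_bcontfun v (i, k) = apply_bcontfun w (i, k)) \<Longrightarrow> v = (w :: array)"
  by (rule bcontfun_eqI) auto

lemma array_sum_apply: "apply_bcontfun (\<Sum>j\<in>J. v j) p = (\<Sum>j\<in>J. apply_bcontfun (v j :: array) p)"
  by (induction J rule: infinite_finite_induct) auto

lemma row_shift_operator: "\<rho> > 0 \<Longrightarrow> bounded_operator (row_shift \<rho>) \<rho>"
proof
  fix w :: array assume "\<rho> > 0"
  show "norm (row_shift \<rho> w) \<le> \<rho> * norm w"
  proof (rule norm_bound)
    fix p :: "nat \<times> nat"
    show "cmod (row_shift \<rho> w p) \<le> \<rho> * norm w"
      using \<open>\<rho> > 0\<close> by (cases p) (auto simp: norm_mult intro!: mult_left_mono norm_bounded)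
  qed
qed (auto intro!: array_eqI simp: scaleC_complex_def algebra_simps)

lemma row_shift_null_rows: "w \<in> null_rows n \<Longrightarrow> row_shift \<rho> w \<in> null_rows n"
  unfolding null_rows_def by (auto intro!: tendsto_mult_right_zero LIMSEQ_Suc)

lemma rows_fun_row_shift: "rows_fun \<rho> (row_shift \<rho> w) i = diff_op (rows_fun \<rho> w i)"
  unfolding rows_fun_def by (simp add: diff_op_herzog_fun[OF Bseq_row])

text \<open>
  An eigenvector has geometric rows with ratio \<open>\<mu>/\<rho>\<close>, which tend to zero only if \<open>|\<mu>| < \<rho>\<close>.
\<close>

lemma row_shift_eigenvector:
  assumes "\<rho> > 0" "w \<in> null_rows n" "w \<noteq> 0" "row_shift \<rho> w = \<mu> *\<^sub>C w"
  shows "cmod \<mu> < \<rho>"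
proof (rule ccontr)
  assume "\<not> cmod \<mu> < \<rho>"
  have step: "w (i, Suc k) = \<mu> / \<rho> * w (i, k)" for i k
    using arg_cong[OF assms(4), of "\<lambda>v. v (i, k)"] assms(1)
    by (simp add: scaleC_complex_def field_simps)
  have "cmod (w (i, Suc k)) \<ge> cmod (w (i, k))" for i k
  proof -
    have "1 \<le> cmod (\<mu> / \<rho>)" using \<open>\<not> cmod \<mu> < \<rho>\<close> assms(1) by (simp add: norm_divide)
    then have "1 * cmod (w (i, k)) \<le> cmod (\<mu> / \<rho>) * cmod (w (i, k))"
      by (rule mult_right_mono) simp
    then show ?thesis unfolding step norm_mult by simp
  qed
  then have "incseq (\<lambda>k. cmod (w (i, k)))" for i by (intro incseq_SucI)
  moreover have "(\<lambda>k. cmod (w (i, k))) \<longlonglongrightarrow> 0" for i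
    using tendsto_norm_zero[OF null_rowsD(1)[OF assms(2)]] .
  ultimately have "cmod (w (i, k)) \<le> 0" for i k by (rule incseq_le)
  then have "w = 0" by (intro array_eqI) simp
  then show False using assms(3) by simp
qed

section \<open>The Riesz--Dunford calculus of differentiation\<close>

text \<open>
  The expansion of \<open>1 / (\<zeta> - z)\<close> at \<open>z = 0\<close>, whose operator value is the Neumann series of the
  resolvent.
\<close>

definition resolvent_series :: "complex \<Rightarrow> complex fps"
  where "resolvent_series \<zeta> = Abs_fps (\<lambda>m. 1 / \<zeta> ^ Suc m)"

lemma resolvent_series_conv_radius:
  assumes "\<zeta> \<noteq> 0"
  shows "fps_conv_radius (resolvent_series \<zeta>) \<ge> cmod \<zeta>"
  unfolding fps_conv_radius_def
proof (rule conv_radius_geI_ex')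
  fix r assume "0 < r" "ereal r < ereal (cmod \<zeta>)"
  then have "summable (\<lambda>m. 1 / \<zeta> * (of_real r / \<zeta>) ^ m)"
    using assms by (intro summable_mult summable_geometric) (simp add: norm_divide)
  then show "summable (\<lambda>m. fps_nth (resolvent_series \<zeta>) m * of_real r ^ m)"
    by (simp add: resolvent_series_def power_divide)
qed

lemma resolvent_series_inverse:
  assumes "\<zeta> \<noteq> 0"
  shows "(fps_X - fps_const \<zeta>) * resolvent_series \<zeta> = -1"
proof (rule fps_ext)
  fix m
  show "fps_nth ((fps_X - fps_const \<zeta>) * resolvent_series \<zeta>) m = fps_nth (-1) m"
    using assms by (cases m) (simp_all add: resolvent_series_def left_diff_distrib)
qed

context bounded_operator
begin

lemma
  assumes "cmod \<zeta> > R"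
  shows resolvent_conv: "fps_conv_radius (resolvent_series \<zeta>) > R"
    and resolvent_right: "\<zeta> *\<^sub>C opcalc (resolvent_series \<zeta>) T x - T (opcalc (resolvent_series \<zeta>) T x) = x"
    and resolvent_left: "opcalc (resolvent_series \<zeta>) T (\<zeta> *\<^sub>C x - T x) = x"
proof -
  have z: "\<zeta> \<noteq> 0" using assms op_bound_nonneg by auto
  show conv: "fps_conv_radius (resolvent_series \<zeta>) > R"
    using resolvent_series_conv_radius[OF z] assms by (meson less_ereal.simps(1) less_le_trans)
  have lin: "fps_conv_radius (fps_X - fps_const \<zeta>) > R"
    using fps_conv_radius_diff[of fps_X "fps_const \<zeta>"] by simp
  have neg: "opcalc (-1) T y = - y" for y
    by (subst opcalc_finite[of 1]) (auto simp: scaleC_one cvec.scale_minus_left)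
  have "opcalc (fps_X - fps_const \<zeta>) T (opcalc (resolvent_series \<zeta>) T x) = - x"
    by (simp add: opcalc_mult[OF lin conv, symmetric] resolvent_series_inverse[OF z] neg)
  then have "T (opcalc (resolvent_series \<zeta>) T x) - \<zeta> *\<^sub>C opcalc (resolvent_series \<zeta>) T x = - x"
    by (simp only: opcalc_X_diff_const)
  then show "\<zeta> *\<^sub>C opcalc (resolvent_series \<zeta>) T x - T (opcalc (resolvent_series \<zeta>) T x) = x"
    by (metis minus_diff_eq minus_minus)
  have "opcalc (resolvent_series \<zeta>) T (opcalc (fps_X - fps_const \<zeta>) T x) = - x"
    by (simp add: opcalc_mult[OF conv lin, symmetric] mult.commute[of "resolvent_series \<zeta>"]
        resolvent_series_inverse[OF z] neg)
  then have "opcalc (resolvent_series \<zeta>) T (T x - \<zeta> *\<^sub>C x) = - x"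
    by (simp only: opcalc_X_diff_const)
  then have "opcalc (resolvent_series \<zeta>) T ((-1) *\<^sub>C (T x - \<zeta> *\<^sub>C x)) = (-1) *\<^sub>C (- x)"
    by (simp only: opcalc_scaleC[OF conv])
  then show "opcalc (resolvent_series \<zeta>) T (\<zeta> *\<^sub>C x - T x) = x"
    by (simp add: cvec.scale_minus_left scaleC_one)
qed

text \<open>
  The integrand is a series in \<open>T\<^sup>k x\<close> that converges uniformly on the circle, so it may be integrated
  term by term, and Cauchy's formula identifies the integral of \<open>f(\<zeta>) / \<zeta>\<^bsup>k+1\<^esup>\<close> with
  \<open>2 \<pi> i\<close> times the \<open>k\<close>-th Taylor coefficient of \<open>f\<close>.
\<close>

lemma cauchy_integral_opcalc:
  assumes r: "R < r" and f: "open U" "cball 0 r \<subseteq> U" "f holomorphic_on U"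
  shows "((\<lambda>t. vector_derivative (circlepath 0 r) (at t within {0..1}) *\<^sub>C
      f (circlepath 0 r t) *\<^sub>C opcalc (resolvent_series (circlepath 0 r t)) T x)
    has_integral (2 * of_real pi * \<i>) *\<^sub>C opcalc (fps_expansion f 0) T x) {0..1}"
proof -
  have r0: "r > 0" using r op_bound_nonneg by simp
  define \<gamma> where "\<gamma> = circlepath 0 r"
  have \<gamma>: "\<gamma> t = of_real r * exp (2 * of_real pi * \<i> * of_real t)" for t
    by (simp add: \<gamma>_def circlepath)
  have norm_\<gamma>: "cmod (\<gamma> t) = r" for t
    using r0 by (simp add: \<gamma> norm_mult)
  have \<gamma>_nz: "\<gamma> t \<noteq> 0" for t using norm_\<gamma>[of t] r0 by auto
  have \<gamma>_cont: "continuous_on {0..1} \<gamma>" unfolding \<gamma> by (intro continuous_intros)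
  define c where "c = (\<lambda>t. vector_derivative \<gamma> (at t within {0..1}) * f (\<gamma> t))"
  have "continuous_on {0..1} (\<lambda>t. (2 * of_real pi * \<i> * of_real r * exp (2 * of_real pi * \<i> * of_real t)) * f (\<gamma> t))"
  proof (intro continuous_intros continuous_on_compose2[OF holomorphic_on_imp_continuous_on[OF f(3)] \<gamma>_cont])
    show "\<gamma> ` {0..1} \<subseteq> U" using f(2) norm_\<gamma> by auto
  qed
  then have c_cont: "continuous_on {0..1} c"
    by (rule continuous_on_eq) (simp add: c_def \<gamma>_def vector_derivative_circlepath01)
  obtain M where "\<forall>y\<in>c ` {0..1}. cmod y \<le> M"
    using compact_imp_bounded[OF compact_continuous_image[OF c_cont compact_Icc]]
    unfolding bounded_iff by blast
  then have M: "\<And>t. t \<in> {0..1} \<Longrightarrow> cmod (c t) \<le> M" by blast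
  define g where "g = (\<lambda>k t. (c t / \<gamma> t ^ Suc k) *\<^sub>C (T ^^ k) x)"
  have g_cont: "continuous_on {0..1} (g k)" for k
    unfolding g_def by (intro continuous_intros c_cont \<gamma>_cont) (simp add: \<gamma>_nz)
  have g_bound: "norm (g k t) \<le> M / r * norm x * (R / r) ^ k" if t: "t \<in> {0..1}" for k t
  proof -
    have "norm (g k t) \<le> M / r ^ Suc k * (R ^ k * norm x)"
      unfolding g_def norm_scaleC norm_divide norm_power norm_\<gamma>
    proof (rule mult_mono)
      show "cmod (c t) / r ^ Suc k \<le> M / r ^ Suc k"
        using M[OF t] r0 by (intro divide_right_mono) auto
      show "0 \<le> M / r ^ Suc k"
        using order_trans[OF norm_ge_zero M[OF t]] r0 by auto
    qed (auto intro: pow_bound)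
    also have "\<dots> = M / r * norm x * (R / r) ^ k" by (simp add: power_divide)
    finally show ?thesis .
  qed
  have "uniform_limit {0..1} (\<lambda>m t. \<Sum>k<m. g k t) (\<lambda>t. \<Sum>k. g k t) sequentially"
  proof (rule Weierstrass_m_test[OF g_bound])
    show "summable (\<lambda>k. M / r * norm x * (R / r) ^ k)"
      using r r0 op_bound_nonneg by (intro summable_mult summable_geometric) simp
  qed
  then obtain I J where I: "\<And>m. ((\<lambda>t. \<Sum>k<m. g k t) has_integral I m) {0..1}"
    and J: "((\<lambda>t. \<Sum>k. g k t) has_integral J) {0..1}" and lim: "I \<longlonglongrightarrow> J"
    by (rule uniform_limit_integral) (auto intro!: continuous_on_sum g_cont)
  have int_g: "(g k has_integral (2 * of_real pi * \<i> * fps_nth (fps_expansion f 0) k) *\<^sub>C (T ^^ k) x) {0..1}" for k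
  proof -
    have sub: "ball 0 r \<subseteq> U" using f(2) by auto
    have "((\<lambda>u. f u / (u - 0) ^ Suc k) has_contour_integral
        2 * of_real pi * \<i> / fact k * (deriv ^^ k) f 0) (circlepath 0 r)"
      using Cauchy_has_contour_integral_higher_derivative_circlepath[OF
          holomorphic_on_imp_continuous_on[OF holomorphic_on_subset[OF f(3) f(2)]]
          holomorphic_on_subset[OF f(3) sub], of 0 k] r0 by simp
    then have "((\<lambda>t. c t / \<gamma> t ^ Suc k) has_integral
        2 * of_real pi * \<i> * fps_nth (fps_expansion f 0) k) {0..1}"
      unfolding has_contour_integral_def
      by (simp add: c_def \<gamma>_def fps_expansion_def mult.commute)
    from has_integral_linear[OF this bounded_linear_scaleC_left] show ?thesis
      by (simp add: o_def g_def)
  qed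
  have I_eq: "I m = (\<Sum>k<m. (2 * of_real pi * \<i> * fps_nth (fps_expansion f 0) k) *\<^sub>C (T ^^ k) x)" for m
    by (rule has_integral_unique[OF I]) (intro has_integral_sum finite_lessThan int_g)
  have "f holomorphic_on eball 0 (ereal r)"
    using f(2) by (intro holomorphic_on_subset[OF f(3)]) auto
  then have "fps_conv_radius (fps_expansion f 0) \<ge> ereal r" by (rule conv_radius_fps_expansion)
  then have conv: "fps_conv_radius (fps_expansion f 0) > R"
    using r by (meson less_ereal.simps(1) less_le_trans)
  have "(\<lambda>m. \<Sum>k<m. (2 * of_real pi * \<i> * fps_nth (fps_expansion f 0) k) *\<^sub>C (T ^^ k) x)
      \<longlonglongrightarrow> (2 * of_real pi * \<i>) *\<^sub>C opcalc (fps_expansion f 0) T x"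
    using bounded_linear.sums[OF bounded_linear_scaleC_right opcalc_sums[OF conv],
        of "2 * of_real pi * \<i>" x]
    by (simp add: scaleC_scaleC sums_def)
  then have "I \<longlonglongrightarrow> (2 * of_real pi * \<i>) *\<^sub>C opcalc (fps_expansion f 0) T x"
    by (simp add: I_eq[abs_def])
  from LIMSEQ_unique[OF lim this] have JJ: "J = (2 * of_real pi * \<i>) *\<^sub>C opcalc (fps_expansion f 0) T x" .
  have "(\<Sum>k. g k t) = vector_derivative \<gamma> (at t within {0..1}) *\<^sub>C f (\<gamma> t) *\<^sub>C
      opcalc (resolvent_series (\<gamma> t)) T x" for t
  proof -
    have "cmod (\<gamma> t) > R" using norm_\<gamma> r by simp
    from bounded_linear.sums[OF bounded_linear_scaleC_right opcalc_sums[OF resolvent_conv[OF this]], of "c t" x]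
    have "(\<lambda>k. g k t) sums (c t *\<^sub>C opcalc (resolvent_series (\<gamma> t)) T x)"
      by (simp add: g_def scaleC_scaleC resolvent_series_def)
    then show ?thesis by (simp add: sums_iff c_def scaleC_scaleC)
  qed
  then show ?thesis using J unfolding JJ by (simp add: \<gamma>_def)
qed

end

lemma
  assumes "\<rho> > 0" "cmod \<zeta> > \<rho>"
  shows bij_resolvent_diff_op:
      "bij_betw (\<lambda>g. \<zeta> *\<^sub>C g - diff_op g) (herzog_space \<rho>) (herzog_space \<rho>)" (is ?bij)
    and resolvent_diff_op: "w \<in> null_rows n \<Longrightarrow> resolvent (herzog_space \<rho>) diff_op \<zeta> (rows_fun \<rho> w i) =
      rows_fun \<rho> (opcalc (resolvent_series \<zeta>) (row_shift \<rho>) w) i"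
proof -
  interpret X: isometric_model "herzog_space \<rho>" "herzog_norm \<rho>" "\<lambda>w. rows_fun \<rho> w 1" "null_rows 1"
    by (rule herzog_model[OF assms(1)])
  interpret D: bounded_operator "row_shift \<rho>" \<rho>
    by (rule row_shift_operator[OF assms(1)])
  define \<Phi> where "\<Phi> = (\<lambda>g. \<zeta> *\<^sub>C g - diff_op g)"
  define Q where "Q = opcalc (resolvent_series \<zeta>) (row_shift \<rho>)"
  have Q: "Q w \<in> null_rows n" if "w \<in> null_rows n" for w n
    unfolding Q_def
    by (rule D.opcalc_closed_invariant[OF D.resolvent_conv[OF assms(2)] subspace_null_rows closed_null_rows
          row_shift_null_rows that])
  have diff: "rows_fun \<rho> (v - w) j = rows_fun \<rho> v j - rows_fun \<rho> w j" for v w j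
    using rows_fun_add[of \<rho> "v - w" w] by (auto simp: fun_eq_iff algebra_simps)
  have \<Phi>: "\<Phi> (rows_fun \<rho> w j) = rows_fun \<rho> (\<zeta> *\<^sub>C w - row_shift \<rho> w) j" for w j
    by (simp only: \<Phi>_def rows_fun_row_shift[symmetric] rows_fun_scaleC_row[symmetric] diff)
  have in1: "\<zeta> *\<^sub>C w - row_shift \<rho> w \<in> null_rows n" if "w \<in> null_rows n" for w n
    by (intro cvec.subspace_diff cvec.subspace_scale subspace_null_rows that row_shift_null_rows)
  have inj: "inj_on \<Phi> (herzog_space \<rho>)"
  proof (rule inj_onI)
    fix g h assume gh: "g \<in> herzog_space \<rho>" "h \<in> herzog_space \<rho>" "\<Phi> g = \<Phi> h"
    obtain x y where xy: "x \<in> null_rows 1" "g = rows_fun \<rho> x 1" "y \<in> null_rows 1" "h = rows_fun \<rho> y 1"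
      using gh(1,2) unfolding X.psi_image[symmetric] by blast
    have "\<zeta> *\<^sub>C x - row_shift \<rho> x = \<zeta> *\<^sub>C y - row_shift \<rho> y"
      using gh(3) unfolding xy(2,4) \<Phi> X.psi_inject[OF in1[OF xy(1)] in1[OF xy(3)]] .
    then have "Q (\<zeta> *\<^sub>C x - row_shift \<rho> x) = Q (\<zeta> *\<^sub>C y - row_shift \<rho> y)" by simp
    then show "g = h"
      unfolding Q_def D.resolvent_left[OF assms(2)] xy(2,4) by simp
  qed
  have QQ: "\<Phi> (rows_fun \<rho> (Q w) j) = rows_fun \<rho> w j" for w j
    unfolding \<Phi> Q_def D.resolvent_right[OF assms(2)] ..
  have "\<Phi> ` herzog_space \<rho> = herzog_space \<rho>"
  proof
    show "\<Phi> ` herzog_space \<rho> \<subseteq> herzog_space \<rho>"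
      unfolding X.psi_image[symmetric] using \<Phi> in1 by blast
    show "herzog_space \<rho> \<subseteq> \<Phi> ` herzog_space \<rho>"
    proof
      fix g assume "g \<in> herzog_space \<rho>"
      then obtain x where x: "x \<in> null_rows 1" "g = rows_fun \<rho> x 1"
        unfolding X.psi_image[symmetric] by blast
      have "g = \<Phi> (rows_fun \<rho> (Q x) 1)" by (simp only: QQ x(2))
      then show "g \<in> \<Phi> ` herzog_space \<rho>" using rows_fun_in_space[OF Q[OF x(1)]] by blast
    qed
  qed
  with inj show ?bij unfolding bij_betw_def \<Phi>_def by blast
  show "resolvent (herzog_space \<rho>) diff_op \<zeta> (rows_fun \<rho> w i) =
      rows_fun \<rho> (opcalc (resolvent_series \<zeta>) (row_shift \<rho>) w) i" if "w \<in> null_rows n"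
  proof -
    have "inv_into (herzog_space \<rho>) \<Phi> (\<Phi> (rows_fun \<rho> (Q w) i)) = rows_fun \<rho> (Q w) i"
      by (rule inv_into_f_f[OF inj rows_fun_in_space[OF Q[OF that]]])
    then show ?thesis unfolding QQ by (simp add: resolvent_def \<Phi>_def Q_def)
  qed
qed

lemma op_spectrum_diff_op_subset:
  assumes "\<rho> > 0"
  shows "op_spectrum (herzog_space \<rho>) (herzog_norm \<rho>) diff_op \<subseteq> cball 0 \<rho>"
proof
  interpret X: isometric_model "herzog_space \<rho>" "herzog_norm \<rho>" "\<lambda>w. rows_fun \<rho> w 1" "null_rows 1"
    by (rule herzog_model[OF assms(1)])
  interpret D: bounded_operator "row_shift \<rho>" \<rho>
    by (rule row_shift_operator[OF assms(1)])
  fix \<zeta> assume \<zeta>: "\<zeta> \<in> op_spectrum (herzog_space \<rho>) (herzog_norm \<rho>) diff_op"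
  show "\<zeta> \<in> cball 0 \<rho>"
  proof (rule ccontr)
    assume "\<zeta> \<notin> cball 0 \<rho>"
    then have big: "cmod \<zeta> > \<rho>" by simp
    note conv = D.resolvent_conv[OF big]
    have "bounded_op (herzog_space \<rho>) (herzog_norm \<rho>) (resolvent (herzog_space \<rho>) diff_op \<zeta>)"
    proof (rule X.bounded_op_psi[OF D.opcalc_operator[OF conv]])
      fix x assume "x \<in> null_rows 1"
      then show "opcalc (resolvent_series \<zeta>) (row_shift \<rho>) x \<in> null_rows 1"
        using D.opcalc_closed_invariant[OF conv subspace_null_rows closed_null_rows row_shift_null_rows]
        by blast
      show "resolvent (herzog_space \<rho>) diff_op \<zeta> (rows_fun \<rho> x 1) =
          rows_fun \<rho> (opcalc (resolvent_series \<zeta>) (row_shift \<rho>) x) 1"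
        by (rule resolvent_diff_op[OF assms big \<open>x \<in> null_rows 1\<close>])
    qed
    then show False
      using \<zeta> bij_resolvent_diff_op[OF assms big] unfolding op_spectrum_def by blast
  qed
qed

text \<open>
  In coefficients \<open>\<rho> g - g' = b\<close> reads \<open>\<rho> (a\<^sub>k - a\<^bsub>k+1\<^esub>) = b\<^sub>k\<close>. The left side telescopes to a
  convergent series, so \<open>b\<^sub>k = 1/(k+1)\<close> is not in the range.
\<close>

lemma rho_in_op_spectrum_diff_op:
  assumes "\<rho> > 0"
  shows "complex_of_real \<rho> \<in> op_spectrum (herzog_space \<rho>) (herzog_norm \<rho>) diff_op"
proof -
  interpret X: isometric_model "herzog_space \<rho>" "herzog_norm \<rho>" "\<lambda>w. rows_fun \<rho> w 1" "null_rows 1"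
    by (rule herzog_model[OF assms(1)])
  define b where "b = (\<lambda>k. complex_of_real (inverse (real (Suc k))))"
  have b: "b \<longlonglongrightarrow> 0"
    unfolding b_def using tendsto_of_real[OF LIMSEQ_inverse_real_of_nat, where 'a = complex] by simp
  have "herzog_fun \<rho> b \<notin> (\<lambda>g. of_real \<rho> *\<^sub>C g - diff_op g) ` herzog_space \<rho>"
  proof
    assume "herzog_fun \<rho> b \<in> (\<lambda>g. of_real \<rho> *\<^sub>C g - diff_op g) ` herzog_space \<rho>"
    then obtain g where g: "g \<in> herzog_space \<rho>" "herzog_fun \<rho> b = of_real \<rho> *\<^sub>C g - diff_op g" by blast
    then obtain a where "herzog_expansion \<rho> g a" unfolding herzog_space_def by blast
    then have a: "a \<longlonglongrightarrow> 0" "g = herzog_fun \<rho> a"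
      by (simp_all add: herzog_expansion_def herzog_expansion_imp_fun)
    note Ba = null_imp_Bseq[OF a(1)]
    have a': "(\<lambda>k. of_real \<rho> * a (Suc k)) \<longlonglongrightarrow> 0" "(\<lambda>k. of_real \<rho> * a k) \<longlonglongrightarrow> 0"
      using a(1) LIMSEQ_Suc[OF a(1)] by (auto intro: tendsto_mult_right_zero)
    have e: "herzog_expansion \<rho> (of_real \<rho> *\<^sub>C g - diff_op g) (\<lambda>k. of_real \<rho> * a k - of_real \<rho> * a (Suc k))"
      unfolding a(2) diff_op_herzog_fun[OF Ba] herzog_fun_scaleC[OF Ba, symmetric]
      by (intro herzog_expansion_diff herzog_expansion_fun a')
    then have "b = (\<lambda>k. of_real \<rho> * a k - of_real \<rho> * a (Suc k))"
      using herzog_coeff_eq[OF assms e] herzog_coeff_eq[OF assms herzog_expansion_fun[OF b]]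
      unfolding g(2) by simp
    then have "summable b" using telescope_summable'[OF a'(2)] by simp
    then have "summable (\<lambda>k. inverse (real (Suc k)))"
      unfolding b_def summable_complex_of_real .
    then show False
      using not_summable_harmonic[where 'a = real] by (subst (asm) summable_Suc_iff) blast
  qed
  then have "\<not> bij_betw (\<lambda>g. of_real \<rho> *\<^sub>C g - diff_op g) (herzog_space \<rho>) (herzog_space \<rho>)"
    using herzog_fun_in_space[OF b] using bij_betw_imp_surj_on by blast
  then show ?thesis unfolding op_spectrum_def by blast
qed

text \<open>
  The calculus integrates over some circle around the spectrum. That it has radius larger than \<open>\<rho>\<close>, and
  not just one that avoids the spectrum, follows because \<open>\<rho>\<close> itself is a spectral value.
\<close>

lemma riesz_dunford_radius:
  assumes "\<rho> > 0" and f: "\<exists>U. open U \<and> cball 0 \<rho> \<subseteq> U \<and> f holomorphic_on U"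
  defines "r \<equiv> riesz_dunford_radius (herzog_space \<rho>) (herzog_norm \<rho>) f diff_op"
  shows "\<rho> < r" "\<exists>U. open U \<and> cball 0 r \<subseteq> U \<and> f holomorphic_on U"
proof -
  let ?P = "\<lambda>r. 0 < r \<and> op_spectrum (herzog_space \<rho>) (herzog_norm \<rho>) diff_op \<subseteq> ball 0 r \<and>
      (\<exists>U. open U \<and> cball 0 r \<subseteq> U \<and> f holomorphic_on U)"
  obtain U where U: "open U" "cball 0 \<rho> \<subseteq> U" "f holomorphic_on U" using f by blast
  then obtain s where s: "\<rho> < s" "ball 0 s \<subseteq> U"
    using cball_subset_open_imp_larger_ball[OF U(1,2)] assms(1) by auto
  have "?P ((\<rho> + s) / 2)"
  proof (intro conjI exI)
    show "op_spectrum (herzog_space \<rho>) (herzog_norm \<rho>) diff_op \<subseteq> ball 0 ((\<rho> + s) / 2)"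
      using op_spectrum_diff_op_subset[OF assms(1)] s(1) by force
    show "cball 0 ((\<rho> + s) / 2) \<subseteq> U" using s by (intro order_trans[OF _ s(2)]) auto
  qed (use U s assms(1) in auto)
  then have "?P r"
    unfolding r_def riesz_dunford_radius_def by (rule someI)
  then show "\<exists>U. open U \<and> cball 0 r \<subseteq> U \<and> f holomorphic_on U" by blast
  have "complex_of_real \<rho> \<in> ball 0 r"
    using \<open>?P r\<close> rho_in_op_spectrum_diff_op[OF assms(1)] by blast
  then show "\<rho> < r" using assms(1) by simp
qed

text \<open>
  The contour integral in the Herzog space is the image of the integral of arrays: the isometry turns
  Riemann sums into Riemann sums.
\<close>

theorem riesz_dunford_diff_op:
  assumes "\<rho> > 0" and f: "\<exists>U. open U \<and> cball 0 \<rho> \<subseteq> U \<and> f holomorphic_on U"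
    and w: "w \<in> null_rows n"
  shows "riesz_dunford (herzog_space \<rho>) (herzog_norm \<rho>) f diff_op (rows_fun \<rho> w i) =
    rows_fun \<rho> (opcalc (fps_expansion f 0) (row_shift \<rho>) w) i"
proof -
  interpret X: isometric_model "herzog_space \<rho>" "herzog_norm \<rho>" "\<lambda>w. rows_fun \<rho> w 1" "null_rows 1"
    by (rule herzog_model[OF assms(1)])
  interpret D: bounded_operator "row_shift \<rho>" \<rho>
    by (rule row_shift_operator[OF assms(1)])
  define r where "r = riesz_dunford_radius (herzog_space \<rho>) (herzog_norm \<rho>) f diff_op"
  have r: "\<rho> < r" and ex: "\<exists>U. open U \<and> cball 0 r \<subseteq> U \<and> f holomorphic_on U"
    unfolding r_def by (rule riesz_dunford_radius[OF assms(1,2)])+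
  from ex obtain U where U: "open U" "cball 0 r \<subseteq> U" "f holomorphic_on U" by blast
  define \<gamma> where "\<gamma> = circlepath 0 r"
  have big: "cmod (\<gamma> t) > \<rho>" for t
    using r assms(1) by (simp add: \<gamma>_def circlepath norm_mult)
  define v where "v = (\<lambda>t. vector_derivative \<gamma> (at t within {0..1}) *\<^sub>C f (\<gamma> t) *\<^sub>C
      opcalc (resolvent_series (\<gamma> t)) (row_shift \<rho>) w)"
  define J where "J = (2 * of_real pi * \<i>) *\<^sub>C opcalc (fps_expansion f 0) (row_shift \<rho>) w"
  have int: "(v has_integral J) {0..1}"
    unfolding v_def J_def \<gamma>_def by (rule D.cauchy_integral_opcalc[OF r U])
  have v_in: "v t \<in> null_rows n" for t
    unfolding v_def
    by (intro cvec.subspace_scale subspace_null_rows D.opcalc_closed_invariant[OF D.resolvent_conv[OF big]]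
        closed_null_rows row_shift_null_rows w)
  have fr: "f holomorphic_on eball 0 (ereal r)"
    using U(2) by (intro holomorphic_on_subset[OF U(3)]) auto
  have conv: "fps_conv_radius (fps_expansion f 0) > \<rho>"
    using conv_radius_fps_expansion[OF fr] r by (meson less_ereal.simps(1) less_le_trans)
  have J_in: "J \<in> null_rows n"
    unfolding J_def
    by (intro cvec.subspace_scale subspace_null_rows D.opcalc_closed_invariant[OF conv]
        closed_null_rows row_shift_null_rows w)
  have integrand: "vector_derivative \<gamma> (at t within {0..1}) *\<^sub>C f (\<gamma> t) *\<^sub>C
      resolvent (herzog_space \<rho>) diff_op (\<gamma> t) (rows_fun \<rho> w i) = rows_fun \<rho> (v t) i" for t
    by (simp only: v_def rows_fun_scaleC_row resolvent_diff_op[OF assms(1) big w])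
  have diff: "rows_fun \<rho> (x - y) j = rows_fun \<rho> x j - rows_fun \<rho> y j" for x y j
    using rows_fun_add[of \<rho> "x - y" y] by (auto simp: fun_eq_iff algebra_simps)
  have rows_zero: "rows_fun \<rho> 0 i = 0"
    using rows_fun_scaleC_row[of \<rho> 0 0 i] by simp
  have sum_rows: "rows_fun \<rho> (\<Sum>p\<in>P. c p *\<^sub>C x p) i = (\<Sum>p\<in>P. c p *\<^sub>C rows_fun \<rho> (x p) i)"
    if "finite P" for P :: "(real \<times> real set) set" and c x
    using that
    by (induction P rule: finite_induct) (simp_all add: rows_zero rows_fun_add rows_fun_scaleC_row)
  \<comment> \<open>Riemann sums of the arrays converge, and taking row i does not increase the norm.\<close>
  have nint: "has_nintegral (herzog_space \<rho>) (herzog_norm \<rho>) (\<lambda>t. rows_fun \<rho> (v t) i) (rows_fun \<rho> J i)"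
    unfolding has_nintegral_def
  proof (rule X.limitin_contraction)
    let ?s = "\<lambda>p. \<Sum>(t, k)\<in>p. measure lborel k *\<^sub>R v t"
    have "(?s \<longlongrightarrow> J) (division_filter {0..1})"
      using int has_integral_cbox[of v J 0 1] by simp
    then show "((\<lambda>p. dist (?s p) J) \<longlongrightarrow> 0) (division_filter {0..1})"
      by (rule tendsto_dist_iff[THEN iffD1])
    show "\<forall>\<^sub>F p in division_filter {0..1}.
        (\<Sum>(t, k)\<in>p. complex_of_real (measure lborel k) *\<^sub>C rows_fun \<rho> (v t) i) \<in> herzog_space \<rho> \<and>
        herzog_norm \<rho> ((\<Sum>(t, k)\<in>p. complex_of_real (measure lborel k) *\<^sub>C rows_fun \<rho> (v t) i) -
          rows_fun \<rho> J i) \<le> dist (?s p) J"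
      using eventually_division_filter_tagged_division
    proof eventually_elim
      fix p :: "(real \<times> real set) set" assume "p tagged_division_of {0..1}"
      then have fin: "finite p" by (rule tagged_division_of_finite)
      have s: "?s p = (\<Sum>q\<in>p. complex_of_real (measure lborel (snd q)) *\<^sub>C v (fst q))"
        by (simp add: scaleR_scaleC case_prod_beta)
      have s_in: "?s p \<in> null_rows n"
        unfolding s by (intro cvec.subspace_sum cvec.subspace_scale subspace_null_rows v_in)
      have eq: "(\<Sum>(t, k)\<in>p. complex_of_real (measure lborel k) *\<^sub>C rows_fun \<rho> (v t) i) = rows_fun \<rho> (?s p) i"
        unfolding s sum_rows[OF fin] by (simp add: case_prod_beta)
      have "herzog_norm \<rho> (rows_fun \<rho> (?s p - J) i) \<le> norm (?s p - J)"
        by (rule herzog_norm_rows_fun_le[OF assms(1) cvec.subspace_diff[OF subspace_null_rows s_in J_in]])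
      then show "(\<Sum>(t, k)\<in>p. complex_of_real (measure lborel k) *\<^sub>C rows_fun \<rho> (v t) i) \<in> herzog_space \<rho> \<and>
        herzog_norm \<rho> ((\<Sum>(t, k)\<in>p. complex_of_real (measure lborel k) *\<^sub>C rows_fun \<rho> (v t) i) -
          rows_fun \<rho> J i) \<le> dist (?s p) J"
        unfolding eq diff dist_norm using rows_fun_in_space[OF s_in] by blast
    qed
  qed (rule rows_fun_in_space[OF J_in])
  have "contour_nintegral (herzog_space \<rho>) (herzog_norm \<rho>) \<gamma>
      (\<lambda>\<zeta>. f \<zeta> *\<^sub>C resolvent (herzog_space \<rho>) diff_op \<zeta> (rows_fun \<rho> w i)) = rows_fun \<rho> J i"
    unfolding contour_nintegral_def integrand
  proof (rule the_equality[of "has_nintegral _ _ _", OF nint])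
    have nb: "division_filter {0..1::real} \<noteq> bot"
      using division_filter_not_empty[of 0 "1::real"] by simp
    fix I assume "has_nintegral (herzog_space \<rho>) (herzog_norm \<rho>) (\<lambda>t. rows_fun \<rho> (v t) i) I"
    then show "I = rows_fun \<rho> J i"
      using nint unfolding has_nintegral_def by (rule X.limitin_unique[OF nb])
  qed
  then show ?thesis
    unfolding riesz_dunford_def r_def[symmetric] \<gamma>_def[symmetric]
    by (simp add: J_def rows_fun_scaleC_row scaleC_scaleC scaleC_one)
qed

section \<open>The semigroup generated by a bounded operator\<close>

text \<open>
  An operator \<open>A\<close> on \<open>V\<close> that is the image of a bounded operator \<open>T\<close> leaving \<open>E\<close> invariant. Its
  exponential semigroup is the image of \<open>flow t = exp(t T)\<close>.
\<close>

locale operator_model = isometric_model V N \<psi> E + bounded_operator T R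
  for V :: "'v::complex_vector set" and N :: "'v \<Rightarrow> real"
    and \<psi> :: "'w::{complex_normed,banach} \<Rightarrow> 'v" and E :: "'w set" and T :: "'w \<Rightarrow> 'w" and R :: real +
  fixes A :: "'v \<Rightarrow> 'v"
  assumes closed_E: "closed E"
    and T_in_E: "x \<in> E \<Longrightarrow> T x \<in> E"
    and A_psi: "x \<in> E \<Longrightarrow> A (\<psi> x) = \<psi> (T x)"
begin

definition flow :: "real \<Rightarrow> 'w \<Rightarrow> 'w"
  where "flow t = opcalc (fps_exp (of_real t)) T"

lemma exp_conv: "fps_conv_radius (fps_exp (c :: complex)) > ereal R"
  by simp

lemma flow_operator: "bounded_operator (flow t) (\<Sum>m. cmod (fps_nth (fps_exp (of_real t)) m) * R ^ m)"
  unfolding flow_def by (rule opcalc_operator[OF exp_conv])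

lemma flow_closed_invariant:
  "cvec.subspace Y \<Longrightarrow> closed Y \<Longrightarrow> (\<And>x. x \<in> Y \<Longrightarrow> T x \<in> Y) \<Longrightarrow> x \<in> Y \<Longrightarrow> flow t x \<in> Y"
  unfolding flow_def by (rule opcalc_closed_invariant[OF exp_conv])

lemma flow_in_E: "x \<in> E \<Longrightarrow> flow t x \<in> E"
  by (rule flow_closed_invariant[OF subspace_E closed_E T_in_E])

lemma flow_0: "flow 0 x = x"
  by (simp add: flow_def)

lemma flow_add: "flow (s + t) x = flow s (flow t x)"
  unfolding flow_def opcalc_mult[OF exp_conv exp_conv, symmetric]
  by (simp add: fps_exp_add_mult)

lemma flow_pow: "(flow t ^^ k) x = flow (real k * t) x"
proof (induction k)
  case (Suc k)
  have "(flow t ^^ Suc k) x = flow (t + real k * t) x" by (simp add: Suc flow_add)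
  then show ?case by (simp add: algebra_simps)
qed (simp add: flow_0)

lemma flow_eigenvector:
  assumes "T v = \<mu> *\<^sub>C v"
  shows "flow t v = exp (of_real t * \<mu>) *\<^sub>C v"
  using opcalc_eigenvector[OF exp_conv assms, of "of_real t"] by (simp add: flow_def)

lemma A_pow_psi: "x \<in> E \<Longrightarrow> (A ^^ k) (\<psi> x) = \<psi> ((T ^^ k) x)"
  and T_pow_in_E: "x \<in> E \<Longrightarrow> (T ^^ k) x \<in> E"
  by (induction k) (simp_all add: A_psi T_in_E)

lemma exp_semigroup_psi:
  assumes x: "x \<in> E"
  shows "exp_semigroup V N A t (\<psi> x) = \<psi> (flow t x)"
proof -
  let ?h = "\<lambda>m. \<Sum>k<m. complex_of_real (t ^ k / fact k) *\<^sub>C (A ^^ k) (\<psi> x)"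
  let ?g = "\<lambda>m. \<Sum>k<m. complex_of_real (t ^ k / fact k) *\<^sub>C (T ^^ k) x"
  have "?g m \<in> E" for m
    by (intro cvec.subspace_sum cvec.subspace_scale subspace_E T_pow_in_E x)
  moreover have "?h m = \<psi> (?g m)" for m
  proof -
    have "\<psi> (?g m) = (\<Sum>k<m. \<psi> (complex_of_real (t ^ k / fact k) *\<^sub>C (T ^^ k) x))"
      by (intro psi_sum finite_lessThan cvec.subspace_scale subspace_E T_pow_in_E x)
    then show ?thesis by (simp only: psi_scaleC T_pow_in_E x A_pow_psi)
  qed
  moreover have "?g \<longlonglongrightarrow> flow t x"
    using opcalc_sums[OF exp_conv, of "of_real t" x] by (simp add: sums_def flow_def)
  ultimately have "limitin (ntop V N) ?h (\<psi> (flow t x)) sequentially"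
    by (intro limitin_psi[OF flow_in_E[OF x], of ?g] always_eventually) auto
  then show ?thesis
    unfolding exp_semigroup_def by (rule the_equality) (rule limitin_unique[OF sequentially_bot _ \<open>limitin _ _ _ _\<close>])
qed

text \<open>
  Continuity and the derivative at \<open>0\<close> are the cases \<open>M = 1\<close> and \<open>M = 2\<close>.
\<close>

lemma flow_expansion:
  "\<exists>K d. d > 0 \<and> (\<forall>h. \<bar>h\<bar> < d \<longrightarrow>
    norm (flow h x - (\<Sum>j<M. (of_real h ^ j / fact j) *\<^sub>C (T ^^ j) x)) \<le> K * \<bar>h\<bar> ^ M)"
proof -
  define u where "u = (\<lambda>m. (1 / fact m) *\<^sub>C (T ^^ m) x)"
  define F where "F = (\<lambda>z. opcalc (fps_exp z) T x)"
  have sums: "(\<lambda>m. (z - 0) ^ m *\<^sub>C u m) sums F z" if "z \<in> ball 0 1" for z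
    using opcalc_sums[OF exp_conv, of z x] by (simp add: u_def F_def scaleC_scaleC)
  show ?thesis
  proof (rule power_series_remainder_bound[of 1 0 u F M])
    fix K d
    assume d: "0 < d" and
      K: "\<And>z. z \<in> ball 0 d \<Longrightarrow> norm (F z - (\<Sum>j<M. (z - 0) ^ j *\<^sub>C u j)) \<le> K * cmod (z - 0) ^ M"
    have "norm (flow h x - (\<Sum>j<M. (of_real h ^ j / fact j) *\<^sub>C (T ^^ j) x)) \<le> K * \<bar>h\<bar> ^ M"
      if "\<bar>h\<bar> < d" for h
      using K[of "of_real h"] that by (simp add: flow_def F_def u_def scaleC_scaleC)
    then show ?thesis using d by blast
  qed (use sums in simp_all)
qed

lemma flow_continuous_at_0: "((\<lambda>t. flow t x) \<longlongrightarrow> x) (at_right 0)"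
proof -
  have "\<exists>K d. d > 0 \<and> (\<forall>h. \<bar>h\<bar> < d \<longrightarrow> norm (flow h x - x) \<le> K * \<bar>h\<bar>)"
    using flow_expansion[of x 1] by (simp add: scaleC_one)
  then obtain K d where d: "d > 0" "\<forall>h. \<bar>h\<bar> < d \<longrightarrow> norm (flow h x - x) \<le> K * \<bar>h\<bar>"
    by blast
  have "((\<lambda>h. flow h x - x) \<longlongrightarrow> 0) (at_right 0)"
  proof (rule Lim_null_comparison)
    have "norm (flow h x - x) \<le> K * \<bar>h\<bar>" if "0 < h" "h < d" for h
      using d(2)[rule_format, of h] that by simp
    then show "\<forall>\<^sub>F h in at_right 0. norm (flow h x - x) \<le> K * \<bar>h\<bar>"
      unfolding eventually_at_right_field using d(1) by blast
    have "((\<lambda>h. K * \<bar>h\<bar>) \<longlongrightarrow> K * \<bar>0\<bar>) (at_right 0)" by (intro tendsto_intros)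
    then show "((\<lambda>h. K * \<bar>h\<bar>) \<longlongrightarrow> 0) (at_right 0)" by simp
  qed
  then show ?thesis by (simp add: LIM_zero_iff)
qed

lemma flow_derivative_at_0: "((\<lambda>h. complex_of_real (1 / h) *\<^sub>C (flow h x - x)) \<longlongrightarrow> T x) (at_right 0)"
proof -
  obtain K d where d: "d > 0"
    "\<forall>h. \<bar>h\<bar> < d \<longrightarrow>
      norm (flow h x - (\<Sum>j<2. (of_real h ^ j / fact j) *\<^sub>C (T ^^ j) x)) \<le> K * \<bar>h\<bar> ^ 2"
    using flow_expansion[of x 2] by blast
  have "((\<lambda>h. complex_of_real (1 / h) *\<^sub>C (flow h x - x) - T x) \<longlongrightarrow> 0) (at_right 0)"
  proof (rule Lim_null_comparison)
    have "norm (complex_of_real (1 / h) *\<^sub>C (flow h x - x) - T x) \<le> K * h" if h: "0 < h" "h < d" for h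
    proof -
      have "(\<Sum>j<2. (of_real h ^ j / fact j) *\<^sub>C (T ^^ j) x) = x + of_real h *\<^sub>C T x"
        by (simp add: numeral_2_eq_2 scaleC_one)
      then have "norm (flow h x - x - of_real h *\<^sub>C T x) \<le> K * h ^ 2"
        using d(2)[rule_format, of h] h by (simp add: diff_diff_eq)
      moreover have "complex_of_real (1 / h) *\<^sub>C (flow h x - x) - T x =
          complex_of_real (1 / h) *\<^sub>C (flow h x - x - of_real h *\<^sub>C T x)"
        using h by (simp add: cvec.scale_right_diff_distrib scaleC_scaleC scaleC_one)
      ultimately show ?thesis
        using h by (simp add: norm_scaleC norm_divide pos_divide_le_eq power2_eq_square mult.assoc)
    qed
    then show "\<forall>\<^sub>F h in at_right 0. norm (complex_of_real (1 / h) *\<^sub>C (flow h x - x) - T x) \<le> K * h"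
      unfolding eventually_at_right_field using d(1) by (intro exI[of _ d]) auto
    have "((\<lambda>h. K * h) \<longlongrightarrow> K * 0) (at_right 0)" by (intro tendsto_intros)
    then show "((\<lambda>h. K * h) \<longlongrightarrow> 0) (at_right 0)" by simp
  qed
  then show ?thesis by (simp add: LIM_zero_iff)
qed

abbreviation S :: "real \<Rightarrow> 'v \<Rightarrow> 'v"
  where "S \<equiv> exp_semigroup V N A"

theorem generates_exp_semigroup: "generates V N A S"
proof -
  have "limitin (ntop V N) (\<lambda>t. S t v) v (at_right 0)" if v: "v \<in> V" for v
  proof -
    obtain x where x: "x \<in> E" "v = \<psi> x" using v unfolding psi_image[symmetric] by blast
    show ?thesis
      unfolding x(2) by (rule limitin_psi[OF x(1) _ flow_continuous_at_0])
        (simp add: exp_semigroup_psi flow_in_E x(1))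
  qed
  moreover have "limitin (ntop V N) (\<lambda>h. complex_of_real (1 / h) *\<^sub>C (S h v - v)) (A v) (at_right 0)"
    if v: "v \<in> V" for v
  proof -
    obtain x where x: "x \<in> E" "v = \<psi> x" using v unfolding psi_image[symmetric] by blast
    have *: "flow h x - x \<in> E" for h
      by (intro cvec.subspace_diff subspace_E flow_in_E x)
    show ?thesis
      unfolding x(2) A_psi[OF x(1)]
      by (rule limitin_psi[OF T_in_E[OF x(1)] _ flow_derivative_at_0])
        (use * in \<open>simp add: exp_semigroup_psi x(1) psi_scaleC psi_diff flow_in_E cvec.subspace_scale[OF subspace_E]\<close>)
  qed
  moreover have "bounded_op V N (S t)" for t
    by (rule bounded_op_psi[OF flow_operator flow_in_E exp_semigroup_psi])
  moreover have "S 0 v = v" if v: "v \<in> V" for v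
  proof -
    obtain x where x: "x \<in> E" "v = \<psi> x" using v unfolding psi_image[symmetric] by blast
    then show ?thesis by (simp add: exp_semigroup_psi flow_0)
  qed
  moreover have "S (s + t) v = S s (S t v)" if v: "v \<in> V" for s t v
  proof -
    obtain x where x: "x \<in> E" "v = \<psi> x" using v unfolding psi_image[symmetric] by blast
    then show ?thesis by (simp add: exp_semigroup_psi flow_in_E flow_add)
  qed
  ultimately show ?thesis unfolding generates_def C0_semigroup_def by blast
qed

lemma S_pow_psi: "x \<in> E \<Longrightarrow> (S t ^^ k) (\<psi> x) = \<psi> ((flow t ^^ k) x)"
  and flow_pow_in_E: "x \<in> E \<Longrightarrow> (flow t ^^ k) x \<in> E"
  by (induction k) (simp_all add: exp_semigroup_psi flow_in_E)

text \<open>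
  Chaos of the time-\<open>t\<close> map on \<open>Y\<close>, in the norm topology of the model. For \<open>t = 1\<close> it implies chaos of
  the semigroup, whose orbits and periodic points contain those of the time-one map.
\<close>

definition chaotic_flow_on :: "real \<Rightarrow> 'w set \<Rightarrow> bool"
  where "chaotic_flow_on t Y \<longleftrightarrow>
    (\<exists>x\<in>Y. Y \<subseteq> closure (range (\<lambda>k. (flow t ^^ k) x))) \<and> Y \<subseteq> closure {x \<in> Y. \<exists>k>0. (flow t ^^ k) x = x}"

context
  fixes Y :: "'w set"
  assumes Y: "cvec.subspace Y" "closed Y" "Y \<subseteq> E" and TY: "\<And>x. x \<in> Y \<Longrightarrow> T x \<in> Y"
begin

interpretation sub: isometric_model "\<psi> ` Y" N \<psi> Y
  by (rule submodel[OF Y(1,3)])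

lemma flow_in_Y: "x \<in> Y \<Longrightarrow> flow t x \<in> Y"
  by (rule flow_closed_invariant[OF Y(1,2) TY])

lemma flow_pow_in_Y: "x \<in> Y \<Longrightarrow> (flow t ^^ k) x \<in> Y"
  by (induction k) (simp_all add: flow_in_Y)

lemma S_psi_Y: "S t ` \<psi> ` Y \<subseteq> \<psi> ` Y"
  using exp_semigroup_psi flow_in_Y Y(3) by fastforce

lemma dense_in_Y_imp:
  assumes "P \<subseteq> Y" "Y \<subseteq> closure P"
  shows "ntop (\<psi> ` Y) N closure_of (\<psi> ` P) = \<psi> ` Y"
  using sub.closure_of_psi[OF assms(1)] assms(2) by (simp add: Int_absorb1)

lemma chaotic_op_psi:
  assumes "chaotic_flow_on t Y"
  shows "chaotic_op (\<psi> ` Y) N (S t)"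
  unfolding chaotic_op_def
proof
  obtain x where x: "x \<in> Y" "Y \<subseteq> closure (range (\<lambda>k. (flow t ^^ k) x))"
    using assms unfolding chaotic_flow_on_def by blast
  have "{(S t ^^ k) (\<psi> x) |k. True} = \<psi> ` range (\<lambda>k. (flow t ^^ k) x)"
  proof -
    have "(S t ^^ k) (\<psi> x) = \<psi> ((flow t ^^ k) x)" for k
      using x(1) Y(3) by (intro S_pow_psi) blast
    then show ?thesis by auto
  qed
  then have "ntop (\<psi> ` Y) N closure_of {(S t ^^ k) (\<psi> x) |k. True} = \<psi> ` Y"
    using dense_in_Y_imp[OF _ x(2)] flow_pow_in_Y[OF x(1)] by auto
  then show "\<exists>v\<in>\<psi> ` Y. ntop (\<psi> ` Y) N closure_of {(S t ^^ k) v |k. True} = \<psi> ` Y"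
    using x(1) by blast
  have "{v \<in> \<psi> ` Y. \<exists>k>0. (S t ^^ k) v = v} = \<psi> ` {x \<in> Y. \<exists>k>0. (flow t ^^ k) x = x}"
  proof -
    have "(S t ^^ k) (\<psi> x) = \<psi> x \<longleftrightarrow> (flow t ^^ k) x = x" if "x \<in> Y" for k x
      using that Y(3) by (simp add: S_pow_psi subsetD sub.psi_inject flow_pow_in_Y)
    then show ?thesis by auto
  qed
  then show "ntop (\<psi> ` Y) N closure_of {v \<in> \<psi> ` Y. \<exists>k>0. (S t ^^ k) v = v} = \<psi> ` Y"
    using dense_in_Y_imp[of "{x \<in> Y. \<exists>k>0. (flow t ^^ k) x = x}"] assms
    unfolding chaotic_flow_on_def by auto
qed

lemma chaotic_sg_psi:
  assumes "chaotic_flow_on 1 Y"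
  shows "chaotic_sg (\<psi> ` Y) N S"
  unfolding chaotic_sg_def
proof
  obtain x where x: "x \<in> Y" "Y \<subseteq> closure (range (\<lambda>k. (flow 1 ^^ k) x))"
    using assms unfolding chaotic_flow_on_def by blast
  have orbit: "{S t (\<psi> x) |t. t \<ge> 0} = \<psi> ` {flow t x |t. t \<ge> 0}"
  proof -
    have "S t (\<psi> x) = \<psi> (flow t x)" for t
      using x(1) Y(3) by (intro exp_semigroup_psi) blast
    then show ?thesis by auto
  qed
  have "range (\<lambda>k. (flow 1 ^^ k) x) \<subseteq> {flow t x |t. t \<ge> 0}"
    by (auto simp: flow_pow)
  then have "Y \<subseteq> closure {flow t x |t. t \<ge> 0}"
    using x(2) closure_mono by blast
  then have "ntop (\<psi> ` Y) N closure_of {S t (\<psi> x) |t. t \<ge> 0} = \<psi> ` Y"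
    unfolding orbit using flow_in_Y[OF x(1)] by (intro dense_in_Y_imp) auto
  then show "\<exists>v\<in>\<psi> ` Y. ntop (\<psi> ` Y) N closure_of {S t v |t. t \<ge> 0} = \<psi> ` Y"
    using x(1) by blast
  have periodic: "{v \<in> \<psi> ` Y. \<exists>t>0. S t v = v} = \<psi> ` {x \<in> Y. \<exists>t>0. flow t x = x}"
  proof -
    have "S t (\<psi> x) = \<psi> x \<longleftrightarrow> flow t x = x" if "x \<in> Y" for t x
      using that Y(3) by (simp add: exp_semigroup_psi subsetD sub.psi_inject flow_in_Y)
    then show ?thesis by auto
  qed
  have "{x \<in> Y. \<exists>k>0. (flow 1 ^^ k) x = x} \<subseteq> {x \<in> Y. \<exists>t>0. flow t x = x}"
    by (auto simp: flow_pow intro: exI[of _ "real _"])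
  then have "Y \<subseteq> closure {x \<in> Y. \<exists>t>0. flow t x = x}"
    using assms closure_mono unfolding chaotic_flow_on_def by blast
  then show "ntop (\<psi> ` Y) N closure_of {v \<in> \<psi> ` Y. \<exists>t>0. S t v = v} = \<psi> ` Y"
    unfolding periodic by (intro dense_in_Y_imp) auto
qed

lemma subchaotic_psi:
  assumes "Y \<noteq> {0}"
  shows "chaotic_flow_on t Y \<Longrightarrow> subchaotic_op V N (S t)"
    and "chaotic_flow_on 1 Y \<Longrightarrow> subchaotic_sg_wrt V N S (\<psi> ` Y)"
proof -
  have "\<psi> ` Y \<noteq> {0}"
  proof
    assume *: "\<psi> ` Y = {0}"
    have "y = 0" if "y \<in> Y" for y
      using * that sub.psi_inject[OF that sub.zero_E] psi_zero by auto
    then show False using assms sub.zero_E by blast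
  qed
  moreover have "closed_subspace V N (\<psi> ` Y)" by (rule closed_subspace_psi_image[OF Y(1,3,2)])
  ultimately show "chaotic_flow_on t Y \<Longrightarrow> subchaotic_op V N (S t)"
    and "chaotic_flow_on 1 Y \<Longrightarrow> subchaotic_sg_wrt V N S (\<psi> ` Y)"
    unfolding subchaotic_op_def subchaotic_sg_wrt_def
    using S_psi_Y chaotic_op_psi chaotic_sg_psi by blast+
qed

end

text \<open>
  A dense subset of a space other than \<open>{0}\<close> has a nonzero element; applied to the periodic
  points.
\<close>

lemma closed_subspace_nonzero_element:
  assumes Z: "closed_subspace V N Z" "Z \<noteq> {0}" and P: "P \<subseteq> Z" "ntop Z N closure_of P = Z"
  obtains x where "x \<in> E" "x \<noteq> 0" "\<psi> x \<in> P"
proof -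
  have sub: "cvec.subspace Z" "Z \<subseteq> V"
    using Z(1) closedin_subset[of "ntop V N" Z] by (auto simp: closed_subspace_def topspace_ntop)
  interpret Z: isometric_model Z N \<psi> "{x \<in> E. \<psi> x \<in> Z}" by (rule model_of_subspace[OF sub])
  obtain v where v: "v \<in> P" "v \<noteq> 0" using Z.dense_imp_nonzero_element[OF P(2,1) Z(2)] by blast
  then have "v \<in> V" using P(1) sub(2) by blast
  then obtain x where "x \<in> E" "v = \<psi> x" unfolding psi_image[symmetric] by blast
  then show ?thesis using v psi_zero by (intro that[of x]) auto
qed

lemma subchaotic_op_imp_periodic:
  assumes "subchaotic_op V N (S t)" "t > 0"
  obtains s x where "s > 0" "x \<in> E" "x \<noteq> 0" "flow s x = x"
proof -
  obtain Z where Z: "closed_subspace V N Z" "Z \<noteq> {0}"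
    "ntop Z N closure_of {v \<in> Z. \<exists>k>0. (S t ^^ k) v = v} = Z"
    using assms(1) unfolding subchaotic_op_def chaotic_op_def by blast
  obtain x where x: "x \<in> E" "x \<noteq> 0" "\<psi> x \<in> {v \<in> Z. \<exists>k>0. (S t ^^ k) v = v}"
    by (rule closed_subspace_nonzero_element[OF Z(1,2) _ Z(3)]) auto
  then obtain k where "k > 0" "(S t ^^ k) (\<psi> x) = \<psi> x" by blast
  then have "flow (real k * t) x = x" "real k * t > 0"
    using x(1) assms(2) psi_inject[OF flow_pow_in_E x(1)] by (auto simp: S_pow_psi flow_pow[symmetric])
  then show ?thesis using x by (intro that)
qed

lemma subchaotic_sg_imp_periodic:
  assumes "subchaotic_sg V N S"
  obtains s x where "s > 0" "x \<in> E" "x \<noteq> 0" "flow s x = x"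
proof -
  obtain Z where Z: "closed_subspace V N Z" "Z \<noteq> {0}"
    "ntop Z N closure_of {v \<in> Z. \<exists>s>0. S s v = v} = Z"
    using assms unfolding subchaotic_sg_def subchaotic_sg_wrt_def chaotic_sg_def by blast
  obtain x where x: "x \<in> E" "x \<noteq> 0" "\<psi> x \<in> {v \<in> Z. \<exists>s>0. S s v = v}"
    by (rule closed_subspace_nonzero_element[OF Z(1,2) _ Z(3)]) auto
  then obtain s where "s > 0" "S s (\<psi> x) = \<psi> x" by blast
  then show ?thesis
    using x psi_inject[OF flow_in_E x(1)] by (intro that[of s x]) (auto simp: exp_semigroup_psi)
qed

text \<open>
  A periodic vector lies in the kernel of the power series \<open>exp(s z) - 1\<close> of \<open>T\<close>, whose zeros are
  purely imaginary.
\<close>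

lemma periodic_imp_imaginary_eigenvalue:
  assumes "s > 0" "x \<in> E" "x \<noteq> 0" "flow s x = x"
  obtains \<mu> y where "Re \<mu> = 0" "y \<in> E" "y \<noteq> 0" "T y = \<mu> *\<^sub>C y"
proof -
  define F where "F = fps_exp (complex_of_real s) - 1"
  have inf: "fps_conv_radius F = \<infinity>"
    using fps_conv_radius_diff[of "fps_exp (complex_of_real s)" 1] by (simp add: F_def)
  then have conv: "fps_conv_radius F > R" by simp
  have "fps_nth F 1 = of_real s" by (simp add: F_def)
  then have "F \<noteq> 0" using assms(1) by auto
  have one: "opcalc 1 T x = x" by (rule opcalc_one)
  have "(\<lambda>m. fps_nth (fps_exp (complex_of_real s)) m *\<^sub>C (T ^^ m) x - fps_nth 1 m *\<^sub>C (T ^^ m) x) sums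
      (flow s x - opcalc 1 T x)"
    unfolding flow_def by (intro sums_diff opcalc_sums exp_conv) simp
  then have "(\<lambda>m. fps_nth (fps_exp (complex_of_real s)) m *\<^sub>C (T ^^ m) x - fps_nth 1 m *\<^sub>C (T ^^ m) x) sums 0"
    unfolding one assms(4) by simp
  moreover have "(\<lambda>m. fps_nth (fps_exp (complex_of_real s)) m *\<^sub>C (T ^^ m) x - fps_nth 1 m *\<^sub>C (T ^^ m) x) =
      (\<lambda>m. fps_nth F m *\<^sub>C (T ^^ m) x)"
    by (simp add: F_def cvec.scale_left_diff_distrib del: fps_one_nth)
  ultimately have "opcalc F T x = 0"
    by (simp add: opcalc_def sums_iff del: fps_one_nth)
  then obtain \<mu> y where \<mu>: "eval_fps F \<mu> = 0" "y \<in> E" "y \<noteq> 0" "T y = \<mu> *\<^sub>C y"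
    using opcalc_kernel_imp_eigenvector[OF conv \<open>F \<noteq> 0\<close> subspace_E T_in_E assms(2,3)] by metis
  have "exp (of_real s * \<mu>) = 1"
    using \<mu>(1) by (simp add: F_def eval_fps_diff)
  then have "exp (s * Re \<mu>) = 1"
    using norm_exp_eq_Re[of "of_real s * \<mu>"] by simp
  then have "Re \<mu> = 0" using assms(1) by simp
  then show ?thesis using \<mu> by (intro that)
qed

end

section \<open>The resultant\<close>

lemma poly_eq_sum_le:
  fixes p :: "'a::comm_semiring_1 poly"
  assumes "degree p \<le> m"
  shows "poly p x = (\<Sum>d\<le>m. coeff p d * x ^ d)"
  unfolding poly_altdef
  by (rule sum.mono_neutral_left) (use assms in \<open>auto simp: coeff_eq_0\<close>)

text \<open>
  For a common root \<open>l\<close> the vector of powers \<open>(l\<^bsup>m+k-1\<^esup>, \<dots>, l, 1)\<close> is in the kernel of the Sylvester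
  matrix. The degrees may be formal ones.
\<close>

lemma common_root_imp_sylvester_det_zero:
  fixes p q :: "complex poly"
  assumes "degree p \<le> m" "degree q \<le> k" "m + k > 0" and root: "poly p l = 0" "poly q l = 0"
  shows "Determinant.det (sylvester_mat_sub m k p q) = 0"
proof -
  let ?A = "sylvester_mat_sub m k p q"
  define v where "v = vec (m + k) (\<lambda>j. l ^ (m + k - 1 - j))"
  \<comment> \<open>The first k rows are shifts of the coefficients of p, the last m rows shifts of those of q.\<close>
  have row: "(\<Sum>j = 0..<m + k. ?A $$ (i, j) * l ^ (m + k - 1 - j)) = 0" if i: "i < m + k" for i
  proof (cases "i < k")
    case True
    have "(\<Sum>j = 0..<m + k. ?A $$ (i, j) * l ^ (m + k - 1 - j)) =
        (\<Sum>j\<in>{i..i + m}. coeff p (m + i - j) * l ^ (m + k - 1 - j))"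
      by (rule sum.mono_neutral_cong_right) (use True i in \<open>auto simp: sylvester_mat_sub_index\<close>)
    also have "\<dots> = (\<Sum>d\<le>m. coeff p d * l ^ d * l ^ (k - 1 - i))"
      by (rule sum.reindex_bij_witness[of _ "\<lambda>d. m + i - d" "\<lambda>j. m + i - j"])
         (use True in \<open>auto simp flip: power_add intro!: arg_cong[of _ _ "\<lambda>e. l ^ e"]\<close>)
    also have "\<dots> = poly p l * l ^ (k - 1 - i)"
      by (simp add: poly_eq_sum_le[OF assms(1)] sum_distrib_right)
    finally show ?thesis using root by simp
  next
    case False
    have "(\<Sum>j = 0..<m + k. ?A $$ (i, j) * l ^ (m + k - 1 - j)) =
        (\<Sum>j\<in>{i - k..i}. coeff q (i - j) * l ^ (m + k - 1 - j))"
      by (rule sum.mono_neutral_cong_right) (use False i in \<open>auto simp: sylvester_mat_sub_index\<close>)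
    also have "\<dots> = (\<Sum>d\<le>k. coeff q d * l ^ d * l ^ (m + k - 1 - i))"
      by (rule sum.reindex_bij_witness[of _ "\<lambda>d. i - d" "\<lambda>j. i - j"])
         (use False i in \<open>auto simp flip: power_add intro!: arg_cong[of _ _ "\<lambda>e. l ^ e"]\<close>)
    also have "\<dots> = poly q l * l ^ (m + k - 1 - i)"
      by (simp add: poly_eq_sum_le[OF assms(2)] sum_distrib_right)
    finally show ?thesis using root by simp
  qed
  have carrier: "?A \<in> carrier_mat (m + k) (m + k)" by (rule sylvester_mat_sub_carrier)
  have "?A *\<^sub>v v = 0\<^sub>v (m + k)"
  proof (rule eq_vecI)
    fix i assume "i < dim_vec (0\<^sub>v (m + k) :: complex vec)"
    then have i: "i < m + k" by simp
    have "(?A *\<^sub>v v) $ i = (\<Sum>j = 0..<m + k. ?A $$ (i, j) * l ^ (m + k - 1 - j))"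
      using i by (simp add: scalar_prod_def v_def)
    then show "(?A *\<^sub>v v) $ i = 0\<^sub>v (m + k) $ i" using row[OF i] i by simp
  qed simp
  moreover have "v \<noteq> 0\<^sub>v (m + k)"
  proof
    assume "v = 0\<^sub>v (m + k)"
    then have "v $ (m + k - 1) = 0" using assms(3) by simp
    then show False using assms(3) by (simp add: v_def)
  qed
  moreover have "v \<in> carrier_vec (m + k)" by (simp add: v_def)
  ultimately show ?thesis unfolding det_0_iff_vec_prod_zero[OF carrier] by blast
qed

lemma coeff_Gd_poly:
  "coeff (Gd_poly n f z) d = (\<Sum>j=1..n. if j - 1 = d then f j z else 0) - (if n = d then 1 else 0)"
  by (simp add: Gd_poly_def coeff_sum)

lemma coeff_dGd_poly: "coeff (dGd_poly n f z) d = (\<Sum>j=1..n. if j - 1 = d then deriv (f j) z else 0)"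
  by (simp add: dGd_poly_def coeff_sum)

lemma degree_Gd_poly: "degree (Gd_poly n f z) \<le> n"
  by (rule degree_le) (auto simp: coeff_Gd_poly intro!: sum.neutral)

lemma degree_dGd_poly: "degree (dGd_poly n f z) \<le> n - 1"
  by (rule degree_le) (auto simp: coeff_dGd_poly intro!: sum.neutral)

lemma Gd_poly_nonzero: "n \<ge> 1 \<Longrightarrow> Gd_poly n f z \<noteq> 0"
proof
  assume "n \<ge> 1" "Gd_poly n f z = 0"
  then have "coeff (Gd_poly n f z) n = 0" by simp
  moreover have "(\<Sum>j=1..n. if j - 1 = n then f j z else 0) = 0"
    by (rule sum.neutral) auto
  ultimately show False by (simp add: coeff_Gd_poly)
qed

lemma finite_Gd_roots: "n \<ge> 1 \<Longrightarrow> finite {l. Gd n f l z = 0}"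
  using poly_roots_finite[OF Gd_poly_nonzero[of n f z]] by (simp add: poly_Gd_poly)

lemma res_Gd_common_root:
  assumes "n \<ge> 1" "Gd n f l z = 0" "poly (dGd_poly n f z) l = 0"
  shows "res_Gd n f z = 0"
  unfolding res_Gd_def
  by (rule common_root_imp_sylvester_det_zero[OF degree_Gd_poly degree_dGd_poly])
     (use assms in \<open>auto simp: poly_Gd_poly\<close>)

lemma holomorphic_on_const_if:
  "(P \<Longrightarrow> g holomorphic_on S) \<Longrightarrow> (\<not> P \<Longrightarrow> h holomorphic_on S) \<Longrightarrow>
    (\<lambda>z. if P then g z else h z) holomorphic_on S"
  by (cases P) simp_all

lemma res_Gd_holomorphic:
  assumes "open S" and f: "\<And>j. j \<in> {1..n} \<Longrightarrow> f j holomorphic_on S"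
  shows "res_Gd n f holomorphic_on S"
proof -
  let ?N = "n + (n - 1)"
  let ?A = "\<lambda>z. sylvester_mat_sub n (n - 1) (Gd_poly n f z) (dGd_poly n f z)"
  have p: "(\<lambda>z. coeff (Gd_poly n f z) d) holomorphic_on S" for d
    unfolding coeff_Gd_poly
    by (intro holomorphic_on_diff holomorphic_on_sum holomorphic_on_const_if holomorphic_on_const f)
  have q: "(\<lambda>z. coeff (dGd_poly n f z) d) holomorphic_on S" for d
    unfolding coeff_dGd_poly
    by (intro holomorphic_on_sum holomorphic_on_const_if holomorphic_on_const holomorphic_deriv f assms(1))
  have entry: "(\<lambda>z. ?A z $$ (i, j)) holomorphic_on S" if "i < ?N" "j < ?N" for i j
    unfolding sylvester_mat_sub_index[OF that]
    by (intro holomorphic_on_const_if holomorphic_on_const p q)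
  have "(\<lambda>z. \<Sum>\<pi>\<in>{\<pi>. \<pi> permutes {0..<?N}}. signof \<pi> * (\<Prod>i = 0..<?N. ?A z $$ (i, \<pi> i))) holomorphic_on S"
    by (intro holomorphic_on_sum holomorphic_on_mult holomorphic_on_const holomorphic_on_prod entry)
       (auto simp: permutes_in_image)
  moreover have "res_Gd n f = (\<lambda>z. \<Sum>\<pi>\<in>{\<pi>. \<pi> permutes {0..<?N}}. signof \<pi> * (\<Prod>i = 0..<?N. ?A z $$ (i, \<pi> i)))"
    unfolding res_Gd_def by (intro ext det_def' sylvester_mat_sub_carrier)
  ultimately show ?thesis by simp
qed

lemma Gd_holomorphic:
  assumes "\<And>j. j \<in> {1..n} \<Longrightarrow> f j holomorphic_on S"
  shows "Gd n f l holomorphic_on S"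
proof -
  have "(\<lambda>z. (\<Sum>j=1..n. l ^ (j - 1) * f j z) - l ^ n) holomorphic_on S"
    by (intro holomorphic_intros assms) auto
  then show ?thesis by (simp add: Gd_def[abs_def])
qed

text \<open>
  If \<open>G\<^sub>d(l, \<cdot>)\<close> vanishes identically, so does its derivative, and \<open>l\<close> is a common root of the two
  polynomials at every point.
\<close>

lemma Gd_not_identically_zero:
  assumes "n \<ge> 1" and S: "open S" and f: "\<And>j. j \<in> {1..n} \<Longrightarrow> f j holomorphic_on S"
    and res: "z \<in> S" "res_Gd n f z \<noteq> 0"
  shows "\<exists>w\<in>S. Gd n f l w \<noteq> 0"
proof (rule ccontr)
  assume "\<not> (\<exists>w\<in>S. Gd n f l w \<noteq> 0)"
  then have zero: "Gd n f l w = 0" if "w \<in> S" for w using that by blast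
  have "eventually (\<lambda>w. Gd n f l w = 0) (nhds z)"
    using eventually_nhds_in_open[OF S res(1)] by eventually_elim (rule zero)
  then have "deriv (Gd n f l) z = deriv (\<lambda>w. 0) z" by (rule deriv_cong_ev) simp
  moreover have "deriv (Gd n f l) z = poly (dGd_poly n f z) l"
    using f S res(1) by (intro deriv_Gd) (auto intro: holomorphic_on_imp_differentiable_at)
  ultimately have "poly (dGd_poly n f z) l = 0" by simp
  then show False using res_Gd_common_root[OF assms(1) zero[OF res(1)]] res(2) by blast
qed

text \<open>
  A root at a zero of the resultant can be moved: the zeros of the resultant are isolated, and by
  Hurwitz' theorem \<open>G\<^sub>d(l, \<cdot>)\<close> has roots near \<open>z\<^sub>0\<close> for \<open>l\<close> on the imaginary axis near \<open>l\<^sub>0\<close>. They differ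
  from \<open>z\<^sub>0\<close>, because \<open>G\<^sub>d(\<cdot>, z\<^sub>0)\<close> has finitely many roots.
\<close>

lemma Gd_root_perturbation:
  assumes "n \<ge> 1" "\<rho> > 0" and f: "\<And>j. j \<in> {1..n} \<Longrightarrow> f j holomorphic_on ball 0 \<rho>"
    and res: "cmod z\<^sub>1 < \<rho>" "res_Gd n f z\<^sub>1 \<noteq> 0"
    and root: "Re l\<^sub>0 = 0" "cmod z\<^sub>0 < \<rho>" "Gd n f l\<^sub>0 z\<^sub>0 = 0"
  shows "\<exists>l z. Re l = 0 \<and> cmod z < \<rho> \<and> Gd n f l z = 0 \<and> res_Gd n f z \<noteq> 0"
proof (cases "res_Gd n f z\<^sub>0 = 0")
  case False
  then show ?thesis using root by blast
next
  case True
  have z1: "z\<^sub>1 \<in> ball 0 \<rho>" and z0: "z\<^sub>0 \<in> ball 0 \<rho>" using res root by auto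
  obtain r where r: "0 < r" "ball z\<^sub>0 r \<subseteq> ball 0 \<rho>"
    "\<And>z. z \<in> ball z\<^sub>0 r - {z\<^sub>0} \<Longrightarrow> res_Gd n f z \<noteq> 0"
    using isolated_zeros[OF res_Gd_holomorphic[OF open_ball f] open_ball connected_ball z0 True z1 res(2)]
    by metis
  define L where "L = (\<lambda>k::nat. l\<^sub>0 + \<i> * of_real (inverse (real (Suc k))))"
  have L_lim: "L \<longlonglongrightarrow> l\<^sub>0"
  proof -
    have "L \<longlonglongrightarrow> l\<^sub>0 + \<i> * of_real 0"
      unfolding L_def by (intro tendsto_intros LIMSEQ_inverse_real_of_nat)
    then show ?thesis by simp
  qed
  have "inj L" by (rule injI) (simp add: L_def)
  then have "finite (L -` {l. Gd n f l z\<^sub>0 = 0})"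
    using finite_Gd_roots[OF assms(1)] by (intro finite_vimageI)
  \<comment> \<open>From the index K on, no l in the sequence has the root z0 itself.\<close>
  then obtain K where K: "\<And>k. Gd n f (L k) z\<^sub>0 = 0 \<Longrightarrow> k < K"
    unfolding finite_nat_set_iff_bounded by auto
  have "\<exists>k. \<exists>z\<in>ball z\<^sub>0 r. Gd n f (L (k + K)) z = 0"
  proof (rule ccontr)
    assume no: "\<not> (\<exists>k. \<exists>z\<in>ball z\<^sub>0 r. Gd n f (L (k + K)) z = 0)"
    have fr: "f j holomorphic_on ball z\<^sub>0 r" if "j \<in> {1..n}" for j
      by (rule holomorphic_on_subset[OF f[OF that] r(2)])
    have "Gd n f l\<^sub>0 z\<^sub>0 \<noteq> 0"
    proof (rule Hurwitz_no_zeros[of "ball z\<^sub>0 r" "\<lambda>k. Gd n f (L (k + K))" "Gd n f l\<^sub>0" z\<^sub>0])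
      show "Gd n f (L (k + K)) holomorphic_on ball z\<^sub>0 r" for k by (rule Gd_holomorphic[OF fr])
      show "Gd n f l\<^sub>0 holomorphic_on ball z\<^sub>0 r" by (rule Gd_holomorphic[OF fr])
      show "\<not> Gd n f l\<^sub>0 constant_on ball z\<^sub>0 r"
      proof
        assume "Gd n f l\<^sub>0 constant_on ball z\<^sub>0 r"
        then have small: "Gd n f l\<^sub>0 z = 0" if "z \<in> ball z\<^sub>0 r" for z
          using that root(3) r(1) unfolding constant_on_def by (metis centre_in_ball)
        have "Gd n f l\<^sub>0 z = 0" if "z \<in> ball 0 \<rho>" for z
        proof (rule analytic_continuation_open[of "ball z\<^sub>0 r" "ball 0 \<rho>" "Gd n f l\<^sub>0" "\<lambda>_. 0" z])
          show "Gd n f l\<^sub>0 holomorphic_on ball 0 \<rho>" by (rule Gd_holomorphic[OF f])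
        qed (use r small that in auto)
        then show False using Gd_not_identically_zero[OF assms(1) open_ball f z1 res(2)] by blast
      qed
      show "Gd n f (L (k + K)) z \<noteq> 0" if "z \<in> ball z\<^sub>0 r" for k z using no that by blast
      show "uniform_limit C (\<lambda>k. Gd n f (L (k + K))) (Gd n f l\<^sub>0) sequentially"
        if C: "compact C" "C \<subseteq> ball z\<^sub>0 r" for C
      proof -
        have "\<exists>M. \<forall>z\<in>C. cmod (f j z) \<le> M" if "j \<in> {1..n}" for j
          using compact_imp_bounded[OF compact_continuous_image[OF
              holomorphic_on_imp_continuous_on[OF holomorphic_on_subset[OF fr[OF that] C(2)]] C(1)]]
          unfolding bounded_iff by blast
        then obtain M where M: "\<And>j z. j \<in> {1..n} \<Longrightarrow> z \<in> C \<Longrightarrow> cmod (f j z) \<le> M j" by metis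
        define b where "b = (\<lambda>k. (\<Sum>j=1..n. cmod (L (k + K) ^ (j - 1) - l\<^sub>0 ^ (j - 1)) * M j) +
            cmod (L (k + K) ^ n - l\<^sub>0 ^ n))"
        have LK: "(\<lambda>k. L (k + K)) \<longlonglongrightarrow> l\<^sub>0" using L_lim by (rule LIMSEQ_ignore_initial_segment)
        have "b \<longlonglongrightarrow> (\<Sum>j=1..n. cmod (l\<^sub>0 ^ (j - 1) - l\<^sub>0 ^ (j - 1)) * M j) + cmod (l\<^sub>0 ^ n - l\<^sub>0 ^ n)"
          unfolding b_def by (intro tendsto_intros LK)
        then have b: "b \<longlonglongrightarrow> 0" by simp
        have diff: "cmod (Gd n f (L (k + K)) z - Gd n f l\<^sub>0 z) \<le> b k" if "z \<in> C" for k z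
        proof -
          have "Gd n f (L (k + K)) z - Gd n f l\<^sub>0 z =
              (\<Sum>j=1..n. (L (k + K) ^ (j - 1) - l\<^sub>0 ^ (j - 1)) * f j z) - (L (k + K) ^ n - l\<^sub>0 ^ n)"
            by (simp add: Gd_def left_diff_distrib sum_subtractf)
          also have "cmod \<dots> \<le> (\<Sum>j=1..n. cmod ((L (k + K) ^ (j - 1) - l\<^sub>0 ^ (j - 1)) * f j z)) +
              cmod (L (k + K) ^ n - l\<^sub>0 ^ n)"
            by (intro order_trans[OF norm_triangle_ineq4] add_mono norm_sum order_refl)
          also have "\<dots> \<le> b k"
            unfolding b_def norm_mult using M that by (intro add_mono sum_mono mult_left_mono) auto
          finally show ?thesis .
        qed
        show ?thesis
        proof (rule uniform_limitI)
          fix e :: real assume "e > 0"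
          then have "\<forall>\<^sub>F k in sequentially. b k < e" using b by (rule order_tendstoD(2)[rotated])
          then show "\<forall>\<^sub>F k in sequentially. \<forall>z\<in>C. dist (Gd n f (L (k + K)) z) (Gd n f l\<^sub>0 z) < e"
            by eventually_elim (use diff in \<open>auto simp: dist_norm intro: le_less_trans\<close>)
        qed
      qed
    qed (use r(1) in auto)
    then show False using root(3) by blast
  qed
  then obtain k z where z: "z \<in> ball z\<^sub>0 r" "Gd n f (L (k + K)) z = 0" by blast
  have "z \<noteq> z\<^sub>0" using K[of "k + K"] z(2) by auto
  then have "res_Gd n f z \<noteq> 0" using r(3) z(1) by blast
  moreover have "cmod z < \<rho>" using z(1) r(2) by auto
  moreover have "Re (L (k + K)) = 0" using root(1) by (simp add: L_def)
  ultimately show ?thesis using z(2) by blast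
qed

section \<open>The companion operator in coordinates\<close>

context bounded_operator
begin

lemma opcalc_fps_add:
  assumes "fps_conv_radius F > R" "fps_conv_radius G > R"
  shows "opcalc (F + G) T x = opcalc F T x + opcalc G T x"
  using sums_add[OF opcalc_sums[OF assms(1)] opcalc_sums[OF assms(2)], of x x]
  by (simp add: opcalc_def sums_iff scaleC_add_left)

lemma opcalc_fps_cmult:
  assumes "fps_conv_radius F > R"
  shows "opcalc (fps_const c * F) T x = c *\<^sub>C opcalc F T x"
  using bounded_linear.sums[OF bounded_linear_scaleC_right opcalc_sums[OF assms], of c x]
  by (simp add: opcalc_def sums_iff scaleC_scaleC)

lemma opcalc_fps_const: "opcalc (fps_const c) T x = c *\<^sub>C x"
  by (subst opcalc_finite[of 1]) auto

lemma opcalc_fps_sum: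
  assumes "finite I" "\<And>i. i \<in> I \<Longrightarrow> fps_conv_radius (F i) > R"
  shows "fps_conv_radius (\<Sum>i\<in>I. F i) > R \<and> opcalc (\<Sum>i\<in>I. F i) T x = (\<Sum>i\<in>I. opcalc (F i) T x)"
  using assms
proof (induction I rule: finite_induct)
  case empty
  then show ?case using opcalc_fps_const[of 0 x] by simp
next
  case (insert i I)
  have "min (fps_conv_radius (F i)) (fps_conv_radius (\<Sum>i\<in>I. F i)) > R"
    using insert by simp
  then have "fps_conv_radius (F i + (\<Sum>i\<in>I. F i)) > R"
    by (rule less_le_trans[OF _ fps_conv_radius_add])
  then show ?case using insert by (simp add: opcalc_fps_add)
qed

end

lemma tendsto_zero_if:
  fixes a b :: "nat \<Rightarrow> complex"
  shows "(P \<Longrightarrow> a \<longlonglongrightarrow> 0) \<Longrightarrow> (\<not> P \<Longrightarrow> b \<longlonglongrightarrow> 0) \<Longrightarrow> (\<lambda>k. if P then a k else b k) \<longlonglongrightarrow> 0"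
  by (cases P) simp_all

lemma row_shift_pow_apply: "(row_shift \<rho> ^^ m) w (i, k) = of_real (\<rho> ^ m) * w (i, k + m)"
  by (induction m arbitrary: k) simp_all

locale companion_setting =
  fixes \<rho> :: real and n :: nat and f :: "nat \<Rightarrow> complex \<Rightarrow> complex"
  assumes rho_pos: "\<rho> > 0" and n_pos: "n \<ge> 1"
    and f_hol: "\<And>j. j \<in> {1..n} \<Longrightarrow> \<exists>U. open U \<and> cball 0 \<rho> \<subseteq> U \<and> f j holomorphic_on U"
begin

sublocale D: bounded_operator "row_shift \<rho>" \<rho>
  by (rule row_shift_operator[OF rho_pos])

definition f_series :: "nat \<Rightarrow> complex fps"
  where "f_series j = fps_expansion (f j) 0"

text \<open>The operator \<open>f\<^sub>j(\<partial>\<^sub>x)\<close> in coefficients, acting on all rows at once.\<close>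

definition f_shift :: "nat \<Rightarrow> array \<Rightarrow> array"
  where "f_shift j = opcalc (f_series j) (row_shift \<rho>)"

lemma common_radius:
  obtains r where "\<rho> < r" "\<And>j. j \<in> {1..n} \<Longrightarrow> f j holomorphic_on ball 0 r"
proof -
  obtain U where U: "\<And>j. j \<in> {1..n} \<Longrightarrow> open (U j) \<and> cball 0 \<rho> \<subseteq> U j \<and> f j holomorphic_on U j"
    using f_hol by metis
  have "open (\<Inter>j\<in>{1..n}. U j)" "cball 0 \<rho> \<subseteq> (\<Inter>j\<in>{1..n}. U j)"
    using U by (blast intro: open_INT[OF finite_atLeastAtMost])+
  then obtain r where r: "\<rho> < r" "ball 0 r \<subseteq> (\<Inter>j\<in>{1..n}. U j)"
    using cball_subset_open_imp_larger_ball rho_pos by (metis less_imp_le)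
  have "f j holomorphic_on ball 0 r" if "j \<in> {1..n}" for j
    using U[OF that] r(2) that by (blast intro: holomorphic_on_subset)
  then show ?thesis using r(1) by (rule that[rotated])
qed

lemma f_hol_ball: "j \<in> {1..n} \<Longrightarrow> f j holomorphic_on ball 0 \<rho>"
  using f_hol[of j] ball_subset_cball by (metis holomorphic_on_subset)

lemma f_series:
  assumes "j \<in> {1..n}"
  shows f_series_conv: "fps_conv_radius (f_series j) > \<rho>"
    and f_series_eval: "cmod z < \<rho> \<Longrightarrow> eval_fps (f_series j) z = f j z"
proof -
  obtain r where r: "\<rho> < r" "\<And>j. j \<in> {1..n} \<Longrightarrow> f j holomorphic_on ball 0 r" by (rule common_radius) blast
  have hol: "f j holomorphic_on eball 0 (ereal r)" using r(2)[OF assms] by simp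
  show "fps_conv_radius (f_series j) > \<rho>"
    unfolding f_series_def using conv_radius_fps_expansion[OF hol] r(1)
    by (meson less_ereal.simps(1) less_le_trans)
  show "eval_fps (f_series j) z = f j z" if "cmod z < \<rho>"
    unfolding f_series_def using eval_fps_expansion'[OF hol, of z] that r(1) by simp
qed

definition companion_bound :: real
  where "companion_bound = 1 + (\<Sum>j=1..n. \<Sum>m. cmod (fps_nth (f_series j) m) * \<rho> ^ m)"

lemma f_shift_bound_nonneg: "j \<in> {1..n} \<Longrightarrow> 0 \<le> (\<Sum>m. cmod (fps_nth (f_series j) m) * \<rho> ^ m)"
  using rho_pos by (intro suminf_nonneg D.summable_coeffs f_series_conv) auto

definition companion_array :: "array \<Rightarrow> array"
  where "companion_array w = Bcontfun (\<lambda>(i, k).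
    if 1 \<le> i \<and> i < n then w (i + 1, k) else if i = n then \<Sum>j=1..n. f_shift j w (j, k) else 0)"

lemma companion_bound_ge_1: "1 \<le> companion_bound"
  unfolding companion_bound_def le_add_same_cancel1 by (intro sum_nonneg f_shift_bound_nonneg)

lemma companion_entry_bound:
  "norm (case q of (i, k) \<Rightarrow>
    if 1 \<le> i \<and> i < n then apply_bcontfun w (i + 1, k)
    else if i = n then \<Sum>j=1..n. apply_bcontfun (f_shift j w) (j, k) else 0) \<le> companion_bound * norm w"
proof (cases q)
  case (Pair i k)
  note cb = companion_bound_ge_1
  have "norm (apply_bcontfun w (i + 1, k)) \<le> companion_bound * norm w"
    using mult_right_mono[OF cb norm_ge_zero[of w]] norm_bounded[of w "(i + 1, k)"] by simp
  moreover have "norm (\<Sum>j=1..n. apply_bcontfun (f_shift j w) (j, k)) \<le> companion_bound * norm w"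
  proof -
    have "norm (\<Sum>j=1..n. apply_bcontfun (f_shift j w) (j, k)) \<le>
        (\<Sum>j=1..n. (\<Sum>m. cmod (fps_nth (f_series j) m) * \<rho> ^ m) * norm w)"
      by (rule sum_norm_le)
         (auto simp: f_shift_def intro!: order_trans[OF norm_bounded D.opcalc_bound] f_series_conv)
    also have "\<dots> \<le> companion_bound * norm w"
      unfolding companion_bound_def by (simp add: sum_distrib_right[symmetric] mult_right_mono)
    finally show ?thesis .
  qed
  moreover have "0 \<le> companion_bound * norm w" using cb by simp
  ultimately show ?thesis using Pair by simp
qed

lemma companion_array_apply:
  "companion_array w (i, k) =
    (if 1 \<le> i \<and> i < n then w (i + 1, k) else if i = n then \<Sum>j=1..n. f_shift j w (j, k) else 0)"
  unfolding companion_array_def by (subst apply_Bcontfun_array[OF companion_entry_bound]) simp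

lemma companion_operator: "bounded_operator companion_array companion_bound"
proof
  show "companion_array (v + w) = companion_array v + companion_array w" for v w
    by (rule array_eqI)
       (simp add: companion_array_apply f_shift_def D.opcalc_add f_series_conv sum.distrib)
  show "companion_array (c *\<^sub>C w) = c *\<^sub>C companion_array w" for c w
    by (rule array_eqI)
       (simp add: companion_array_apply f_shift_def D.opcalc_scaleC f_series_conv scaleC_complex_def
         sum_distrib_left)
  show "norm (companion_array w) \<le> companion_bound * norm w" for w
  proof (rule norm_bound)
    fix p :: "nat \<times> nat"
    show "norm (companion_array w p) \<le> companion_bound * norm w"
      using companion_entry_bound[where q = p and w = w] by (cases p) (simp add: companion_array_apply)
  qed
  show "0 \<le> companion_bound"
    using companion_bound_ge_1 by simp
qed

lemma f_shift_null_rows: "j \<in> {1..n} \<Longrightarrow> w \<in> null_rows m \<Longrightarrow> f_shift j w \<in> null_rows m"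
  unfolding f_shift_def
  by (rule D.opcalc_closed_invariant[OF f_series_conv subspace_null_rows closed_null_rows row_shift_null_rows])

lemma companion_null_rows:
  assumes w: "w \<in> null_rows n"
  shows "companion_array w \<in> null_rows n"
proof -
  have "(\<lambda>k. companion_array w (i, k)) \<longlonglongrightarrow> 0" for i
  proof -
    have "(\<lambda>k. \<Sum>j=1..n. f_shift j w (j, k)) \<longlonglongrightarrow> (\<Sum>j=1..n. 0)"
      by (intro tendsto_sum) (rule null_rowsD(1)[OF f_shift_null_rows[OF _ w]])
    then show ?thesis
      unfolding companion_array_apply
      by (intro tendsto_zero_if null_rowsD(1)[OF w] tendsto_const) simp
  qed
  then show ?thesis by (auto simp: null_rows_def companion_array_apply)
qed

lemma companion_op_rows_fun:
  assumes w: "w \<in> null_rows n"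
  shows "companion_op \<rho> n f (rows_fun \<rho> w) = rows_fun \<rho> (companion_array w)"
proof
  fix i
  have zero: "herzog_fun \<rho> (\<lambda>k. 0) = 0" by (simp add: herzog_fun_def fun_eq_iff)
  have sum: "(\<Sum>j\<in>J. rows_fun \<rho> (v j) j) = herzog_fun \<rho> (\<lambda>k. \<Sum>j\<in>J. v j (j, k))"
    if "finite J" for J and v :: "nat \<Rightarrow> array"
    using that
  proof (induction J rule: finite_induct)
    case (insert j J)
    have "Bseq (\<lambda>k. \<Sum>j\<in>J. v j (j, k))"
      by (rule BseqI'[of _ "\<Sum>j\<in>J. norm (v j)"]) (intro sum_norm_le norm_bounded)
    then show ?case
      using insert by (simp add: rows_fun_def herzog_fun_add[OF Bseq_row])
  qed (simp add: zero)
  consider "1 \<le> i \<and> i < n" | "i = n" | "\<not> (1 \<le> i \<and> i < n)" "i \<noteq> n" by blast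
  then show "companion_op \<rho> n f (rows_fun \<rho> w) i = rows_fun \<rho> (companion_array w) i"
  proof cases
    case 2
    have "(\<Sum>j=1..n. riesz_dunford (herzog_space \<rho>) (herzog_norm \<rho>) (f j) diff_op (rows_fun \<rho> w j)) =
        (\<Sum>j=1..n. rows_fun \<rho> (f_shift j w) j)"
      unfolding f_shift_def f_series_def
      by (intro sum.cong refl riesz_dunford_diff_op[OF rho_pos f_hol w])
    then show ?thesis
      using 2 by (simp add: companion_op_def sum rows_fun_def[of _ "companion_array w"] companion_array_apply)
  next
    case 1
    then show ?thesis by (simp add: companion_op_def rows_fun_def companion_array_apply)
  next
    case 3
    then show ?thesis
      unfolding companion_op_def rows_fun_def companion_array_apply using zero by auto
  qed
qed

sublocale op: operator_model "prod_space n (herzog_space \<rho>)" "prod_norm n (herzog_norm \<rho>)" "rows_fun \<rho>"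
    "null_rows n" companion_array companion_bound "companion_op \<rho> n f"
proof -
  interpret isometric_model "prod_space n (herzog_space \<rho>)" "prod_norm n (herzog_norm \<rho>)" "rows_fun \<rho>" "null_rows n"
    by (rule product_model[OF rho_pos n_pos])
  interpret bounded_operator companion_array companion_bound by (rule companion_operator)
  show "operator_model (prod_space n (herzog_space \<rho>)) (prod_norm n (herzog_norm \<rho>)) (rows_fun \<rho>)
      (null_rows n) companion_array companion_bound (companion_op \<rho> n f)"
    by unfold_locales (auto simp: closed_null_rows companion_null_rows companion_op_rows_fun)
qed

section \<open>Eigenvalues of the companion operator\<close>

lemma f_shift_row_multiple:
  fixes w :: array
  assumes "j \<in> {1..n}" "\<And>k. w (i, k) = c * w (i', k)"
  shows "f_shift j w (i, k) = c * f_shift j w (i', k)"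
proof -
  have s: "(\<lambda>m. fps_nth (f_series j) m * (of_real (\<rho> ^ m) * w (i, k + m))) sums f_shift j w (i, k)" for i
  proof -
    have "(\<lambda>m. apply_bcontfun (fps_nth (f_series j) m *\<^sub>C (row_shift \<rho> ^^ m) w) (i, k)) sums
        apply_bcontfun (opcalc (f_series j) (row_shift \<rho>) w) (i, k)"
      by (rule bounded_linear.sums[OF bounded_linear_apply_bcontfun D.opcalc_sums[OF f_series_conv[OF assms(1)]]])
    then show ?thesis by (simp add: f_shift_def scaleC_complex_def row_shift_pow_apply)
  qed
  have "(\<lambda>m. c * (fps_nth (f_series j) m * (of_real (\<rho> ^ m) * w (i', k + m)))) sums (c * f_shift j w (i', k))"
    by (intro sums_mult s)
  then show ?thesis
    using s[of i] unfolding assms(2) by (intro sums_unique2[OF s[of i]]) (simp add: assms(2) mult_ac)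
qed

text \<open>
  The expansion of \<open>G\<^sub>d(l, \<cdot>)\<close> at the origin.
\<close>

definition Gd_series :: "complex \<Rightarrow> complex fps"
  where "Gd_series l = (\<Sum>j=1..n. fps_const (l ^ (j - 1)) * f_series j) - fps_const (l ^ n)"

lemma Gd_series:
  shows Gd_series_conv: "fps_conv_radius (Gd_series l) > \<rho>"
    and Gd_series_eval: "cmod z < \<rho> \<Longrightarrow> eval_fps (Gd_series l) z = Gd n f l z"
    and Gd_series_opcalc: "opcalc (Gd_series l) (row_shift \<rho>) w =
      (\<Sum>j=1..n. l ^ (j - 1) *\<^sub>C f_shift j w) - l ^ n *\<^sub>C w"
proof -
  have term_conv: "fps_conv_radius (fps_const (l ^ (j - 1)) * f_series j) > \<rho>" if "j \<in> {1..n}" for j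
    using f_series_conv[OF that] fps_conv_radius_mult[of "fps_const (l ^ (j - 1))" "f_series j"]
    by (auto simp: min_def intro: less_le_trans split: if_splits)
  note sum = D.opcalc_fps_sum[of "{1..n}" "\<lambda>j. fps_const (l ^ (j - 1)) * f_series j", OF finite_atLeastAtMost term_conv]
  have eq: "Gd_series l = (\<Sum>j=1..n. fps_const (l ^ (j - 1)) * f_series j) + fps_const (- (l ^ n))"
    by (simp add: Gd_series_def flip: fps_const_neg)
  have sum_conv: "fps_conv_radius (\<Sum>j=1..n. fps_const (l ^ (j - 1)) * f_series j) > \<rho>"
    using sum by blast
  show "fps_conv_radius (Gd_series l) > \<rho>"
    unfolding eq using sum_conv
    by (intro less_le_trans[OF _ fps_conv_radius_add]) simp
  have "opcalc (Gd_series l) (row_shift \<rho>) w =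
      (\<Sum>j=1..n. opcalc (fps_const (l ^ (j - 1)) * f_series j) (row_shift \<rho>) w) + (- (l ^ n)) *\<^sub>C w"
    unfolding eq using sum by (subst D.opcalc_fps_add) (auto simp: D.opcalc_fps_const simp del: fps_const_neg)
  also have "(\<Sum>j=1..n. opcalc (fps_const (l ^ (j - 1)) * f_series j) (row_shift \<rho>) w) =
      (\<Sum>j=1..n. l ^ (j - 1) *\<^sub>C f_shift j w)"
    unfolding f_shift_def by (intro sum.cong refl D.opcalc_fps_cmult f_series_conv)
  finally show "opcalc (Gd_series l) (row_shift \<rho>) w =
      (\<Sum>j=1..n. l ^ (j - 1) *\<^sub>C f_shift j w) - l ^ n *\<^sub>C w"
    by (simp add: cvec.scale_minus_left)
  show "eval_fps (Gd_series l) z = Gd n f l z" if z: "cmod z < \<rho>"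
  proof -
    have conv: "ereal (cmod z) < fps_conv_radius F" if "fps_conv_radius F > \<rho>" for F :: "complex fps"
      using z that by (meson less_ereal.simps(1) less_trans)
    have "(\<lambda>m. (\<Sum>j=1..n. l ^ (j - 1) * (fps_nth (f_series j) m * z ^ m)) - fps_nth (fps_const (l ^ n)) m * z ^ m)
        sums ((\<Sum>j=1..n. l ^ (j - 1) * eval_fps (f_series j) z) - eval_fps (fps_const (l ^ n)) z)"
      unfolding eval_fps_def
      by (intro sums_diff sums_sum sums_mult summable_sums summable_fps conv f_series_conv) simp_all
    moreover have "(\<lambda>m. (\<Sum>j=1..n. l ^ (j - 1) * (fps_nth (f_series j) m * z ^ m)) - fps_nth (fps_const (l ^ n)) m * z ^ m) =
        (\<lambda>m. fps_nth (Gd_series l) m * z ^ m)"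
      by (simp add: Gd_series_def fps_sum_nth sum_distrib_right left_diff_distrib mult.assoc)
    ultimately have "eval_fps (Gd_series l) z = (\<Sum>j=1..n. l ^ (j - 1) * eval_fps (f_series j) z) - l ^ n"
      by (simp add: eval_fps_def[of "Gd_series l"] sums_iff)
    then show ?thesis by (simp add: Gd_def f_series_eval[OF _ z])
  qed
qed

text \<open>
  The first \<open>n - 1\<close> equations say that row \<open>i\<close> is \<open>l\<^bsup>i-1\<^esup>\<close> times row \<open>1\<close>, and the last one then says
  that \<open>G\<^sub>d(l, D)\<close> annihilates row \<open>1\<close>, and therefore all of its multiples.
\<close>

lemma companion_eigenvector_imp_kernel:
  assumes w: "w \<in> null_rows n" and eig: "companion_array w = l *\<^sub>C w"
  shows "opcalc (Gd_series l) (row_shift \<rho>) w = 0"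
proof -
  have step: "w (i + 1, k) = l * w (i, k)" if "1 \<le> i" "i < n" for i k
    using arg_cong[OF eig, of "\<lambda>v. v (i, k)"] that by (simp add: companion_array_apply scaleC_complex_def)
  have rows: "w (i, k) = l ^ (i - 1) * w (1, k)" if "i \<in> {1..n}" for i k
    using that
  proof (induction i)
    case (Suc i)
    then show ?case using step[of i k] by (cases "i = 0") (auto simp: power_eq_if)
  qed simp
  have last: "(\<Sum>j=1..n. f_shift j w (j, k)) = l * w (n, k)" for k
    using arg_cong[OF eig, of "\<lambda>v. v (n, k)"] by (simp add: companion_array_apply scaleC_complex_def)
  have shift_rows: "f_shift j w (i, k) = l ^ (i - 1) * f_shift j w (1, k)" if "i \<in> {1..n}" "j \<in> {1..n}" for i j k
    by (rule f_shift_row_multiple[OF that(2) rows[OF that(1)]])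
  have "(\<Sum>j=1..n. l ^ (j - 1) * f_shift j w (1, k)) = l * w (n, k)" for k
    unfolding last[of k, symmetric] by (intro sum.cong refl) (rule shift_rows[symmetric])
  also have "l * w (n, k) = l ^ n * w (1, k)" for k
    using rows[of n k] n_pos by (simp add: power_eq_if mult.assoc)
  finally have row1: "(\<Sum>j=1..n. l ^ (j - 1) * f_shift j w (1, k)) = l ^ n * w (1, k)" for k .
  show ?thesis
    unfolding Gd_series_opcalc
  proof (rule array_eqI)
    fix i k
    have "apply_bcontfun ((\<Sum>j=1..n. l ^ (j - 1) *\<^sub>C f_shift j w) - l ^ n *\<^sub>C w) (i, k) =
        (\<Sum>j=1..n. l ^ (j - 1) * f_shift j w (i, k)) - l ^ n * w (i, k)"
      by (simp add: array_sum_apply scaleC_complex_def)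
    also have "\<dots> = 0"
    proof (cases "i \<in> {1..n}")
      case True
      have "(\<Sum>j=1..n. l ^ (j - 1) * f_shift j w (i, k)) = l ^ (i - 1) * (\<Sum>j=1..n. l ^ (j - 1) * f_shift j w (1, k))"
        unfolding sum_distrib_left by (intro sum.cong refl) (simp add: shift_rows[OF True] mult_ac)
      then show ?thesis unfolding row1 rows[OF True] by simp
    next
      case False
      then show ?thesis
        using null_rowsD(2)[OF w False] null_rowsD(2)[OF f_shift_null_rows[OF _ w] False] by simp
    qed
    finally show "apply_bcontfun ((\<Sum>j=1..n. l ^ (j - 1) *\<^sub>C f_shift j w) - l ^ n *\<^sub>C w) (i, k) = apply_bcontfun 0 (i, k)"
      by simp
  qed
qed

text \<open>
  The kernel of \<open>G\<^sub>d(l, D)\<close> is nonzero, so it yields an eigenvector of \<open>D\<close> whose eigenvalue is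
  a zero of \<open>G\<^sub>d(l, \<cdot>)\<close>. The resultant ensures that this series is not zero.
\<close>

lemma companion_eigenvalue_imp_root:
  assumes res: "cmod z\<^sub>1 < \<rho>" "res_Gd n f z\<^sub>1 \<noteq> 0"
    and w: "w \<in> null_rows n" "w \<noteq> 0" "companion_array w = l *\<^sub>C w"
  shows "\<exists>z. cmod z < \<rho> \<and> Gd n f l z = 0"
proof -
  have "z\<^sub>1 \<in> ball 0 \<rho>" using res(1) by simp
  then obtain z where z: "cmod z < \<rho>" "Gd n f l z \<noteq> 0"
    using Gd_not_identically_zero[OF n_pos open_ball f_hol_ball _ res(2), of l] by auto
  have "Gd_series l \<noteq> 0"
  proof
    assume "Gd_series l = 0"
    then have "eval_fps (Gd_series l) z = 0" by (simp add: eval_fps_0)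
    then show False using Gd_series_eval[OF z(1)] z(2) by simp
  qed
  then obtain \<mu> y where \<mu>: "eval_fps (Gd_series l) \<mu> = 0" "y \<in> null_rows n" "y \<noteq> 0" "row_shift \<rho> y = \<mu> *\<^sub>C y"
    using D.opcalc_kernel_imp_eigenvector[OF Gd_series_conv _ subspace_null_rows row_shift_null_rows w(1,2)
        companion_eigenvector_imp_kernel[OF w(1,3)]] by metis
  have "cmod \<mu> < \<rho>" by (rule row_shift_eigenvector[OF rho_pos \<mu>(2-4)])
  then show ?thesis using \<mu>(1) Gd_series_eval by metis
qed

text \<open>
  Coordinate \<open>i\<close> represents \<open>l\<^bsup>i-1\<^esup> exp(z x)\<close>. With one row and \<open>l = 0\<close>, where \<open>0\<^sup>0 = 1\<close>, this is the
  exponential itself.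
\<close>

definition eigen_array :: "nat \<Rightarrow> complex \<Rightarrow> complex \<Rightarrow> array"
  where "eigen_array m l z = Bcontfun (\<lambda>(i, k). if i \<in> {1..m} then l ^ (i - 1) * (z / of_real \<rho>) ^ k else 0)"

lemma eigen_array_entry_bound:
  assumes "cmod z < \<rho>"
  shows "norm (case q of (i, k) \<Rightarrow> if i \<in> {1..m} then l ^ (i - 1) * (z / of_real \<rho>) ^ k else 0) \<le> (1 + cmod l) ^ m"
proof (cases q)
  case (Pair i k)
  have "cmod l ^ (i - 1) * cmod (z / of_real \<rho>) ^ k \<le> (1 + cmod l) ^ m * 1" if i: "i \<in> {1..m}"
  proof (rule mult_mono)
    have "cmod l ^ (i - 1) \<le> (1 + cmod l) ^ (i - 1)" by (rule power_mono) auto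
    also have "\<dots> \<le> (1 + cmod l) ^ m" using i by (intro power_increasing) auto
    finally show "cmod l ^ (i - 1) \<le> (1 + cmod l) ^ m" .
    show "cmod (z / of_real \<rho>) ^ k \<le> 1"
      using assms rho_pos by (intro power_le_one) (auto simp: norm_divide)
  qed auto
  then show ?thesis using Pair by (auto simp: norm_mult norm_power)
qed

lemma eigen_array_apply:
  "cmod z < \<rho> \<Longrightarrow> eigen_array m l z (i, k) = (if i \<in> {1..m} then l ^ (i - 1) * (z / of_real \<rho>) ^ k else 0)"
  unfolding eigen_array_def by (subst apply_Bcontfun_array[OF eigen_array_entry_bound]) auto

lemma eigen_array_norm:
  assumes "cmod z < \<rho>"
  shows "norm (eigen_array m l z) \<le> (1 + cmod l) ^ m"
proof (rule norm_bound)
  fix p :: "nat \<times> nat"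
  show "norm (eigen_array m l z p) \<le> (1 + cmod l) ^ m"
    using eigen_array_entry_bound[OF assms, where q = p and m = m and l = l] by (cases p) (simp add: eigen_array_apply[OF assms])
qed

lemma eigen_array_null_rows:
  assumes "cmod z < \<rho>"
  shows "eigen_array m l z \<in> null_rows m"
proof -
  have "(\<lambda>k. (z / of_real \<rho>) ^ k) \<longlonglongrightarrow> 0"
    using assms rho_pos by (intro LIMSEQ_power_zero) (simp add: norm_divide)
  then have "(\<lambda>k. eigen_array m l z (i, k)) \<longlonglongrightarrow> 0" for i
    unfolding eigen_array_apply[OF assms] by (intro tendsto_zero_if tendsto_mult_right_zero tendsto_const)
  then show ?thesis by (auto simp: null_rows_def eigen_array_apply[OF assms])
qed

lemma row_shift_eigen_array: "cmod z < \<rho> \<Longrightarrow> row_shift \<rho> (eigen_array m l z) = z *\<^sub>C eigen_array m l z"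
  using rho_pos by (intro array_eqI) (simp add: eigen_array_apply scaleC_complex_def)

lemma companion_eigen_array:
  assumes z: "cmod z < \<rho>" and root: "Gd n f l z = 0"
  shows "companion_array (eigen_array n l z) = l *\<^sub>C eigen_array n l z"
proof (rule array_eqI)
  fix i k
  have shift: "f_shift j (eigen_array n l z) = f j z *\<^sub>C eigen_array n l z" if j: "j \<in> {1..n}" for j
  proof -
    have "ereal (cmod z) < fps_conv_radius (f_series j)"
      using z f_series_conv[OF j] by (meson less_ereal.simps(1) less_trans)
    then show ?thesis
      unfolding f_shift_def
      using D.opcalc_eigenvector[OF f_series_conv[OF j] row_shift_eigen_array[OF z]] f_series_eval[OF j z] by simp
  qed
  have G: "(\<Sum>j=1..n. l ^ (j - 1) * f j z) = l ^ n" using root by (simp add: Gd_def)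
  have "(\<Sum>j=1..n. f_shift j (eigen_array n l z) (j, k)) =
      (\<Sum>j=1..n. l ^ (j - 1) * f j z) * (z / of_real \<rho>) ^ k"
    unfolding sum_distrib_right
    by (intro sum.cong refl) (simp add: shift eigen_array_apply[OF z] scaleC_complex_def)
  also have "\<dots> = l * (l ^ (n - 1) * (z / of_real \<rho>) ^ k)"
    unfolding G using n_pos by (simp add: power_eq_if)
  finally have last: "(\<Sum>j=1..n. f_shift j (eigen_array n l z) (j, k)) = l * (l ^ (n - 1) * (z / of_real \<rho>) ^ k)" .
  consider "1 \<le> i \<and> i < n" | "i = n" | "\<not> (1 \<le> i \<and> i < n)" "i \<noteq> n" by blast
  then show "companion_array (eigen_array n l z) (i, k) = (l *\<^sub>C eigen_array n l z) (i, k)"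
  proof cases
    case 1
    then show ?thesis
      by (simp add: companion_array_apply eigen_array_apply[OF z] scaleC_complex_def power_eq_if)
  next
    case 2
    then show ?thesis
      using n_pos last by (simp add: companion_array_apply eigen_array_apply[OF z] scaleC_complex_def)
  next
    case 3
    then show ?thesis
      by (auto simp: companion_array_apply eigen_array_apply[OF z] scaleC_complex_def)
  qed
qed

end

section \<open>Chaos along a curve of eigenvectors\<close>

lemma islimpt_Re_less: "l islimpt {w. Re w < Re l}"
  unfolding islimpt_approachable
proof (intro allI impI)
  fix e :: real assume "e > 0"
  then show "\<exists>w\<in>{w. Re w < Re l}. w \<noteq> l \<and> dist w l < e"
    by (intro bexI[of _ "l - of_real (e / 2)"]) (auto simp: dist_norm)
qed

lemma islimpt_Re_greater: "l islimpt {w. Re w > Re l}"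
  unfolding islimpt_approachable
proof (intro allI impI)
  fix e :: real assume "e > 0"
  then show "\<exists>w\<in>{w. Re w > Re l}. w \<noteq> l \<and> dist w l < e"
    by (intro bexI[of _ "l + of_real (e / 2)"]) (auto simp: dist_norm)
qed

text \<open>
  For rational \<open>q\<close> the point \<open>2 \<pi> i q / t\<close> is sent to the root of unity \<open>exp(2 \<pi> i q)\<close>, and these points
  are dense in the imaginary axis.
\<close>

lemma islimpt_roots_of_unity:
  assumes "t > 0" "Re l = 0"
  shows "l islimpt {w. \<exists>k>0. exp (of_real t * w) ^ k = 1}"
  unfolding islimpt_approachable
proof (intro allI impI)
  fix e :: real assume "e > 0"
  define c where "c = 2 * pi / t"
  have c: "c > 0" using assms(1) by (simp add: c_def)
  then obtain q where q: "q \<in> \<rat>" "Im l / c < q" "q < (Im l + e) / c"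
    using Rats_dense_in_real[of "Im l / c" "(Im l + e) / c"] \<open>e > 0\<close> by (auto simp: divide_strict_right_mono)
  obtain a b where ab: "b > 0" "q = of_int a / of_int b"
    using q(1) by (metis Rats_cases' )
  define w where "w = \<i> * of_real (c * q)"
  have "of_nat (nat b) * (of_real t * w) = of_int a * (2 * of_real pi * \<i>)"
    using assms(1) ab by (simp add: w_def c_def)
  then have "exp (of_real t * w) ^ nat b = exp (of_int a * (2 * of_real pi * \<i>))"
    by (metis exp_of_nat_mult)
  also have "\<dots> = 1" by (simp add: exp_eq_1)
  finally have "w \<in> {w. \<exists>k>0. exp (of_real t * w) ^ k = 1}"
    using ab(1) by (auto intro!: exI[of _ "nat b"])
  moreover have "Im l < c * q" "c * q < Im l + e"
    using q c by (simp_all add: field_simps)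
  moreover have "w - l = \<i> * of_real (c * q - Im l)"
    using assms(2) by (simp add: complex_eq_iff w_def)
  then have "dist w l = \<bar>c * q - Im l\<bar>"
    by (simp only: dist_norm norm_mult norm_ii norm_of_real) simp
  ultimately show "\<exists>w\<in>{w. \<exists>k>0. exp (of_real t * w) ^ k = 1}. w \<noteq> l \<and> dist w l < e"
    by (intro bexI[of _ w]) auto
qed

text \<open>
  The projection to the first coordinate, kept inside the type of arrays.
\<close>

definition first_row :: "array \<Rightarrow> array"
  where "first_row w = Bcontfun (\<lambda>(i, k). if i = 1 then w (1, k) else 0)"

lemma first_row_apply: "first_row w (i, k) = (if i = 1 then w (1, k) else 0)"
proof -
  have "norm (case q of (i, k) \<Rightarrow> if i = 1 then apply_bcontfun w (1, k) else 0) \<le> norm w" for q :: "nat \<times> nat"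
    by (cases q) (auto simp: norm_bounded)
  from apply_Bcontfun_array[OF this] show ?thesis by (simp add: first_row_def)
qed

lemma first_row_null_rows: "w \<in> null_rows n \<Longrightarrow> first_row w \<in> null_rows 1"
  unfolding null_rows_def by (auto simp: first_row_apply simp del: One_nat_def intro!: tendsto_zero_if)

lemma rows_fun_first_row: "rows_fun \<rho> (first_row w) 1 = rows_fun \<rho> w 1"
  by (simp add: rows_fun_def first_row_apply)

lemma subspace_first_row_image:
  assumes "cvec.subspace Y"
  shows "cvec.subspace (first_row ` Y)"
proof (rule cvec.subspaceI)
  have add: "first_row v + first_row w = first_row (v + w)" for v w
    by (rule array_eqI) (simp add: first_row_apply)
  have scale: "c *\<^sub>C first_row w = first_row (c *\<^sub>C w)" for c w
    by (rule array_eqI) (simp add: first_row_apply scaleC_complex_def)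
  have "first_row 0 = 0" by (rule array_eqI) (simp add: first_row_apply)
  then show "0 \<in> first_row ` Y" using cvec.subspace_0[OF assms] by (metis imageI)
  fix u c assume u: "u \<in> first_row ` Y"
  then show "c *\<^sub>C u \<in> first_row ` Y"
    using cvec.subspace_scale[OF assms] by (auto simp: scale)
  fix v assume "v \<in> first_row ` Y"
  then show "u + v \<in> first_row ` Y"
    using u cvec.subspace_add[OF assms] by (auto simp: add)
qed

definition unit_array :: "nat \<Rightarrow> array"
  where "unit_array m = Bcontfun (\<lambda>(i, k). if i = 1 \<and> k = m then 1 else 0)"

lemma unit_array_apply: "unit_array m (i, k) = (if i = 1 \<and> k = m then 1 else 0)"
proof -
  have "cmod (case q of (i, k) \<Rightarrow> if i = 1 \<and> k = m then 1 else 0) \<le> 1" for q :: "nat \<times> nat"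
    by (cases q) auto
  from apply_Bcontfun_array[OF this] show ?thesis by (simp add: unit_array_def)
qed

lemma unit_array_norm: "norm (unit_array m) \<le> 1"
proof (rule norm_bound)
  fix p :: "nat \<times> nat"
  show "cmod (unit_array m p) \<le> 1" by (cases p) (simp add: unit_array_apply)
qed

text \<open>
  A null sequence is the norm limit of its truncations.
\<close>

lemma null_rows_1_in_closed_subspace:
  assumes L: "cvec.subspace L" "closed L" and unit: "\<And>m. unit_array m \<in> L"
  shows "null_rows 1 \<subseteq> L"
proof
  fix w assume w: "w \<in> null_rows 1"
  define s where "s = (\<lambda>M. \<Sum>m<M. w (1, m) *\<^sub>C unit_array m)"
  have s: "s M (i, k) = (if i = 1 \<and> k < M then w (1, k) else 0)" for M i k
  proof -
    have "s M (i, k) = (\<Sum>m<M. if m = k then (if i = 1 then w (1, k) else 0) else 0)"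
      unfolding s_def array_sum_apply
      by (intro sum.cong refl) (auto simp: unit_array_apply scaleC_complex_def)
    then show ?thesis by (simp add: sum.delta)
  qed
  have "s \<longlonglongrightarrow> w"
  proof (rule LIMSEQ_I)
    fix e :: real assume "e > 0"
    then obtain K where K: "\<And>k. k \<ge> K \<Longrightarrow> cmod (w (1, k)) < e / 2"
      using LIMSEQ_D[OF null_rowsD(1)[OF w], of "e / 2" 1] by auto
    have "norm (s M - w) < e" if "M \<ge> K" for M
    proof -
      have "norm (s M - w) \<le> e / 2"
      proof (rule norm_bound)
        fix p :: "nat \<times> nat"
        obtain i k where p: "p = (i, k)" by (cases p)
        have "cmod (s M (i, k) - w (i, k)) \<le> e / 2"
          using K[of k] that null_rowsD(2)[OF w, of i k] \<open>e > 0\<close>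
          by (cases "i = 1") (auto simp: s less_imp_le)
        then show "cmod ((s M - w) p) \<le> e / 2" by (simp add: p)
      qed
      then show ?thesis using \<open>e > 0\<close> by simp
    qed
    then show "\<exists>K. \<forall>M\<ge>K. norm (s M - w) < e" by blast
  qed
  moreover have "s M \<in> L" for M
    unfolding s_def by (intro cvec.subspace_sum cvec.subspace_scale L unit)
  ultimately show "w \<in> L" using closed_sequentially[OF L(2), of s] by blast
qed

context companion_setting
begin

text \<open>
  The exponentials are a bounded holomorphic family on the disc of radius \<open>\<rho>\<close>. A Moebius transformation
  moves the accumulation point \<open>z\<^sub>0\<close> to the centre, so that one power series represents the family on the
  whole disc; the identity theorem puts its coefficients, and hence all its values, into \<open>L\<close>.
\<close>

lemma exponentials_in_closed_subspace:
  assumes L: "cvec.subspace L" "closed L"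
    and z0: "cmod z\<^sub>0 < \<rho>" "z\<^sub>0 islimpt Z"
    and Z: "\<And>z. z \<in> Z \<Longrightarrow> cmod z < \<rho> \<and> eigen_array 1 0 z \<in> L"
    and w: "cmod w < \<rho>"
  shows "eigen_array 1 0 w \<in> L"
proof -
  define a where "a = z\<^sub>0 / of_real \<rho>"
  have a: "cmod a < 1" using z0(1) rho_pos by (simp add: a_def norm_divide)
  define \<mu> where "\<mu> = Moebius_function 0 (- a)"
  define \<nu> where "\<nu> = Moebius_function 0 a"
  have \<mu>_norm: "cmod (\<mu> s) < 1" if "cmod s < 1" for s
    unfolding \<mu>_def using a that by (intro Moebius_function_norm_lt_1) auto
  have \<nu>_norm: "cmod (\<nu> s) < 1" if "cmod s < 1" for s
    unfolding \<nu>_def using a that by (intro Moebius_function_norm_lt_1) auto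
  have \<mu>\<nu>: "\<mu> (\<nu> s) = s" if "cmod s < 1" for s
    unfolding \<mu>_def \<nu>_def using a that by (intro Moebius_function_compose) auto
  have \<nu>\<mu>: "\<nu> (\<mu> s) = s" if "cmod s < 1" for s
    unfolding \<mu>_def \<nu>_def using a that by (intro Moebius_function_compose) auto
  have \<mu>_hol: "\<mu> holomorphic_on ball 0 1" and \<nu>_hol: "\<nu> holomorphic_on ball 0 1"
    unfolding \<mu>_def \<nu>_def using a by (auto intro: Moebius_function_holomorphic)
  have in_disc: "cmod (of_real \<rho> * \<mu> s) < \<rho>" if "cmod s < 1" for s
    using \<mu>_norm[OF that] rho_pos by (simp add: norm_mult)
  define H where "H = (\<lambda>s. eigen_array 1 0 (of_real \<rho> * \<mu> s))"
  have H_hol: "(\<lambda>s. H s p) holomorphic_on ball 0 1" for p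
  proof (cases p)
    case (Pair i k)
    have "(\<lambda>s. if i \<in> {1..1} then 0 ^ (i - 1) * \<mu> s ^ k else 0) holomorphic_on ball 0 1"
      by (intro holomorphic_on_const_if holomorphic_intros \<mu>_hol)
    then show ?thesis
      by (rule holomorphic_transform) (use Pair rho_pos in_disc in \<open>auto simp: H_def eigen_array_apply\<close>)
  qed
  have H_bound: "norm (H s) \<le> 1" if "s \<in> ball 0 1" for s
    using eigen_array_norm[OF in_disc, of s 1 0] that by (simp add: H_def)
  have "\<exists>u. \<forall>s\<in>ball 0 1. (\<lambda>m. (s - 0) ^ m *\<^sub>C u m) sums H s"
  proof (rule holomorphic_family_power_series[of "1" H "0" "1"])
    show "(\<lambda>s. H s p) holomorphic_on ball 0 1" for p by (rule H_hol)
    show "norm (H s) \<le> 1" if "s \<in> ball 0 1" for s by (rule H_bound[OF that])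
    show "\<exists>u. \<forall>s\<in>ball 0 1. (\<lambda>m. (s - 0) ^ m *\<^sub>C u m) sums H s"
      if "\<And>s. s \<in> ball 0 1 \<Longrightarrow> (\<lambda>m. (s - 0) ^ m *\<^sub>C v m) sums H s" for v
      by (rule exI[of _ v], rule ballI, rule that)
  qed simp
  then obtain u where u: "\<And>s. s \<in> ball 0 1 \<Longrightarrow> (\<lambda>m. (s - 0) ^ m *\<^sub>C u m) sums H s"
    by blast
  define \<Lambda> where "\<Lambda> = (\<lambda>z. \<nu> (z / of_real \<rho>)) ` Z"
  have scaled: "cmod (z / of_real \<rho>) < 1" if "cmod z < \<rho>" for z
    using that rho_pos by (simp add: norm_divide)
  have limpt: "0 islimpt \<Lambda>"
  proof -
    obtain z where z: "\<And>k. z k \<in> Z - {z\<^sub>0}" "z \<longlonglongrightarrow> z\<^sub>0"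
      using z0(2) unfolding islimpt_sequential by blast
    have zk: "cmod (z k / of_real \<rho>) < 1" for k
      using z(1)[of k] by (intro scaled conjunct1[OF Z]) simp
    have zero: "\<nu> a = 0" by (simp add: \<nu>_def Moebius_function_eq_zero)
    have "\<nu> (z k / of_real \<rho>) \<noteq> 0" for k
    proof
      assume "\<nu> (z k / of_real \<rho>) = 0"
      then have "\<mu> (\<nu> (z k / of_real \<rho>)) = \<mu> (\<nu> a)" by (simp add: zero)
      then have "z k / of_real \<rho> = a" by (simp only: \<mu>\<nu>[OF zk] \<mu>\<nu>[OF a])
      then show False using z(1)[of k] rho_pos by (simp add: a_def)
    qed
    moreover have "isCont \<nu> a"
      using holomorphic_on_imp_continuous_on[OF \<nu>_hol] a
      by (simp add: continuous_on_eq_continuous_at)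
    then have "(\<lambda>k. \<nu> (z k / of_real \<rho>)) \<longlonglongrightarrow> \<nu> a"
      by (rule isCont_tendsto_compose) (use rho_pos in \<open>auto simp: a_def intro!: tendsto_intros z(2)\<close>)
    ultimately show ?thesis
      unfolding islimpt_sequential \<Lambda>_def using z(1) zero
      by (rule_tac exI[of _ "\<lambda>k. \<nu> (z k / of_real \<rho>)"]) auto
  qed
  have "u m \<in> L" for m
  proof (rule power_series_coeffs_in_closed_subspace[where c=0 and r=1 and F=H and u=u and \<Lambda>=\<Lambda>, OF _ u L limpt])
    show "(0::real) < 1" by simp
    fix s assume "s \<in> \<Lambda>"
    then obtain z where z: "z \<in> Z" "s = \<nu> (z / of_real \<rho>)" unfolding \<Lambda>_def by blast
    have "of_real \<rho> * \<mu> s = z"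
      using Z[OF z(1)] scaled[of z] rho_pos by (simp add: z(2) \<mu>\<nu>)
    then show "H s \<in> L" using Z[OF z(1)] by (simp add: H_def)
  qed
  then have H_in: "H s \<in> L" if "s \<in> ball 0 1" for s
    by (rule power_series_in_closed_subspace[where u=u and c=0 and z=s and F=H, OF u[OF that] L])
  have "\<nu> (w / of_real \<rho>) \<in> ball 0 1" using \<nu>_norm[OF scaled[OF w]] by simp
  from H_in[OF this] show ?thesis
    using scaled[OF w] rho_pos by (simp add: H_def \<mu>\<nu>)
qed

text \<open>
  The expansion \<open>exp(z x) = \<Sum>\<^sub>m z\<^sup>m x\<^sup>m / m!\<close>; in coefficients the \<open>m\<close>-th monomial is a multiple of a
  unit array.
\<close>

lemma exponential_sums:
  assumes zr: "cmod z < \<rho>"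
  shows "(\<lambda>m. (z - 0) ^ m *\<^sub>C ((1 / of_real \<rho> ^ m) *\<^sub>C unit_array m)) sums eigen_array 1 0 z"
proof -
  define v where "v = (\<lambda>m. (1 / of_real \<rho> ^ m :: complex) *\<^sub>C unit_array m)"
  have "norm ((z - 0) ^ m *\<^sub>C v m) \<le> (cmod z / \<rho>) ^ m" for m
    using mult_left_mono[OF unit_array_norm, of "(cmod z / \<rho>) ^ m" m] rho_pos
    by (simp add: v_def norm_scaleC norm_mult norm_divide norm_power power_divide)
  moreover have "summable (\<lambda>m. (cmod z / \<rho>) ^ m)"
    using zr rho_pos by (intro summable_geometric) simp
  ultimately have "summable (\<lambda>m. (z - 0) ^ m *\<^sub>C v m)"
    by (rule_tac summable_comparison_test'[of "\<lambda>m. (cmod z / \<rho>) ^ m" 0])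
  then have S: "(\<lambda>m. (z - 0) ^ m *\<^sub>C v m) sums (\<Sum>m. (z - 0) ^ m *\<^sub>C v m)" by (rule summable_sums)
  have "(\<Sum>m. (z - 0) ^ m *\<^sub>C v m) = eigen_array 1 0 z"
  proof (rule array_eqI)
    fix i k
    have "(\<lambda>m. apply_bcontfun ((z - 0) ^ m *\<^sub>C v m) (i, k)) sums apply_bcontfun (\<Sum>m. (z - 0) ^ m *\<^sub>C v m) (i, k)"
      by (rule bounded_linear.sums[OF bounded_linear_apply_bcontfun S])
    moreover have "(\<lambda>m. apply_bcontfun ((z - 0) ^ m *\<^sub>C v m) (i, k)) =
        (\<lambda>m. if m = k then eigen_array 1 0 z (i, m) else 0)"
    proof
      fix m
      show "apply_bcontfun ((z - 0) ^ m *\<^sub>C v m) (i, k) = (if m = k then eigen_array 1 0 z (i, m) else 0)"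
        by (simp add: v_def unit_array_apply eigen_array_apply[OF zr] scaleC_complex_def power_divide)
    qed
    then have "(\<lambda>m. apply_bcontfun ((z - 0) ^ m *\<^sub>C v m) (i, k)) sums eigen_array 1 0 z (i, k)"
      using sums_single[of k "\<lambda>m. eigen_array 1 0 z (i, m)"] by (simp only:)
    ultimately show "apply_bcontfun (\<Sum>m. (z - 0) ^ m *\<^sub>C v m) (i, k) = eigen_array 1 0 z (i, k)"
      by (rule sums_unique2)
  qed
  then show ?thesis using S by (simp add: v_def)
qed

text \<open>
  Once \<open>L\<close> contains all exponentials, it contains their Taylor coefficients in \<open>z\<close>, the multiples of the
  unit arrays.
\<close>

lemma exponentials_span_null_rows_1:
  assumes L: "cvec.subspace L" "closed L"
    and z0: "cmod z\<^sub>0 < \<rho>" "z\<^sub>0 islimpt Z"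
    and Z: "\<And>z. z \<in> Z \<Longrightarrow> cmod z < \<rho> \<and> eigen_array 1 0 z \<in> L"
  shows "null_rows 1 \<subseteq> L"
proof (rule null_rows_1_in_closed_subspace[OF L])
  fix m
  define v where "v = (\<lambda>m. (1 / of_real \<rho> ^ m :: complex) *\<^sub>C unit_array m)"
  have sums: "(\<lambda>m. (z - 0) ^ m *\<^sub>C v m) sums eigen_array 1 0 z" if "z \<in> ball 0 \<rho>" for z
    unfolding v_def using that by (intro exponential_sums) simp
  have "v m \<in> L"
  proof (rule power_series_coeffs_in_closed_subspace[OF rho_pos sums L])
    show "0 islimpt (UNIV :: complex set)" by (rule islimpt_UNIV)
    show "eigen_array 1 0 z \<in> L" if "z \<in> ball 0 \<rho>" for z
      by (rule exponentials_in_closed_subspace[OF L z0 Z]) (use that in simp_all)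
  qed
  then have "of_real \<rho> ^ m *\<^sub>C v m \<in> L" by (rule cvec.subspace_scale[OF L(1)])
  then show "unit_array m \<in> L"
    using rho_pos by (simp add: v_def scaleC_scaleC scaleC_one)
qed

text \<open>
  A nonzero resultant at \<open>z\<^sub>0\<close> means that \<open>l\<^sub>0\<close> is not a root of the derivative of \<open>G\<^sub>d\<close> in \<open>z\<close>, so the implicit
  function theorem applies.
\<close>

lemma root_curve:
  assumes "cmod z\<^sub>0 < \<rho>" "Gd n f l\<^sub>0 z\<^sub>0 = 0" "res_Gd n f z\<^sub>0 \<noteq> 0"
  obtains \<delta> g where "\<delta> > 0" "g holomorphic_on ball l\<^sub>0 \<delta>" "g l\<^sub>0 = z\<^sub>0"
    "\<And>l. l \<in> ball l\<^sub>0 \<delta> \<Longrightarrow> g l \<in> ball 0 \<rho> \<and> Gd n f l (g l) = 0"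
proof (rule holomorphic_implicit_function[of "ball 0 \<rho>" z\<^sub>0 "Gd n f" "\<lambda>l z. poly (dGd_poly n f z) l" l\<^sub>0])
  show "(Gd n f l has_field_derivative poly (dGd_poly n f z) l) (at z)" if "z \<in> ball 0 \<rho>" for l z
  proof -
    have "deriv (Gd n f l) z = poly (dGd_poly n f z) l"
      by (intro deriv_Gd holomorphic_on_imp_differentiable_at[OF f_hol_ball open_ball that])
    moreover have "Gd n f l holomorphic_on ball 0 \<rho>"
      by (rule Gd_holomorphic[OF f_hol_ball])
    from holomorphic_derivI[OF this open_ball that]
    have "(Gd n f l has_field_derivative deriv (Gd n f l) z) (at z)" .
    ultimately show ?thesis by simp
  qed
  show "continuous_on (UNIV \<times> ball 0 \<rho>) (\<lambda>(l, z). poly (dGd_poly n f z) l)"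
  proof -
    have "continuous_on (UNIV \<times> ball 0 \<rho>) (\<lambda>p. deriv (f j) (snd p))" if "j \<in> {1..n}" for j
      using holomorphic_on_imp_continuous_on[OF holomorphic_deriv[OF f_hol_ball[OF that] open_ball]]
      by (rule continuous_on_compose2) (auto intro!: continuous_intros)
    then have "continuous_on (UNIV \<times> ball 0 \<rho>) (\<lambda>p. \<Sum>j=1..n. deriv (f j) (snd p) * fst p ^ (j - 1))"
      by (intro continuous_intros) auto
    then show ?thesis by (simp add: dGd_poly_def poly_sum poly_monom case_prod_beta)
  qed
  show "(\<lambda>l. Gd n f l (g l)) holomorphic_on U"
    if "open U" "g holomorphic_on U" "g ` U \<subseteq> ball 0 \<rho>" for g U
  proof -
    have "(\<lambda>l. f j (g l)) holomorphic_on U" if "j \<in> {1..n}" for j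
      using holomorphic_on_compose_gen[OF \<open>g holomorphic_on U\<close> f_hol_ball[OF that] \<open>g ` U \<subseteq> ball 0 \<rho>\<close>]
      by (simp add: o_def)
    then have "(\<lambda>l. (\<Sum>j=1..n. l ^ (j - 1) * f j (g l)) - l ^ n) holomorphic_on U"
      by (intro holomorphic_intros) auto
    then show ?thesis by (simp add: Gd_def)
  qed
  show "poly (dGd_poly n f z\<^sub>0) l\<^sub>0 \<noteq> 0"
    using res_Gd_common_root[OF n_pos assms(2)] assms(3) by blast
qed (use assms that in auto)

text \<open>
  \<open>Y\<close> is the closed span of the Taylor coefficients at \<open>l\<^sub>0\<close> of the family of eigenvectors along the curve
  of roots. By the identity theorem every closed subspace that contains the family on a set accumulating
  at \<open>l\<^sub>0\<close> contains \<open>Y\<close>. So the invariance of \<open>Y\<close> and the density of the eigenvectors of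
  each kind that chaos requires have to be checked only for the family itself, near \<open>l\<^sub>0\<close>.
\<close>

theorem chaotic_eigenvector_space:
  assumes "Re l\<^sub>0 = 0" and root: "cmod z\<^sub>0 < \<rho>" "Gd n f l\<^sub>0 z\<^sub>0 = 0" "res_Gd n f z\<^sub>0 \<noteq> 0"
  obtains Y where "cvec.subspace Y" "closed Y" "Y \<subseteq> null_rows n" "\<And>x. x \<in> Y \<Longrightarrow> companion_array x \<in> Y"
    "Y \<noteq> {0}" "\<And>t. t > 0 \<Longrightarrow> op.chaotic_flow_on t Y" "null_rows 1 \<subseteq> closure (first_row ` Y)"
proof -
  obtain \<delta> g where \<delta>: "\<delta> > 0" and g_hol: "g holomorphic_on ball l\<^sub>0 \<delta>" and g0: "g l\<^sub>0 = z\<^sub>0"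
    and g: "\<And>l. l \<in> ball l\<^sub>0 \<delta> \<Longrightarrow> g l \<in> ball 0 \<rho> \<and> Gd n f l (g l) = 0"
    by (rule root_curve[OF root]) blast
  have gr: "cmod (g l) < \<rho>" if "l \<in> ball l\<^sub>0 \<delta>" for l using g[OF that] by simp
  define F where "F = (\<lambda>l. eigen_array n l (g l))"
  have F_hol: "(\<lambda>l. F l p) holomorphic_on ball l\<^sub>0 \<delta>" for p
  proof (cases p)
    case (Pair i k)
    have "(\<lambda>l. if i \<in> {1..n} then l ^ (i - 1) * (g l / of_real \<rho>) ^ k else 0) holomorphic_on ball l\<^sub>0 \<delta>"
      using rho_pos by (intro holomorphic_on_const_if holomorphic_intros g_hol) auto
    then show ?thesis
      by (rule holomorphic_transform) (simp add: Pair F_def eigen_array_apply[OF gr])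
  qed
  have F_bound: "norm (F l) \<le> (1 + (cmod l\<^sub>0 + \<delta>)) ^ n" if l: "l \<in> ball l\<^sub>0 \<delta>" for l
  proof -
    have "cmod l \<le> cmod l\<^sub>0 + \<delta>"
      using l norm_triangle_ineq[of l\<^sub>0 "l - l\<^sub>0"] by (simp add: dist_norm norm_minus_commute)
    then have "(1 + cmod l) ^ n \<le> (1 + (cmod l\<^sub>0 + \<delta>)) ^ n" by (intro power_mono) auto
    then show ?thesis using eigen_array_norm[OF gr[OF l], of n l] by (simp add: F_def)
  qed
  have "\<exists>u. \<forall>s\<in>ball l\<^sub>0 \<delta>. (\<lambda>m. (s - l\<^sub>0) ^ m *\<^sub>C u m) sums F s"
  proof (rule holomorphic_family_power_series[of "\<delta>" F "l\<^sub>0" "(1 + (cmod l\<^sub>0 + \<delta>)) ^ n"])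
    show "(\<lambda>s. F s p) holomorphic_on ball l\<^sub>0 \<delta>" for p by (rule F_hol)
    show "norm (F s) \<le> (1 + (cmod l\<^sub>0 + \<delta>)) ^ n" if "s \<in> ball l\<^sub>0 \<delta>" for s by (rule F_bound[OF that])
    show "\<exists>u. \<forall>s\<in>ball l\<^sub>0 \<delta>. (\<lambda>m. (s - l\<^sub>0) ^ m *\<^sub>C u m) sums F s"
      if "\<And>s. s \<in> ball l\<^sub>0 \<delta> \<Longrightarrow> (\<lambda>m. (s - l\<^sub>0) ^ m *\<^sub>C v m) sums F s" for v
      by (rule exI[of _ v], rule ballI, rule that)
  qed (rule \<delta>)
  then obtain u where u: "\<And>l. l \<in> ball l\<^sub>0 \<delta> \<Longrightarrow> (\<lambda>m. (l - l\<^sub>0) ^ m *\<^sub>C u m) sums F l"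
    by blast
  define Y where "Y = closure (cvec.span (range u))"
  have Y: "cvec.subspace Y" "closed Y"
    unfolding Y_def by (rule subspace_closure[OF cvec.subspace_span], rule closed_closure)
  have u_Y: "u m \<in> Y" for m
    unfolding Y_def by (rule subsetD[OF closure_subset cvec.span_base]) simp
  have F_Y: "F l \<in> Y" if "l \<in> ball l\<^sub>0 \<delta>" for l
    by (rule power_series_in_closed_subspace[where u=u and c=l\<^sub>0 and z=l and F=F, OF u[OF that] Y u_Y])
  have Y_least: "Y \<subseteq> L" if L: "cvec.subspace L" "closed L" and "l\<^sub>0 islimpt \<Lambda>"
    and "\<And>l. l \<in> \<Lambda> \<Longrightarrow> l \<in> ball l\<^sub>0 \<delta> \<Longrightarrow> F l \<in> L" for L \<Lambda>
  proof -
    have "u m \<in> L" for m by (rule power_series_coeffs_in_closed_subspace[where c=l\<^sub>0 and r=\<delta> and F=F and u=u and \<Lambda>=\<Lambda>, OF \<delta> u that])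
    then show ?thesis unfolding Y_def by (intro closure_span_minimal L) auto
  qed
  have Y_null: "Y \<subseteq> null_rows n"
    by (rule Y_least[OF subspace_null_rows closed_null_rows islimpt_UNIV])
       (simp add: F_def eigen_array_null_rows gr)
  have F_eigen: "companion_array (F l) = l *\<^sub>C F l" if "l \<in> ball l\<^sub>0 \<delta>" for l
    unfolding F_def using g[OF that] by (intro companion_eigen_array) auto
  have Y_inv: "companion_array x \<in> Y" if "x \<in> Y" for x
  proof -
    have "cvec.subspace (companion_array -` Y)"
      by (rule cvec.subspaceI)
         (simp_all add: op.op_add op.op_scaleC cvec.subspace_0[OF Y(1)] cvec.subspace_add[OF Y(1)]
           cvec.subspace_scale[OF Y(1)])
    moreover have "closed (companion_array -` Y)"
      by (rule closed_vimage[OF Y(2)])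
         (rule bounded_linear.continuous_on[OF op.op_bounded_linear continuous_on_id])
    ultimately have "Y \<subseteq> companion_array -` Y"
      by (rule Y_least[OF _ _ islimpt_UNIV]) (simp add: F_eigen F_Y cvec.subspace_scale[OF Y(1)])
    then show ?thesis using that by blast
  qed
  have "F l\<^sub>0 (1, 0) = 1"
    using n_pos \<delta> by (simp add: F_def eigen_array_apply[OF gr])
  then have "F l\<^sub>0 \<noteq> 0" by auto
  then have Y_nz: "Y \<noteq> {0}" using F_Y[of l\<^sub>0] \<delta> by auto
  obtain C where C: "countable C" "C \<subseteq> cvec.span (range u)" "Y \<subseteq> closure C"
    unfolding Y_def by (rule countable_dense_in_closed_span)
  have C_Y: "C \<subseteq> Y" using C(2) closure_subset unfolding Y_def by blast
  have chaos: "op.chaotic_flow_on t Y" if t: "t > 0" for t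
  proof -
    interpret Fl: bounded_operator "op.flow t" "\<Sum>m. cmod (fps_nth (fps_exp (of_real t)) m) * companion_bound ^ m"
      by (rule op.flow_operator)
    have dense: "Y \<subseteq> closure (cvec.span (Fl.eigenvectors_in Y P))"
      if "l\<^sub>0 islimpt \<Lambda>" and P: "\<And>l. l \<in> \<Lambda> \<Longrightarrow> P (exp (of_real t * l))" for \<Lambda> P
    proof (rule Y_least[OF _ closed_closure that(1)])
      show "cvec.subspace (closure (cvec.span (Fl.eigenvectors_in Y P)))"
        by (intro subspace_closure cvec.subspace_span)
      fix l assume l: "l \<in> \<Lambda>" "l \<in> ball l\<^sub>0 \<delta>"
      have "F l \<in> Fl.eigenvectors_in Y P"
        unfolding Fl.eigenvectors_in_def
        using F_Y[OF l(2)] P[OF l(1)] op.flow_eigenvector[OF F_eigen[OF l(2)]] by blast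
      then show "F l \<in> closure (cvec.span (Fl.eigenvectors_in Y P))"
        by (rule subsetD[OF closure_subset cvec.span_base])
    qed
    have "Y \<subseteq> closure (cvec.span (Fl.eigenvectors_in Y (\<lambda>\<mu>. cmod \<mu> < 1)))"
      by (rule dense[OF islimpt_Re_less]) (use assms(1) t in \<open>simp add: mult_pos_neg\<close>)
    moreover have "Y \<subseteq> closure (cvec.span (Fl.eigenvectors_in Y (\<lambda>\<mu>. cmod \<mu> > 1)))"
      by (rule dense[OF islimpt_Re_greater]) (use assms(1) t in simp)
    ultimately have "\<exists>x\<in>Y. Y \<subseteq> closure (range (\<lambda>k. (op.flow t ^^ k) x))"
      by (rule Fl.godefroy_shapiro[OF Y C(1) C_Y C(3)])
    moreover have "Y \<subseteq> closure {x \<in> Y. \<exists>k>0. (op.flow t ^^ k) x = x}"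
      by (rule Fl.periodic_points_dense[OF Y(1) dense[OF islimpt_roots_of_unity[OF t assms(1)]]]) blast
    ultimately show ?thesis unfolding op.chaotic_flow_on_def by blast
  qed
  have proj: "null_rows 1 \<subseteq> closure (first_row ` Y)"
  proof (rule exponentials_span_null_rows_1[OF _ closed_closure root(1)])
    show "cvec.subspace (closure (first_row ` Y))"
      by (intro subspace_closure subspace_first_row_image Y)
    show "z\<^sub>0 islimpt g ` (ball l\<^sub>0 \<delta>)"
    proof -
      \<comment> \<open>The curve is not constant: it meets its value at the base point for finitely many l only.\<close>
      have "l\<^sub>0 islimpt (ball l\<^sub>0 \<delta> - {l. Gd n f l z\<^sub>0 = 0})"
      proof -
        have "l\<^sub>0 islimpt {l. Gd n f l z\<^sub>0 = 0} \<union> (ball l\<^sub>0 \<delta> - {l. Gd n f l z\<^sub>0 = 0})"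
          by (rule islimpt_subset[of _ "ball l\<^sub>0 \<delta>"]) (use \<delta> in \<open>auto simp: islimpt_ball\<close>)
        then show ?thesis
          by (simp only: islimpt_Un_finite[OF finite_Gd_roots[OF n_pos]])
      qed
      then obtain l where l: "\<And>k. l k \<in> ball l\<^sub>0 \<delta> - {l. Gd n f l z\<^sub>0 = 0} - {l\<^sub>0}" "l \<longlonglongrightarrow> l\<^sub>0"
        unfolding islimpt_sequential by blast
      have "isCont g l\<^sub>0"
        using holomorphic_on_imp_continuous_on[OF g_hol] \<delta> by (simp add: continuous_on_eq_continuous_at)
      then have "(\<lambda>k. g (l k)) \<longlonglongrightarrow> z\<^sub>0"
        unfolding g0[symmetric] by (rule isCont_tendsto_compose[OF _ l(2)])
      moreover have "g (l k) \<in> g ` ball l\<^sub>0 \<delta> - {z\<^sub>0}" for k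
      proof -
        have "l k \<in> ball l\<^sub>0 \<delta>" "Gd n f (l k) z\<^sub>0 \<noteq> 0" using l(1)[of k] by simp_all
        then show ?thesis using g[of "l k"] by (metis DiffI imageI singletonD)
      qed
      ultimately show ?thesis
        unfolding islimpt_sequential by (rule_tac exI[of _ "\<lambda>k. g (l k)"]) simp
    qed
    fix z assume "z \<in> g ` ball l\<^sub>0 \<delta>"
    then obtain l where l: "l \<in> ball l\<^sub>0 \<delta>" "z = g l" by blast
    have "first_row (F l) = eigen_array 1 0 z"
      using n_pos by (intro array_eqI) (simp add: first_row_apply F_def l(2) eigen_array_apply[OF gr[OF l(1)]])
    then have "eigen_array 1 0 z \<in> closure (first_row ` Y)"
      using F_Y[OF l(1)] closure_subset by (metis imageI subsetD)
    then show "cmod z < \<rho> \<and> eigen_array 1 0 z \<in> closure (first_row ` Y)"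
      using gr[OF l(1)] l(2) by simp
  qed
  show ?thesis
    by (rule that[OF Y Y_null Y_inv Y_nz chaos proj])
qed

lemma periodic_point_imp_good_root:
  assumes res: "cmod z\<^sub>1 < \<rho>" "res_Gd n f z\<^sub>1 \<noteq> 0"
    and x: "s > 0" "x \<in> null_rows n" "x \<noteq> 0" "op.flow s x = x"
  shows "\<exists>l\<^sub>0 z\<^sub>0. Re l\<^sub>0 = 0 \<and> cmod z\<^sub>0 < \<rho> \<and> Gd n f l\<^sub>0 z\<^sub>0 = 0 \<and> res_Gd n f z\<^sub>0 \<noteq> 0"
proof (rule op.periodic_imp_imaginary_eigenvalue[OF x])
  fix \<mu> y
  assume \<mu>: "Re \<mu> = 0" "y \<in> null_rows n" "y \<noteq> 0" "companion_array y = \<mu> *\<^sub>C y"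
  obtain z where z: "cmod z < \<rho>" "Gd n f \<mu> z = 0"
    using companion_eigenvalue_imp_root[OF res \<mu>(2-4)] by blast
  show ?thesis
    by (rule Gd_root_perturbation[OF n_pos rho_pos f_hol_ball res \<mu>(1) z])
qed

text \<open>
  The space of the previous theorem, mapped to the product space. The closure of its projection is
  \<open>X\<^sub>\<rho>\<close>, since the closure of its first rows contains all null sequences.
\<close>

lemma good_root_imp_chaos:
  assumes root: "Re l\<^sub>0 = 0" "cmod z\<^sub>0 < \<rho>" "Gd n f l\<^sub>0 z\<^sub>0 = 0" "res_Gd n f z\<^sub>0 \<noteq> 0"
  shows "chaotic_projection_family n (herzog_space \<rho>) (herzog_norm \<rho>) op.S"
    and "subchaotic_sg (prod_space n (herzog_space \<rho>)) (prod_norm n (herzog_norm \<rho>)) op.S"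
    and "t > 0 \<Longrightarrow> subchaotic_op (prod_space n (herzog_space \<rho>)) (prod_norm n (herzog_norm \<rho>)) (op.S t)"
proof -
  interpret X: isometric_model "herzog_space \<rho>" "herzog_norm \<rho>" "\<lambda>w. rows_fun \<rho> w 1" "null_rows 1"
    by (rule herzog_model[OF rho_pos])
  obtain Y where Y: "cvec.subspace Y" "closed Y" "Y \<subseteq> null_rows n" "\<And>x. x \<in> Y \<Longrightarrow> companion_array x \<in> Y"
    and Y_nz: "Y \<noteq> {0}" and chaos: "\<And>t. t > 0 \<Longrightarrow> op.chaotic_flow_on t Y"
    and proj: "null_rows 1 \<subseteq> closure (first_row ` Y)"
    by (rule chaotic_eigenvector_space[OF root]) (rule that; blast)
  have sg: "subchaotic_sg_wrt (prod_space n (herzog_space \<rho>)) (prod_norm n (herzog_norm \<rho>)) op.S (rows_fun \<rho> ` Y)"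
    by (rule op.subchaotic_psi(2)[OF Y Y_nz chaos]) simp_all
  have "(\<lambda>F. F 1) ` rows_fun \<rho> ` Y = (\<lambda>w. rows_fun \<rho> w 1) ` first_row ` Y"
    by (simp only: image_image rows_fun_first_row)
  moreover have "first_row ` Y \<subseteq> null_rows 1"
    using Y(3) first_row_null_rows by blast
  moreover have "closure (first_row ` Y) \<inter> null_rows 1 = null_rows 1"
    using proj by blast
  ultimately have "ntop (herzog_space \<rho>) (herzog_norm \<rho>) closure_of ((\<lambda>F. F 1) ` rows_fun \<rho> ` Y) = herzog_space \<rho>"
    by (simp only: X.closure_of_psi X.psi_image)
  then show "chaotic_projection_family n (herzog_space \<rho>) (herzog_norm \<rho>) op.S"
    unfolding chaotic_projection_family_def using sg by (intro exI[of _ "rows_fun \<rho> ` Y"] conjI)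
  show "subchaotic_sg (prod_space n (herzog_space \<rho>)) (prod_norm n (herzog_norm \<rho>)) op.S"
    unfolding subchaotic_sg_def using sg by (rule exI)
  show "t > 0 \<Longrightarrow> subchaotic_op (prod_space n (herzog_space \<rho>)) (prod_norm n (herzog_norm \<rho>)) (op.S t)"
    by (rule op.subchaotic_psi(1)[OF Y Y_nz chaos])
qed

end

theorem theorem4p5:
  fixes \<rho> :: real and n :: nat and f :: "nat \<Rightarrow> complex \<Rightarrow> complex"
  assumes "\<rho> > 0" and "n \<ge> 1"
    and "\<And>j. j \<in> {1..n} \<Longrightarrow> \<exists>U. open U \<and> cball 0 \<rho> \<subseteq> U \<and> f j holomorphic_on U"
    and "\<exists>z. norm z < \<rho> \<and> res_Gd n f z \<noteq> 0"
  shows "let X = herzog_space \<rho>; N = herzog_norm \<rho>;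
             Xn = prod_space n X; Nn = prod_norm n N;
             A = companion_op \<rho> n f;
             S = exp_semigroup Xn Nn A;
             i = generates Xn Nn A S \<and> subchaotic_sg Xn Nn S \<and> chaotic_projection_family n X N S;
             ii = (\<exists>l\<^sub>0 z\<^sub>0. Re l\<^sub>0 = 0 \<and> norm z\<^sub>0 < \<rho> \<and> Gd n f l\<^sub>0 z\<^sub>0 = 0 \<and> res_Gd n f z\<^sub>0 \<noteq> 0);
             iii = (\<forall>t\<^sub>0>0. subchaotic_op Xn Nn (S t\<^sub>0));
             iv = (\<exists>t\<^sub>0>0. subchaotic_op Xn Nn (S t\<^sub>0))
         in (i \<longleftrightarrow> ii) \<and> (ii \<longleftrightarrow> iii) \<and> (iii \<longleftrightarrow> iv)"
proof -
  interpret companion_setting \<rho> n f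
    by standard (use assms(1-3) in auto)
  define ii where "ii \<longleftrightarrow> (\<exists>l\<^sub>0 z\<^sub>0. Re l\<^sub>0 = 0 \<and> norm z\<^sub>0 < \<rho> \<and> Gd n f l\<^sub>0 z\<^sub>0 = 0 \<and> res_Gd n f z\<^sub>0 \<noteq> 0)"
  obtain z\<^sub>1 where z1: "cmod z\<^sub>1 < \<rho>" "res_Gd n f z\<^sub>1 \<noteq> 0" using assms(4) by blast
  have periodic: ii if "s > 0" "x \<in> null_rows n" "x \<noteq> 0" "op.flow s x = x" for s x
    unfolding ii_def by (rule periodic_point_imp_good_root[OF z1 that])
  have sg: ii if "subchaotic_sg (prod_space n (herzog_space \<rho>)) (prod_norm n (herzog_norm \<rho>)) op.S"
    by (rule op.subchaotic_sg_imp_periodic[OF that]) (rule periodic)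
  have op: ii if "subchaotic_op (prod_space n (herzog_space \<rho>)) (prod_norm n (herzog_norm \<rho>)) (op.S t)" "t > 0" for t
    by (rule op.subchaotic_op_imp_periodic[OF that]) (rule periodic)
  have iv: ii if "\<exists>t>0. subchaotic_op (prod_space n (herzog_space \<rho>)) (prod_norm n (herzog_norm \<rho>)) (op.S t)"
    using that by (elim exE conjE) (rule op)
  have chaos: "chaotic_projection_family n (herzog_space \<rho>) (herzog_norm \<rho>) op.S"
    "subchaotic_sg (prod_space n (herzog_space \<rho>)) (prod_norm n (herzog_norm \<rho>)) op.S"
    "\<forall>t>0. subchaotic_op (prod_space n (herzog_space \<rho>)) (prod_norm n (herzog_norm \<rho>)) (op.S t)" if ii
    using that good_root_imp_chaos unfolding ii_def by blast+
  have some: "\<exists>t>0. subchaotic_op (prod_space n (herzog_space \<rho>)) (prod_norm n (herzog_norm \<rho>)) (op.S t)"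
    if "\<forall>t>0. subchaotic_op (prod_space n (herzog_space \<rho>)) (prod_norm n (herzog_norm \<rho>)) (op.S t)"
    by (rule exI[of _ 1]) (simp add: that)
  \<comment> \<open>Chaos of the semigroup or of one time map gives the root; the root gives everything else.\<close>
  have cycle: "(g \<and> a \<and> p \<longleftrightarrow> q) \<and> (q \<longleftrightarrow> u) \<and> (u \<longleftrightarrow> v)"
    if g "a \<Longrightarrow> q" "q \<Longrightarrow> p" "q \<Longrightarrow> a" "q \<Longrightarrow> u" "u \<Longrightarrow> v" "v \<Longrightarrow> q" for g a p q u v
    using that by blast
  show ?thesis
    unfolding Let_def ii_def[symmetric]
    by (rule cycle[OF op.generates_exp_semigroup sg chaos some iv])
qed

end
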